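(* Let $a_1,a_2,b_1,b_2,\alpha\in\mathbb C$ be such that either $a_1a_2=0$ or $2-\frac{4a_1}{a_2}\notin\mathbb N\setminus\{1,2,3,4,6\}$. Then Hayman's conjecture holds for the ordinary differential equation $$[D-(a_2u+b_2)]\,[D-(a_1u+b_1)]\,(u-\alpha)=0,\qquad u=u(z),\ D=\frac{d}{dz},$$ i.e. for every meromorphic solution $u$ of this equation there exist $a,b,c\in\mathbb R^+$ such that $$T(r,u)<a\exp(b\,r^c),\qquad 0\le r<\infty.$$ Moreover, it is sharp in certain cases: there exist parameters $a_1,a_2,b_1,b_2,\alpha\in\mathbb C$ satisfying either $a_1a_2=0$ or $2-\frac{4a_1}{a_2}\notin\mathbb N\setminus\{1,2,3,4,6\}$ for which the equation $[D-(a_2u+b_2)]\,[D-(a_1u+b_1)]\,(u-\alpha)=0$ has a meromorphic solution $u$ such that, for some $A,B,C>0$, $T(r,u)\ge A\exp(B\,r^{C})$ for all sufficiently large $r$.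
   Context: "Meromorphic" means meromorphic on the whole complex plane $\mathbb C$. $\mathbb N=\{1,2,3,\dots\}$. The operator $[D-g(u)]$ acts on a function $F$ by $[D-g(u)]F=F'-g(u)F$; the operators are applied from right to left starting from $u-\alpha$. $T(r,f)$ is the Nevanlinna characteristic of $f$ (its value at $r=0$ being understood as the limit as $r\to0^+$). *)

theory Defs
  imports "HOL-Complex_Analysis.Complex_Analysis"
begin

text \<open>The real logarithm is total in HOL with \<open>ln 0 = 0\<close>, so \<open>log_plus 0 = 0\<close>, as usual.\<close>

definition log_plus :: "real \<Rightarrow> real" where
  "log_plus x = max 0 (ln x)"

definition proximity :: "real \<Rightarrow> (complex \<Rightarrow> complex) \<Rightarrow> real" where
  "proximity r f =
     1 / (2 * pi) * integral {0..2 * pi} (\<lambda>\<theta>. log_plus (cmod (f (of_real r * cis \<theta>))))"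

text \<open>Number of poles in the closed disc of radius \<open>t\<close>, counted with multiplicity; the order
  of a pole is \<open>- zorder f z\<close>. For a meromorphic function on the plane the index set is finite.\<close>

definition pole_count :: "real \<Rightarrow> (complex \<Rightarrow> complex) \<Rightarrow> nat" where
  "pole_count t f = (\<Sum>z | cmod z \<le> t \<and> is_pole f z. nat (- zorder f z))"

definition pole_counting :: "real \<Rightarrow> (complex \<Rightarrow> complex) \<Rightarrow> real" where
  "pole_counting r f =
     integral {0..r} (\<lambda>t. (real (pole_count t f) - real (pole_count 0 f)) / t)
     + real (pole_count 0 f) * ln r"

text \<open>For \<open>r = 0\<close> the characteristic is the limit from the right. (If \<open>f\<close> has a pole at
  the origin, the defining formula is not meaningful there.)\<close>

definition nevanlinna_T :: "real \<Rightarrow> (complex \<Rightarrow> complex) \<Rightarrow> real" where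
  "nevanlinna_T r f =
     (if r = 0 then Lim (at_right 0) (\<lambda>s. proximity s f + pole_counting s f)
      else proximity r f + pole_counting r f)"

definition D_minus ::
    "(complex \<Rightarrow> complex) \<Rightarrow> (complex \<Rightarrow> complex) \<Rightarrow> (complex \<Rightarrow> complex) \<Rightarrow> complex \<Rightarrow> complex" where
  "D_minus g u F = (\<lambda>z. deriv F z - g (u z) * F z)"

text \<open>A meromorphic function on the plane is represented by its normal form: continuous
  (hence analytic) away from its poles, with the dummy value 0 at the poles. The equation is an
  identity of meromorphic functions, so it is required at every point that is not a pole of \<open>u\<close>;
  at such a point \<open>u\<close> is analytic and all the derivatives are genuine.\<close>

definition meromorphic_solution ::
    "complex \<Rightarrow> complex \<Rightarrow> complex \<Rightarrow> complex \<Rightarrow> complex \<Rightarrow> (complex \<Rightarrow> complex) \<Rightarrow> bool" where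
  "meromorphic_solution a1 a2 b1 b2 \<alpha> u \<longleftrightarrow>
     u nicely_meromorphic_on UNIV \<and>
     (\<forall>z. \<not> is_pole u z \<longrightarrow>
        D_minus (\<lambda>w. a2 * w + b2) u (D_minus (\<lambda>w. a1 * w + b1) u (\<lambda>x. u x - \<alpha>)) z = 0)"

definition admissible :: "complex \<Rightarrow> complex \<Rightarrow> bool" where
  "admissible a1 a2 \<longleftrightarrow>
     a1 * a2 = 0 \<or> 2 - 4 * a1 / a2 \<notin> of_nat ` ({1..} - {1, 2, 3, 4, 6})"

end

(* Put v0 = u' - (a1 u + b1)(u - alpha), so that v0' = (a2 u + b2) v0. If v0 is an exponential, or if
   a1 = a2, the substitution u - alpha = - F'/(a1 F) linearises the problem and u is a quotient of
   entire functions of at most doubly exponential growth. Otherwise l = a2 u + b2 and v = a2 v0 satisfy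
   v' = l v and l' = v + k l^2 + p l + q with k = a1/a2, and every pole of v is double. Cauchy's
   estimates, applied where a weighted |v| is nearly maximal, bound v by a polynomial times
   dist(z, poles)^(-2). So v is a quotient of functions whose size is governed by the number of poles
   in a disc, and it remains to separate the poles. If 2 - 4k is not a positive integer, the Laurent
   expansion at a pole is unique, all poles are translates of one another and their distances are
   bounded below. If 2 - 4k is 1, 2, 3, 4 or 6, the existence of a pole forces relations between p and q
   under which there is a first integral; it shows that 1/v is close to a parabola near a pole as long
   as |v| is large, so poles in |z| <= R have distances at least c exp(-K R). *)
theory Submission
  imports Defs "HOL-Real_Asymp.Real_Asymp"
begin

subsection \<open>Jensen's inequality and the characteristic of a quotient\<close>

text \<open>Only Jensen's formula enters from value distribution theory: a quotient F/G with |F|,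
  |G| <= M on |z| = r has characteristic at most log M - log|G(0)|, up to a correction for a zero of
  G at 0. So \<open>u\<close> may be a different quotient for each radius, provided the denominators
  stay bounded below at 0. Since \<open>l v = v'\<close>, the functions v' and v serve as numerator
  and denominator once the poles of \<open>v\<close> are cleared; poles of \<open>l\<close> at which
  \<open>v\<close> vanishes are zeros of the denominator and are never counted. Weight 1 for
  \<open>l\<close> and 2 for \<open>v\<close> makes the leading terms homogeneous, whence the double
  poles and the exponent -2. The number 2 - 4k is the resonance of the Laurent expansion: the
  coefficient of that order is not determined by the earlier ones, so poles need not be translates
  of each other and uniqueness says nothing about their distances. For 1, 2, 3, 4 and 6 the
  compatibility condition at the resonance yields a first integral, quadratic in \<open>l\<close>
  except in one case with k = -1. Exponentially decaying separation is enough: it leaves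
  exponentially many poles in a disc, and the logarithm of the clearing product is of that
  size.\<close>

lemma finite_poles_cball:
  assumes "u meromorphic_on UNIV"
  shows "finite {z. cmod z \<le> t \<and> is_pole u z}"
proof -
  have "{z. is_pole u z} sparse_in UNIV"
    using meromorphic_on_imp_not_pole_cosparse[OF assms] by (simp add: eventually_cosparse)
  then have "{z. is_pole u z} sparse_in cball 0 t"
    using sparse_in_subset by blast
  then have "finite (cball 0 t \<inter> {z. is_pole u z})"
    by (rule sparse_in_compact_finite) auto
  then show ?thesis
    by (rule rev_finite_subset) auto
qed

lemma has_integral_reciprocal_from:
  fixes p r :: real
  assumes "0 < p" "p \<le> r"
  shows "((\<lambda>t. if p \<le> t then 1 / t else 0) has_integral ln (r / p)) {0..r}"
proof -
  have "((\<lambda>t. 1 / t) has_integral (ln r - ln p)) {p..r}"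
  proof (rule fundamental_theorem_of_calculus)
    show "p \<le> r" by fact
    fix x assume "x \<in> {p..r}"
    then have "x > 0" using assms by auto
    then show "(ln has_vector_derivative 1 / x) (at x within {p..r})"
      by (auto intro!: derivative_eq_intros has_vector_derivative_at_within
               simp: has_real_derivative_iff_has_vector_derivative[symmetric] field_simps)
  qed
  moreover have "ln r - ln p = ln (r / p)"
    using assms by (simp add: ln_div)
  ultimately have "((\<lambda>t. if t \<in> {p..r} then 1 / t else 0) has_integral ln (r / p)) {0..r}"
    using has_integral_restrict[of "{p..r}" "{0..r}" "\<lambda>t. 1 / t"] assms by auto
  then show ?thesis
    by (rule has_integral_eq[rotated]) auto
qed

text \<open>Integration in \<open>t\<close> is exchanged with the finite sum over the poles: a pole
  at \<open>p\<close> enters the integrand only for \<open>t\<close> at least \<open>cmod p\<close>,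
  where 1/t integrates to ln(r / cmod p). In this form poles can be compared one by one with the
  zeros of a denominator.\<close>

lemma pole_counting_eq:
  assumes mero: "u meromorphic_on UNIV" and r: "r > 0"
  shows "pole_counting r u =
    (\<Sum>p | cmod p \<le> r \<and> is_pole u p \<and> p \<noteq> 0. real (nat (- zorder u p)) * ln (r / cmod p))
      + real (pole_count 0 u) * ln r"
proof -
  define P where "P = {p. cmod p \<le> r \<and> is_pole u p \<and> p \<noteq> 0}"
  have finP: "finite P"
    unfolding P_def by (rule rev_finite_subset[OF finite_poles_cball[OF mero, of r]]) auto
  define n where "n = (\<lambda>p. nat (- zorder u p))"
  have 0: "pole_count 0 u = (\<Sum>z\<in>{z. z = 0 \<and> is_pole u z}. n z)"
    unfolding pole_count_def n_def by (rule sum.cong) auto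
  have eq: "(real (pole_count t u) - real (pole_count 0 u)) / t =
       (\<Sum>p\<in>P. real (n p) * (if cmod p \<le> t then 1 / t else 0))" if "t \<in> {0..r}" for t
  proof -
    let ?Q = "{p \<in> P. cmod p \<le> t}"
    have "pole_count t u = (\<Sum>p\<in>?Q \<union> {z. z = 0 \<and> is_pole u z}. n p)"
      unfolding pole_count_def n_def by (rule sum.cong) (use that in \<open>auto simp: P_def\<close>)
    also have "\<dots> = (\<Sum>p\<in>?Q. n p) + (\<Sum>z\<in>{z. z = 0 \<and> is_pole u z}. n z)"
    proof (rule sum.union_disjoint)
      show "finite ?Q" using finP by simp
    qed (auto simp: P_def)
    finally have "real (pole_count t u) - real (pole_count 0 u) = (\<Sum>p\<in>?Q. real (n p))"
      using 0 by simp
    then have "(real (pole_count t u) - real (pole_count 0 u)) / t = (\<Sum>p\<in>?Q. real (n p) * (1 / t))"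
      by (simp add: sum_divide_distrib)
    also have "\<dots> = (\<Sum>p\<in>P. if cmod p \<le> t then real (n p) * (1 / t) else 0)"
      using finP by (rule sum.inter_filter)
    also have "\<dots> = (\<Sum>p\<in>P. real (n p) * (if cmod p \<le> t then 1 / t else 0))"
      by (rule sum.cong) auto
    finally show ?thesis .
  qed
  have "((\<lambda>t. \<Sum>p\<in>P. real (n p) * (if cmod p \<le> t then 1 / t else 0)) has_integral
          (\<Sum>p\<in>P. real (n p) * ln (r / cmod p))) {0..r}"
    by (intro has_integral_sum finP has_integral_mult_right has_integral_reciprocal_from)
       (auto simp: P_def)
  then have "((\<lambda>t. (real (pole_count t u) - real (pole_count 0 u)) / t) has_integral
          (\<Sum>p\<in>P. real (n p) * ln (r / cmod p))) {0..r}"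
    by (rule has_integral_eq[rotated]) (simp add: eq)
  then show ?thesis
    unfolding pole_counting_def by (simp add: integral_unique P_def n_def)
qed

lemma circle_mean_value:
  fixes L :: "complex \<Rightarrow> complex"
  assumes "L holomorphic_on ball 0 R" "0 < r" "r < R"
  shows "((\<lambda>\<theta>. L (of_real r * cis \<theta>)) has_integral 2 * pi * L 0) {0..2 * pi}"
proof -
  have "L holomorphic_on cball 0 r"
    by (rule holomorphic_on_subset[OF assms(1)]) (use assms in auto)
  then have "((\<lambda>u. L u / (u - 0)) has_contour_integral (2 * of_real pi * \<i> * L 0)) (part_circlepath 0 r 0 (2 * pi))"
    unfolding circlepath_def[symmetric] by (rule Cauchy_integral_circlepath_simple) (use assms in auto)
  then have "((\<lambda>t. L (0 + of_real r * cis t) / (0 + of_real r * cis t - 0) * of_real r * \<i> * cis t)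
      has_integral 2 * of_real pi * \<i> * L 0) {0..2 * pi}"
    by (rule has_contour_integral_part_circlepath_iff[THEN iffD1, rotated]) simp
  then have "((\<lambda>t. \<i> * L (of_real r * cis t)) has_integral 2 * of_real pi * \<i> * L 0) {0..2 * pi}"
    by (rule has_integral_eq[rotated]) (use assms in auto)
  then have "((\<lambda>t. (- \<i>) * (\<i> * L (of_real r * cis t))) has_integral (- \<i>) * (2 * of_real pi * \<i> * L 0)) {0..2 * pi}"
    by (rule has_integral_mult_right)
  moreover have "- \<i> * (2 * of_real pi * \<i> * L 0) = 2 * pi * L 0"
    by (simp add: algebra_simps)
  ultimately have "((\<lambda>t. (- \<i>) * (\<i> * L (of_real r * cis t))) has_integral 2 * pi * L 0) {0..2 * pi}"
    by metis
  then show ?thesis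
    by (rule has_integral_eq[rotated]) simp
qed

lemma circle_mean_ln_norm:
  fixes B :: "complex \<Rightarrow> complex"
  assumes "B holomorphic_on ball 0 R" "0 < r" "r < R" "\<And>z. z \<in> ball 0 R \<Longrightarrow> B z \<noteq> 0"
  shows "((\<lambda>\<theta>. ln (cmod (B (of_real r * cis \<theta>)))) has_integral 2 * pi * ln (cmod (B 0))) {0..2 * pi}"
proof -
  have "0 < R" using assms by auto
  obtain L where L: "L holomorphic_on ball 0 R" "\<And>z. z \<in> ball 0 R \<Longrightarrow> B z = exp (L z)"
    using contractible_imp_holomorphic_log[OF assms(1) _ assms(4)]
    by (metis convex_ball convex_imp_contractible)
  have ln: "ln (cmod (B z)) = Re (L z)" if "z \<in> ball 0 R" for z
    using L(2)[OF that] by (simp add: norm_exp_eq_Re)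
  have "((\<lambda>\<theta>. Re (L (of_real r * cis \<theta>))) has_integral Re (2 * pi * L 0)) {0..2 * pi}"
    by (rule has_integral_Re[OF circle_mean_value[OF L(1) assms(2,3)]])
  moreover have "Re (2 * pi * L 0) = 2 * pi * ln (cmod (B 0))"
    using ln[of 0] \<open>0 < R\<close> by simp
  ultimately have "((\<lambda>\<theta>. Re (L (of_real r * cis \<theta>))) has_integral 2 * pi * ln (cmod (B 0))) {0..2 * pi}"
    by simp
  then show ?thesis
    by (rule has_integral_eq[rotated]) (use assms in \<open>simp add: ln norm_mult\<close>)
qed

text \<open>\<open>B\<close> may vanish on the circle itself and \<open>f\<close> is arbitrary apart
  from its bounds. On the circles of radius \<open>\<rho> n * r\<close> inside, ln|B| has the exact
  mean ln|B(0)|; Fatou's lemma carries this to radius \<open>r\<close> as a one-sided inequality, so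
  zeros on the circle need no separate treatment.\<close>

lemma jensen_upper_bound:
  fixes B :: "complex \<Rightarrow> complex" and f :: "real \<Rightarrow> real"
  assumes hol: "B holomorphic_on ball 0 R" and r: "0 < r" "r < R"
    and nz: "\<And>z. z \<in> ball 0 r \<Longrightarrow> B z \<noteq> 0"
    and bd: "\<And>z. cmod z = r \<Longrightarrow> cmod (B z) \<le> M"
    and f0: "\<And>\<theta>. f \<theta> \<ge> 0"
    and fB: "\<And>\<theta>. cmod (B (of_real r * cis \<theta>)) * exp (f \<theta>) \<le> M"
  shows "integral {0..2 * pi} f \<le> 2 * pi * (ln M - ln (cmod (B 0)))"
proof -
  have maxmod: "cmod (B z) \<le> M" if "z \<in> cball 0 r" for z
  proof (rule maximum_modulus_frontier[of B "cball 0 r"])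
    show "B holomorphic_on interior (cball 0 r)"
      by (rule holomorphic_on_subset[OF hol]) (use r in auto)
    show "continuous_on (closure (cball 0 r)) B"
      by (rule continuous_on_subset[OF holomorphic_on_imp_continuous_on[OF hol]]) (use r in auto)
  qed (use that bd in auto)
  have B0: "B 0 \<noteq> 0"
    by (rule nz) (use r in auto)
  then have M: "M > 0"
    using maxmod[of 0] r by (auto simp: le_less_trans norm_le_zero_iff)
       (metis less_le_trans zero_less_norm_iff)
  have rhs: "ln M - ln (cmod (B 0)) \<ge> 0"
    using maxmod[of 0] r B0 M by simp
  define \<rho> where "\<rho> = (\<lambda>n::nat. 1 - 1 / (real n + 2))"
  have \<rho>: "0 < \<rho> n" "\<rho> n < 1" for n
    by (auto simp: \<rho>_def field_simps)
  have \<rho>lim: "\<rho> \<longlonglongrightarrow> 1"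
    unfolding \<rho>_def by real_asymp
  define g where "g = (\<lambda>n \<theta>. ln M - ln (cmod (B (of_real (\<rho> n) * (of_real r * cis \<theta>)))))"
  have inb: "of_real (\<rho> n) * (of_real r * cis \<theta>) \<in> ball (0::complex) r" for n \<theta>
    using r \<rho>[of n] by (simp add: norm_mult)
  have gint: "(g n has_integral 2 * pi * (ln M - ln (cmod (B 0)))) {0..2 * pi}" for n
  proof -
    have "((\<lambda>\<theta>. ln (cmod (B (of_real (\<rho> n) * (of_real r * cis \<theta>))))) has_integral
             2 * pi * ln (cmod (B (of_real (\<rho> n) * 0)))) {0..2 * pi}"
    proof (rule circle_mean_ln_norm[of "\<lambda>z. B (of_real (\<rho> n) * z)" "r / \<rho> n" r])
      show "(\<lambda>z. B (of_real (\<rho> n) * z)) holomorphic_on ball 0 (r / \<rho> n)"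
      proof (rule holomorphic_on_compose_gen[OF _ hol, unfolded o_def])
        show "(*) (complex_of_real (\<rho> n)) holomorphic_on ball 0 (r / \<rho> n)"
          by (intro holomorphic_intros)
        show "(*) (complex_of_real (\<rho> n)) ` ball 0 (r / \<rho> n) \<subseteq> ball 0 R"
          using r \<rho>[of n] by (auto simp: norm_mult field_simps)
      qed
      show "r < r / \<rho> n" using r \<rho>[of n] by (simp add: field_simps)
      fix z :: complex assume "z \<in> ball 0 (r / \<rho> n)"
      then show "B (of_real (\<rho> n) * z) \<noteq> 0"
        using \<rho>[of n] by (intro nz) (auto simp: norm_mult field_simps)
    qed (use r in auto)
    from has_integral_diff[OF has_integral_const_real[of "ln M" 0 "2 * pi"] this]
    show ?thesis
      using r by (simp add: g_def algebra_simps)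
  qed
  have g0: "g n \<theta> \<ge> 0" for n \<theta>
    using maxmod[of "of_real (\<rho> n) * (of_real r * cis \<theta>)"] inb[of n \<theta>] nz[OF inb[of n \<theta>]] M
    by (simp add: g_def)
  show ?thesis
  proof (cases "f integrable_on {0..2 * pi}")
    \<comment> \<open>The integral of a non-integrable function is 0 by convention, and the
      right-hand side is nonnegative by the maximum principle.\<close>
    case False
    then show ?thesis using rhs by (simp add: not_integrable_integral)
  next
    case True
    have "ennreal (integral {0..2 * pi} f) = (\<integral>\<^sup>+ x. indicator {0..2 * pi} x * ennreal (f x) \<partial>lebesgue)"
      using nn_integral_has_integral_lebesgue[OF f0 integrable_integral[OF True]]
      by (simp add: nn_integral_completion ennreal_mult' ennreal_indicator)
    also have "\<dots> \<le> (\<integral>\<^sup>+ x. liminf (\<lambda>n. indicator {0..2 * pi} x * ennreal (g n x)) \<partial>lebesgue)"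
    proof (rule nn_integral_mono)
      fix x :: real
      show "indicator {0..2 * pi} x * ennreal (f x)
             \<le> liminf (\<lambda>n. indicator {0..2 * pi} x * ennreal (g n x))"
      proof (cases "x \<in> {0..2 * pi}")
        case True
        \<comment> \<open>Pointwise comparison for Fatou: at a zero of \<open>B\<close> on the
          circle \<open>g n x\<close> tends to infinity, so it is compared with each
          \<open>t\<close> strictly below \<open>f x\<close>, for which |B| exp t < M holds with
          strict inequality in all cases.\<close>
        have "eventually (\<lambda>n. y < ennreal (g n x)) sequentially" if y: "y < ennreal (f x)" for y
        proof -
          obtain t where t: "y = ennreal t" "0 \<le> t" "t < f x"
            using y by (metis ennreal_cases ennreal_less_iff ennreal_less_top less_asym top.not_eq_extremum)
          have lim: "(\<lambda>n. cmod (B (of_real (\<rho> n) * (of_real r * cis x))) * exp t)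
              \<longlonglongrightarrow> cmod (B (of_real 1 * (of_real r * cis x))) * exp t"
          proof (intro tendsto_intros)
            have "isCont B (of_real 1 * (of_real r * cis x))"
              using hol r by (intro holomorphic_on_imp_continuous_on[THEN continuous_on_interior])
                 (auto simp: norm_mult)
            then show "(\<lambda>n. B (of_real (\<rho> n) * (of_real r * cis x)))
                \<longlonglongrightarrow> B (of_real 1 * (of_real r * cis x))"
              by (rule isCont_tendsto_compose) (intro tendsto_intros \<rho>lim)
          qed
          have "cmod (B (of_real 1 * (of_real r * cis x))) * exp t < M"
          proof (cases "B (of_real r * cis x) = 0")
            case False
            then have "cmod (B (of_real r * cis x)) * exp t < cmod (B (of_real r * cis x)) * exp (f x)"
              using t by simp
            then show ?thesis using fB[of x] by simp
          qed (use M in auto)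
          from order_tendstoD(2)[OF lim this]
          show ?thesis
          proof eventually_elim
            case (elim n)
            let ?b = "cmod (B (of_real (\<rho> n) * (of_real r * cis x)))"
            have b: "?b > 0" using nz[OF inb[of n x]] by simp
            have "ln (?b * exp t) < ln M"
              using elim b M by simp
            then have "t < g n x"
              using b by (simp add: g_def ln_mult)
            then show ?case using t by (simp add: ennreal_less_iff)
          qed
        qed
        then show ?thesis
          using True by (auto simp: le_Liminf_iff)
      qed auto
    qed
    also have "\<dots> \<le> liminf (\<lambda>n. \<integral>\<^sup>+ x. indicator {0..2 * pi} x * ennreal (g n x) \<partial>lebesgue)"
    proof (rule nn_integral_liminf)
      fix n
      have "(\<lambda>x. indicator {0..2 * pi} x * g n x) \<in> borel_measurable lebesgue"
        using has_integral_implies_lebesgue_measurable_real[OF gint[of n]]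
        by (simp add: mult.commute)
      then have "(\<lambda>x. ennreal (indicator {0..2 * pi} x * g n x)) \<in> borel_measurable lebesgue"
        by simp
      then show "(\<lambda>x. indicator {0..2 * pi} x * ennreal (g n x)) \<in> borel_measurable lebesgue"
        by (simp add: ennreal_mult' ennreal_indicator)
    qed
    also have "(\<lambda>n. \<integral>\<^sup>+ x. indicator {0..2 * pi} x * ennreal (g n x) \<partial>lebesgue)
        = (\<lambda>n. ennreal (2 * pi * (ln M - ln (cmod (B 0)))))"
      using nn_integral_has_integral_lebesgue[OF g0 gint]
      by (simp add: nn_integral_completion ennreal_mult' ennreal_indicator)
    also have "liminf \<dots> = ennreal (2 * pi * (ln M - ln (cmod (B 0))))"
      by (simp add: Liminf_const)
    finally show ?thesis
      using rhs by (simp add: ennreal_le_iff mult_nonneg_nonneg)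
  qed
qed

lemma holomorphic_factor_at:
  assumes hol: "G holomorphic_on S" and S: "open S" "connected S" and a: "a \<in> S"
    and nz: "\<exists>w\<in>S. G w \<noteq> 0"
  obtains n H where "H holomorphic_on S" "H a \<noteq> 0" "\<And>z. z \<in> S \<Longrightarrow> G z = (z - a) ^ n * H z"
proof -
  define n where "n = nat (zorder G a)"
  obtain r where r: "r > 0" "cball a r \<subseteq> S" "zor_poly G a holomorphic_on cball a r"
      "\<And>w. w \<in> cball a r \<Longrightarrow> G w = zor_poly G a w * (w - a) ^ n \<and> zor_poly G a w \<noteq> 0"
    using zorder_exist_zero[OF hol S a nz] unfolding n_def by blast
  define H where "H = (\<lambda>z. if z \<in> ball a r then zor_poly G a z else G z / (z - a) ^ n)"
  have "H holomorphic_on ball a r \<union> (S - {a})"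
  proof (rule holomorphic_on_Un)
    show "H holomorphic_on ball a r"
      by (rule holomorphic_transform[OF holomorphic_on_subset[OF r(3)]]) (auto simp: H_def)
    have "(\<lambda>z. G z / (z - a) ^ n) holomorphic_on S - {a}"
      by (intro holomorphic_intros holomorphic_on_subset[OF hol]) auto
    then show "H holomorphic_on S - {a}"
      by (rule holomorphic_transform) (use r(4) in \<open>auto simp: H_def\<close>)
  qed (use S in auto)
  moreover have "ball a r \<union> (S - {a}) = S"
    using r a by auto
  ultimately have "H holomorphic_on S" by simp
  moreover have "H a \<noteq> 0" using r by (simp add: H_def)
  moreover have "G z = (z - a) ^ n * H z" if "z \<in> S" for z
    using r(1) r(4)[of z] by (cases "z = a") (auto simp: H_def)
  ultimately show ?thesis using that by blast
qed

lemma holomorphic_factor_finite: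
  assumes "finite Z" and hol: "G holomorphic_on S" and S: "open S" "connected S" and "Z \<subseteq> S"
    and nz: "\<exists>w\<in>S. G w \<noteq> 0"
  shows "\<exists>m H. H holomorphic_on S \<and> (\<forall>a\<in>Z. H a \<noteq> 0) \<and>
           (\<forall>z\<in>S. G z = (\<Prod>a\<in>Z. (z - a) ^ m a) * H z)"
  using assms(1,5)
proof (induction Z)
  case empty
  then show ?case using hol by auto
next
  case (insert a Z)
  then obtain m H where H: "H holomorphic_on S" "\<And>a. a \<in> Z \<Longrightarrow> H a \<noteq> 0"
      "\<And>z. z \<in> S \<Longrightarrow> G z = (\<Prod>a\<in>Z. (z - a) ^ m a) * H z"
    by blast
  have "a \<in> S" using insert.prems by simp
  have Hnz: "\<exists>w\<in>S. H w \<noteq> 0"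
    using nz H(3) by (metis mult_zero_right)
  obtain n K where K: "K holomorphic_on S" "K a \<noteq> 0" "\<And>z. z \<in> S \<Longrightarrow> H z = (z - a) ^ n * K z"
    using holomorphic_factor_at[OF H(1) S \<open>a \<in> S\<close> Hnz] by metis
  have "G z = (\<Prod>b\<in>insert a Z. (z - b) ^ (m(a := n)) b) * K z" if "z \<in> S" for z
  proof -
    have "(\<Prod>b\<in>Z. (z - b) ^ (m(a := n)) b) = (\<Prod>b\<in>Z. (z - b) ^ m b)"
      by (rule prod.cong) (use insert.hyps in auto)
    then show ?thesis
      using H(3)[OF that] K(3)[OF that] insert.hyps by simp
  qed
  moreover have "K b \<noteq> 0" if "b \<in> insert a Z" for b
    using that K(2) H(2)[of b] insert.prems K(3)[of b] by force
  ultimately show ?case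
    using K(1) by (intro exI[of _ "m(a := n)"] exI[of _ K]) blast
qed

text \<open>If the order \<open>N\<close> of the pole exceeded \<open>m\<close>, then with g the
  regular part of \<open>u\<close> one would have g K = (z - p)^(N - m) F near \<open>p\<close>,
  nonzero at \<open>p\<close> on the left and zero on the right.\<close>

lemma pole_order_le_of_mult:
  assumes iso: "isolated_singularity_at u p" and pole: "is_pole u p"
    and S: "open S" "p \<in> S"
    and F: "F holomorphic_on S" and K: "K holomorphic_on S" "K p \<noteq> 0"
    and eq: "\<And>z. z \<in> S - {p} \<Longrightarrow> \<not> is_pole u z \<Longrightarrow> u z * ((z - p) ^ m * K z) = F z"
  shows "nat (- zorder u p) \<le> m"
proof (rule ccontr)
  define N where "N = nat (- zorder u p)"
  assume "\<not> nat (- zorder u p) \<le> m"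
  then have Nm: "m < N" by (simp add: N_def)
  obtain r0 where r0: "r0 > 0" "u analytic_on ball p r0 - {p}"
    using iso unfolding isolated_singularity_at_def by blast
  have "u holomorphic_on ball p r0 - {p}"
    using r0 by (simp add: analytic_imp_holomorphic)
  from zorder_exist_pole[OF this _ _ pole] obtain r g where g: "r > 0" "cball p r \<subseteq> ball p r0"
      "g holomorphic_on cball p r" "g p \<noteq> 0" "\<And>w. w \<in> cball p r - {p} \<Longrightarrow> u w = g w / (w - p) ^ N"
    using r0 unfolding N_def by (metis centre_in_ball open_ball)
  have "eventually (\<lambda>w. w \<in> ball p r - {p}) (at p)"
    using g(1) by (intro eventually_at_in_open) auto
  moreover have "eventually (\<lambda>w. w \<in> S - {p}) (at p)"
    using S by (intro eventually_at_in_open) auto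
  ultimately have ev: "eventually (\<lambda>w. g w * K w = (w - p) ^ (N - m) * F w) (at p)"
  proof eventually_elim
    case (elim w)
    have "u analytic_on {w}"
      by (rule analytic_on_subset[OF r0(2)]) (use elim subsetD[OF g(2), of w] in auto)
    then have "u w * ((w - p) ^ m * K w) = F w"
      using elim eq by (meson analytic_at_imp_no_pole)
    moreover have "u w = g w / (w - p) ^ N" using elim g(5) by auto
    moreover have "(w - p) ^ N = (w - p) ^ m * (w - p) ^ (N - m)"
      using Nm by (simp flip: power_add)
    ultimately show ?case using elim by (auto simp: field_simps)
  qed
  have "isCont g p"
    using g by (intro continuous_on_interior[OF holomorphic_on_imp_continuous_on[OF g(3)]]) auto
  moreover have "isCont K p" "isCont F p"
    using S by (auto intro!: continuous_on_interior[OF holomorphic_on_imp_continuous_on[OF F]]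
        continuous_on_interior[OF holomorphic_on_imp_continuous_on[OF K(1)]] simp: interior_open)
  ultimately have 1: "(\<lambda>w. g w * K w) \<midarrow>p\<rightarrow> g p * K p"
      and 2: "(\<lambda>w. (w - p) ^ (N - m) * F w) \<midarrow>p\<rightarrow> (p - p) ^ (N - m) * F p"
    by (intro tendsto_intros; simp add: isCont_def)+
  have "(\<lambda>w. g w * K w) \<midarrow>p\<rightarrow> (p - p) ^ (N - m) * F p"
    using tendsto_cong[OF ev] 2 by blast
  with 1 have "g p * K p = (p - p) ^ (N - m) * F p"
    using LIM_unique by blast
  then show False using g(4) K(2) Nm by (simp add: power_0_left)
qed

text \<open>Jensen's formula for \<open>G\<close>: its zeros dominate the poles of \<open>u\<close>
  with multiplicity, so the counting function is absorbed by the difference between the mean of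
  ln|G| and ln|H(0)|, while adding the positive part of ln|u| turns |G| into max(|F|, |G|). The last
  term pays for r < 1 when \<open>G\<close> vanishes at 0 to a higher order than the pole of
  \<open>u\<close> there.\<close>

lemma nevanlinna_T_quotient_le:
  fixes u F G H :: "complex \<Rightarrow> complex"
  assumes u: "u nicely_meromorphic_on UNIV" and r: "0 < r" "r < R"
    and F: "F holomorphic_on ball 0 R" and H: "H holomorphic_on ball 0 R" "H 0 \<noteq> 0"
    and G: "\<And>z. z \<in> ball 0 R \<Longrightarrow> G z = z ^ k * H z"
    and eq: "\<And>z. z \<in> ball 0 R \<Longrightarrow> \<not> is_pole u z \<Longrightarrow> u z * G z = F z"
    and bdF: "\<And>z. cmod z = r \<Longrightarrow> cmod (F z) \<le> M"
    and bdG: "\<And>z. cmod z = r \<Longrightarrow> cmod (G z) \<le> M"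
  shows "nevanlinna_T r u \<le> ln M - ln (cmod (H 0)) + real k * max 0 (- ln r)"
proof -
  have mero: "u meromorphic_on UNIV"
    using u by (simp add: nicely_meromorphic_on_def)
  define B0 where "B0 = ball (0::complex) R"
  \<comment> \<open>The poles of \<open>u\<close> are included beside the zeros of \<open>H\<close>,
    so that the factorisation below attaches an exponent \<open>m p\<close> to each of them;
    clearing then shows that the order of the pole is at most \<open>m p\<close>.\<close>
  define Z where "Z = {p. cmod p \<le> r \<and> is_pole u p \<and> p \<noteq> 0} \<union> {z \<in> cball 0 r. H z = 0}"
  have B0: "open B0" "connected B0" "0 \<in> B0" "cball 0 r \<subseteq> B0"
    using r by (auto simp: B0_def)
  have "\<exists>w\<in>B0. H w \<noteq> 0" using H(2) B0 by blast
  have finH: "finite {z \<in> cball 0 r. H z = 0}"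
  proof -
    have "finite {z \<in> cball 0 r. H z = 0}" if "\<not> H constant_on B0"
      by (rule holomorphic_compact_finite_zeros[OF H(1)[folded B0_def] B0(1,2) _ B0(4) that]) simp
    moreover have "{z \<in> cball 0 r. H z = 0} = {}" if "H constant_on B0"
    proof -
      have "H z = H 0" if "z \<in> cball 0 r" for z
        using \<open>H constant_on B0\<close> B0(3,4) that unfolding constant_on_def by (metis subsetD)
      then show ?thesis using H(2) by auto
    qed
    ultimately show ?thesis
      by (metis finite.emptyI)
  qed
  have finZ: "finite Z"
  proof -
    have "finite {p. cmod p \<le> r \<and> is_pole u p \<and> p \<noteq> 0}"
      by (rule finite_subset[OF _ finite_poles_cball[OF mero, of r]]) auto
    then show ?thesis
      unfolding Z_def using finH by (rule finite_UnI)
  qed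
  have ZB: "Z \<subseteq> B0" using B0(4) by (auto simp: Z_def)
  have Z0: "0 \<notin> Z" using H(2) by (auto simp: Z_def)
  have Zr: "0 < cmod a \<and> cmod a \<le> r" if "a \<in> Z" for a
    using that Z0 by (auto simp: Z_def)
  obtain m K where K: "K holomorphic_on B0" "\<And>a. a \<in> Z \<Longrightarrow> K a \<noteq> 0"
      and HK: "\<And>z. z \<in> B0 \<Longrightarrow> H z = (\<Prod>a\<in>Z. (z - a) ^ m a) * K z"
    using holomorphic_factor_finite[OF finZ H(1)[folded B0_def] B0(1,2) ZB \<open>\<exists>w\<in>B0. H w \<noteq> 0\<close>] by blast
  have Knz: "K z \<noteq> 0" if "z \<in> cball 0 r" for z
  proof (cases "z \<in> Z")
    case False
    then have "H z \<noteq> 0" using that by (auto simp: Z_def)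
    then show ?thesis using HK[of z] B0(4) that by auto
  qed (use K in auto)
  have iso: "isolated_singularity_at u p" for p
    by (rule meromorphic_on_isolated_singularity) (rule meromorphic_on_subset[OF mero], simp)
  have ord: "nat (- zorder u p) \<le> m p" if p: "cmod p \<le> r" "is_pole u p" "p \<noteq> 0" for p
  proof -
    have pZ: "p \<in> Z" using p by (simp add: Z_def)
    define K' where "K' = (\<lambda>z. z ^ k * ((\<Prod>a\<in>Z - {p}. (z - a) ^ m a) * K z))"
    show ?thesis
    proof (rule pole_order_le_of_mult[OF iso p(2) B0(1) _ F[folded B0_def]])
      show "p \<in> B0" using pZ ZB by auto
      show "K' holomorphic_on B0"
        unfolding K'_def by (intro holomorphic_intros K)
      show "K' p \<noteq> 0"
        using p K(2)[OF pZ] finZ by (auto simp: K'_def)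
      fix z assume z: "z \<in> B0 - {p}" "\<not> is_pole u z"
      have "(\<Prod>a\<in>Z. (z - a) ^ m a) = (z - p) ^ m p * (\<Prod>a\<in>Z - {p}. (z - a) ^ m a)"
        using finZ pZ by (simp add: prod.remove)
      then have "(z - p) ^ m p * K' z = G z"
        using z HK[of z] G[of z] by (simp add: K'_def B0_def mult_ac)
      then show "u z * ((z - p) ^ m p * K' z) = F z"
        using eq z by (simp add: B0_def)
    qed
  qed
  have ord0: "pole_count 0 u \<le> k"
  proof (cases "is_pole u 0")
    case True
    have "nat (- zorder u 0) \<le> k"
      by (rule pole_order_le_of_mult[OF iso True B0(1,3) F[folded B0_def] H(1)[folded B0_def] H(2)])
         (use eq G in \<open>auto simp: B0_def\<close>)
    moreover have "pole_count 0 u = (\<Sum>z\<in>{0}. nat (- zorder u z))"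
      unfolding pole_count_def by (rule sum.cong) (use True in auto)
    ultimately show ?thesis by simp
  next
    case False
    then have "{z. cmod z \<le> 0 \<and> is_pole u z} = {}" by auto
    then show ?thesis by (metis pole_count_def sum.empty zero_le)
  qed
  \<comment> \<open>Replacing each linear factor with a zero inside the circle by a Blaschke factor keeps the
    modulus on the circle and removes the zero.\<close>
  define b where "b = (\<lambda>a z. if cmod a < r then (of_real (r\<^sup>2) - cnj a * z) / of_real r else z - a)"
  have b_circle: "cmod (b a z) = cmod (z - a)" if "cmod z = r" for a z
  proof (cases "cmod a < r")
    case True
    have "of_real (r\<^sup>2) - cnj a * z = z * cnj (z - a)"
      using complex_norm_square[of z] that by (simp add: algebra_simps)
    then have "b a z = z * cnj (z - a) / of_real r"
      using True by (simp add: b_def)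
    then show ?thesis
      using that r by (simp add: norm_mult norm_divide del: complex_cnj_diff)
  qed (simp add: b_def)
  have b_nz: "b a z \<noteq> 0" if "cmod a \<le> r" "z \<in> ball 0 r" for a z
  proof (cases "cmod a < r")
    case True
    have "cmod (cnj a * z) < r * r"
      using True that(2) r by (auto simp: norm_mult intro!: mult_strict_mono')
    moreover have "cmod (of_real (r\<^sup>2)) = r * r"
      by (simp add: power2_eq_square del: of_real_mult of_real_power)
    ultimately have "cnj a * z \<noteq> of_real (r\<^sup>2)"
      by (metis less_irrefl)
    then show ?thesis using True r by (simp add: b_def)
  qed (use that in \<open>auto simp: b_def\<close>)
  have b_0: "cmod (b a 0) = r" if "cmod a \<le> r" for a
    using that r by (auto simp: b_def norm_divide power2_eq_square norm_mult)
  \<comment> \<open>On the circle |B| = |G|, with z^k replaced by the constant r^k. At 0, ln|B|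
    exceeds ln|H| by k ln r plus the sum of m(a) ln(r / |a|), which is the part that bounds the
    counting function.\<close>
  define B where "B = (\<lambda>z. of_real (r ^ k) * ((\<Prod>a\<in>Z. b a z ^ m a) * K z))"
  have Bhol: "B holomorphic_on ball 0 R"
  proof -
    have "(\<lambda>z. b a z) holomorphic_on B0" for a
      unfolding b_def using r by (cases "cmod a < r") (auto intro!: holomorphic_intros)
    then show ?thesis
      unfolding B_def B0_def[symmetric] by (intro holomorphic_intros K)
  qed
  have Bcirc: "cmod (B z) = cmod (G z)" if "cmod z = r" for z
  proof -
    have "z \<in> B0" using that r by (simp add: B0_def)
    then have "cmod (G z) = r ^ k * ((\<Prod>a\<in>Z. cmod (z - a) ^ m a) * cmod (K z))"
      using G[of z] HK[of z] that by (simp add: B0_def norm_mult norm_power prod_norm[symmetric])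
    then show ?thesis
      using b_circle[OF that] r by (simp add: B_def norm_mult norm_power prod_norm[symmetric])
  qed
  have "integral {0..2 * pi} (\<lambda>\<theta>. log_plus (cmod (u (of_real r * cis \<theta>))))
          \<le> 2 * pi * (ln M - ln (cmod (B 0)))"
  proof (rule jensen_upper_bound[OF Bhol r])
    fix z :: complex assume "z \<in> ball 0 r"
    then show "B z \<noteq> 0"
      using b_nz Knz[of z] Zr r finZ by (auto simp: B_def)
  next
    fix \<theta> :: real
    let ?z = "of_real r * cis \<theta>"
    have cz: "cmod ?z = r" using r by (simp add: norm_mult)
    have e: "exp (log_plus x) = max 1 x" if "x \<ge> 0" for x
      using that by (cases "x = 0") (auto simp: log_plus_def max_def)
    have "cmod (G ?z) * max 1 (cmod (u ?z)) \<le> M"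
    \<comment> \<open>At a pole on the circle the normal form gives \<open>u\<close> the value 0, so
      \<open>log_plus\<close> contributes nothing and the bound on \<open>G\<close>
      suffices.\<close>
    proof (cases "is_pole u ?z")
      case True
      then have "u ?z = 0"
        using is_pole_zero_at_nicely_mero[OF u] by simp
      then show ?thesis using bdG[OF cz] by simp
    next
      case False
      then have "cmod (G ?z) * cmod (u ?z) = cmod (F ?z)"
        using eq[of ?z] cz r by (simp add: mult.commute flip: norm_mult)
      then show ?thesis
        using bdG[OF cz] bdF[OF cz] by (auto simp: max_def)
    qed
    then show "cmod (B ?z) * exp (log_plus (cmod (u ?z))) \<le> M"
      using Bcirc[OF cz] by (simp add: e)
  qed (use Bcirc bdG in \<open>auto simp: log_plus_def\<close>)
  then have prox: "proximity r u \<le> ln M - ln (cmod (B 0))"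
    by (simp add: proximity_def field_simps)
  have lnB: "ln (cmod (B 0)) = real k * ln r + ((\<Sum>a\<in>Z. real (m a) * ln r) + ln (cmod (K 0)))"
  proof -
    have "cmod (B 0) = r ^ k * ((\<Prod>a\<in>Z. r ^ m a) * cmod (K 0))"
      using b_0 Zr r by (simp add: B_def norm_mult norm_power prod_norm[symmetric])
    moreover have "K 0 \<noteq> 0" using Knz[of 0] r by simp
    moreover have "(\<Prod>a\<in>Z. r ^ m a) > 0" using r by (simp add: prod_pos)
    ultimately show ?thesis
      using r finZ by (simp add: ln_mult ln_realpow ln_prod)
  qed
  have lnH: "ln (cmod (H 0)) = (\<Sum>a\<in>Z. real (m a) * ln (cmod a)) + ln (cmod (K 0))"
  proof -
    have "cmod (H 0) = (\<Prod>a\<in>Z. cmod a ^ m a) * cmod (K 0)"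
      using HK[OF B0(3)] by (simp add: norm_mult norm_power prod_norm[symmetric])
    moreover have "K 0 \<noteq> 0" using Knz[of 0] r by simp
    moreover have "(\<Prod>a\<in>Z. cmod a ^ m a) > 0" using Zr by (intro prod_pos) auto
    ultimately show ?thesis
      using finZ Zr by (simp add: ln_mult ln_realpow ln_prod)
  qed
  have "(\<Sum>p | cmod p \<le> r \<and> is_pole u p \<and> p \<noteq> 0. real (nat (- zorder u p)) * ln (r / cmod p))
      \<le> (\<Sum>p | cmod p \<le> r \<and> is_pole u p \<and> p \<noteq> 0. real (m p) * ln (r / cmod p))"
    using ord by (intro sum_mono mult_right_mono) auto
  also have "\<dots> \<le> (\<Sum>p\<in>Z. real (m p) * ln (r / cmod p))"
  proof (rule sum_mono2[OF finZ])
    fix b assume "b \<in> Z - {p. cmod p \<le> r \<and> is_pole u p \<and> p \<noteq> 0}"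
    then have "0 < cmod b" "cmod b \<le> r" using Zr[of b] by blast+
    then show "0 \<le> real (m b) * ln (r / cmod b)"
      by (intro mult_nonneg_nonneg ln_ge_zero) (auto simp: field_simps)
  qed (simp add: Z_def)
  also have "\<dots> = (\<Sum>a\<in>Z. real (m a) * ln r) - (\<Sum>a\<in>Z. real (m a) * ln (cmod a))"
    unfolding sum_subtractf[symmetric]
  proof (rule sum.cong)
    fix a assume "a \<in> Z"
    then have "0 < cmod a" using Zr[of a] by blast
    then show "real (m a) * ln (r / cmod a) = real (m a) * ln r - real (m a) * ln (cmod a)"
      using r by (simp add: ln_div algebra_simps)
  qed simp
  finally have "pole_counting r u \<le> (\<Sum>a\<in>Z. real (m a) * ln r)
      - (\<Sum>a\<in>Z. real (m a) * ln (cmod a)) + real (pole_count 0 u) * ln r"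
    using pole_counting_eq[OF mero r(1)] by simp
  then have "nevanlinna_T r u \<le> ln M - ln (cmod (H 0)) + (real k - real (pole_count 0 u)) * (- ln r)"
    using prox lnB lnH r by (simp add: nevanlinna_T_def algebra_simps)
  also have "(real k - real (pole_count 0 u)) * (- ln r)
      \<le> (real k - real (pole_count 0 u)) * max 0 (- ln r)"
    using ord0 by (intro mult_left_mono) auto
  also have "\<dots> \<le> real k * max 0 (- ln r)"
    by (intro mult_right_mono) auto
  finally show ?thesis by simp
qed

lemma pole_local_form:
  assumes iso: "isolated_singularity_at u p" and pole: "is_pole u p"
  obtains r g where "r > 0" "g holomorphic_on cball p r" "g p \<noteq> 0" "nat (- zorder u p) > 0"
    "\<And>w. w \<in> cball p r - {p} \<Longrightarrow> u analytic_on {w} \<and> g w \<noteq> 0 \<and> u w = g w / (w - p) ^ nat (- zorder u p)"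
proof -
  obtain r1 where r1: "r1 > 0" "u analytic_on ball p r1 - {p}"
    using iso unfolding isolated_singularity_at_def by blast
  then have hol: "u holomorphic_on ball p r1 - {p}"
    by (simp add: analytic_imp_holomorphic)
  have p: "p \<in> ball p r1" using r1 by simp
  obtain r where r: "zorder u p < 0" "zor_poly u p p \<noteq> 0" "r > 0" "cball p r \<subseteq> ball p r1"
      "zor_poly u p holomorphic_on cball p r"
      "\<And>w. w \<in> cball p r - {p} \<Longrightarrow> u w = zor_poly u p w / (w - p) ^ nat (- zorder u p) \<and> zor_poly u p w \<noteq> 0"
    using zorder_exist_pole[OF hol open_ball p pole] by blast
  show ?thesis
  proof (rule that[OF r(3,5,2)])
    show "nat (- zorder u p) > 0" using r(1) by simp
    fix w assume w: "w \<in> cball p r - {p}"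
    then have "w \<in> ball p r1 - {p}" using subsetD[OF r(4), of w] by auto
    then have "u analytic_on {w}"
      using analytic_on_subset[OF r1(2), of "{w}"] by simp
    then show "u analytic_on {w} \<and> zor_poly u p w \<noteq> 0 \<and>
        u w = zor_poly u p w / (w - p) ^ nat (- zorder u p)"
      using r(6)[OF w] by simp
  qed
qed

text \<open>If 0 is a pole of order N, the proximity function is at most a constant plus -N ln r
  while the counting function is N ln r, and the two cancel. This covers small radii, where the term
  max 0 (-ln r) of the quotient bound is unbounded.\<close>

lemma nevanlinna_T_bounded_near_0:
  assumes u: "u nicely_meromorphic_on UNIV"
  obtains r0 C where "r0 > 0" "\<And>r. 0 < r \<Longrightarrow> r < r0 \<Longrightarrow> nevanlinna_T r u \<le> C"
proof -
  have mero: "u meromorphic_on UNIV"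
    using u by (simp add: nicely_meromorphic_on_def)
  obtain N \<rho> C0 where \<rho>: "\<rho> > 0" "C0 \<ge> (1::real)" "pole_count 0 u = N"
      and bd: "\<And>w. w \<in> ball 0 \<rho> - {0} \<Longrightarrow> \<not> is_pole u w \<and> cmod (u w) \<le> C0 / cmod w ^ N"
  proof (cases "is_pole u 0")
    case True
    have "isolated_singularity_at u 0"
      by (rule meromorphic_on_isolated_singularity) (rule meromorphic_on_subset[OF mero], simp)
    from pole_local_form[OF this True] obtain r g where g: "r > 0" "g holomorphic_on cball 0 r"
        "\<And>w. w \<in> cball 0 r - {0} \<Longrightarrow> u analytic_on {w} \<and> g w \<noteq> 0 \<and> u w = g w / (w - 0) ^ nat (- zorder u 0)"
      by metis
    obtain C1 where C1: "\<And>w. w \<in> cball 0 r \<Longrightarrow> cmod (g w) \<le> C1"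
      using compact_imp_bounded[OF compact_continuous_image[OF holomorphic_on_imp_continuous_on[OF g(2)] compact_cball]]
      unfolding bounded_iff by blast
    have pc: "pole_count 0 u = nat (- zorder u 0)"
    proof -
      have "pole_count 0 u = (\<Sum>z\<in>{0}. nat (- zorder u z))"
        unfolding pole_count_def by (rule sum.cong) (use True in auto)
      then show ?thesis by simp
    qed
    show ?thesis
    proof (rule that[OF g(1) _ pc, of "max 1 C1"])
      fix w :: complex assume w: "w \<in> ball 0 r - {0::complex}"
      then have "u analytic_on {w}" using g(3)[of w] by simp
      moreover have "cmod (u w) \<le> max 1 C1 / cmod w ^ nat (- zorder u 0)"
        using g(3)[of w] C1[of w] w by (simp add: norm_divide norm_power divide_right_mono le_max_iff_disj)
      ultimately show "\<not> is_pole u w \<and> cmod (u w) \<le> max 1 C1 / cmod w ^ nat (- zorder u 0)"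
        by (simp add: analytic_at_imp_no_pole)
    qed auto
  next
    case False
    then have "u analytic_on {0}"
      using nicely_meromorphic_on_imp_analytic_at[OF u] by simp
    then obtain r where r: "r > 0" "u holomorphic_on ball 0 r"
      unfolding analytic_on_def by blast
    have "u holomorphic_on cball 0 (r / 2)"
      by (rule holomorphic_on_subset[OF r(2)]) (use r(1) in auto)
    then obtain C1 where C1: "\<And>w. w \<in> cball 0 (r / 2) \<Longrightarrow> cmod (u w) \<le> C1"
      using compact_imp_bounded[OF compact_continuous_image[OF holomorphic_on_imp_continuous_on compact_cball]]
      unfolding bounded_iff by blast
    have "{z. cmod z \<le> 0 \<and> is_pole u z} = {}" using False by auto
    then have pc: "pole_count 0 u = 0" by (metis pole_count_def sum.empty)
    show ?thesis
    proof (rule that[of "r / 2" "max 1 C1" 0])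
      fix w :: complex assume w: "w \<in> ball 0 (r / 2) - {0::complex}"
      then have "u analytic_on {w}"
        using r analytic_on_subset[of u "ball 0 r" "{w}"] by (simp add: analytic_on_open)
      then show "\<not> is_pole u w \<and> cmod (u w) \<le> max 1 C1 / cmod w ^ 0"
        using C1[of w] w by (auto simp: analytic_at_imp_no_pole)
    qed (use r pc in auto)
  qed
  show ?thesis
  proof (rule that[of "min \<rho> 1" "ln C0"])
    fix r :: real assume r: "0 < r" "r < min \<rho> 1"
    let ?K = "ln C0 - real N * ln r"
    have K: "?K \<ge> 0"
    proof -
      have "ln r \<le> 0" "ln C0 \<ge> 0" using r \<rho>(2) by auto
      then have "real N * ln r \<le> 0" by (intro mult_nonneg_nonpos) auto
      then show ?thesis using \<open>ln C0 \<ge> 0\<close> by linarith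
    qed
    have le: "log_plus (cmod (u (of_real r * cis \<theta>))) \<le> ?K" for \<theta>
    proof (cases "u (of_real r * cis \<theta>) = 0")
      case False
      have "of_real r * cis \<theta> \<in> ball 0 \<rho> - {0::complex}"
        using r by (auto simp: norm_mult)
      then have "cmod (u (of_real r * cis \<theta>)) \<le> C0 / r ^ N"
        using bd[of "of_real r * cis \<theta>"] r by (simp add: norm_mult)
      then have "ln (cmod (u (of_real r * cis \<theta>))) \<le> ln (C0 / r ^ N)"
        using False r \<rho>(2) by (intro ln_mono) auto
      then show ?thesis
        using K r \<rho>(2) by (simp add: log_plus_def ln_div ln_realpow)
    qed (use K in \<open>simp add: log_plus_def\<close>)
    have "integral {0..2 * pi} (\<lambda>\<theta>. log_plus (cmod (u (of_real r * cis \<theta>)))) \<le> 2 * pi * ?K"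
    proof (cases "(\<lambda>\<theta>. log_plus (cmod (u (of_real r * cis \<theta>)))) integrable_on {0..2 * pi}")
      case True
      have "integral {0..2 * pi} (\<lambda>\<theta>. log_plus (cmod (u (of_real r * cis \<theta>))))
          \<le> integral {0..2 * pi} (\<lambda>\<theta>. ?K)"
        by (rule integral_le[OF True]) (use le in auto)
      then show ?thesis by simp
    qed (use K in \<open>simp add: not_integrable_integral\<close>)
    then have "proximity r u \<le> ?K"
      by (simp add: proximity_def field_simps)
    moreover have "{p. cmod p \<le> r \<and> is_pole u p \<and> p \<noteq> 0} = {}"
      using bd r by fastforce
    then have "pole_counting r u = real N * ln r"
      unfolding pole_counting_eq[OF mero r(1)] \<rho>(3)[symmetric] by (simp only: sum.empty add_0)
    ultimately show "nevanlinna_T r u \<le> ln C0"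
      using r by (simp add: nevanlinna_T_def)
  qed (use \<rho> in auto)
qed

text \<open>\<open>F\<close> and \<open>H\<close> may change with \<open>r\<close>; only the order
  \<open>k\<close> at 0, the lower bound \<open>c\<close> for |H(0)| and the constants
  \<open>A\<close>, \<open>B\<close> are uniform. Small radii are handled by boundedness near 0, the
  radius 0 by adding the single number |T(0,u)| to \<open>D\<close>, and the exponent of r obtained
  is 1.\<close>

lemma nevanlinna_growth_quotient:
  fixes u :: "complex \<Rightarrow> complex" and A B c :: real
  assumes u: "u nicely_meromorphic_on UNIV" and c: "c > 0"
    and Q: "\<And>r. r > 0 \<Longrightarrow> \<exists>R F H. r < R \<and> F holomorphic_on ball 0 R \<and> H holomorphic_on ball 0 R \<and>
        c \<le> cmod (H 0) \<and> (\<forall>z\<in>ball 0 R. \<not> is_pole u z \<longrightarrow> u z * (z ^ k * H z) = F z) \<and>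
        (\<forall>z. cmod z = r \<longrightarrow> cmod (F z) \<le> exp (A * exp (B * r)) \<and>
              cmod (z ^ k * H z) \<le> exp (A * exp (B * r)))"
  shows "\<exists>a b c :: real. a > 0 \<and> b > 0 \<and> c > 0 \<and>
           (\<forall>r\<ge>0. nevanlinna_T r u < a * exp (b * r powr c))"
proof -
  obtain r0 C where r0: "r0 > 0" "\<And>r. 0 < r \<Longrightarrow> r < r0 \<Longrightarrow> nevanlinna_T r u \<le> C"
    using nevanlinna_T_bounded_near_0[OF u] by blast
  define D where "D = \<bar>ln c\<bar> + real k * max 0 (- ln r0) + \<bar>C\<bar> + \<bar>nevanlinna_T 0 u\<bar> + 1"
  have D: "D > 0" by (auto simp: D_def intro!: add_nonneg_pos)
  have kk: "real k * max 0 (- ln r0) \<ge> 0" by simp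
  have "nevanlinna_T r u < (\<bar>A\<bar> + D) * exp ((\<bar>B\<bar> + 1) * r)" if rr: "r \<ge> 0" for r
  proof -
    have E: "exp ((\<bar>B\<bar> + 1) * r) \<ge> 1" using that by simp
    have D_le: "D \<le> (\<bar>A\<bar> + D) * exp ((\<bar>B\<bar> + 1) * r)"
      using mult_mono[of "D" "\<bar>A\<bar> + D" 1 "exp ((\<bar>B\<bar> + 1) * r)"] E D by simp
    consider "r = 0" | "0 < r" "r < r0" | "r0 \<le> r" using rr by linarith
    then show ?thesis
    proof cases
      case 1
      have "nevanlinna_T 0 u < D" using kk unfolding D_def by linarith
      then show ?thesis using D_le 1 by simp
    next
      case 2
      have "nevanlinna_T r u < D" using kk r0(2)[OF 2] unfolding D_def by linarith
      then show ?thesis using D_le by simp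
    next
      case 3
      then have r: "r > 0" using r0 by simp
      obtain R F H where FH: "r < R" "F holomorphic_on ball 0 R" "H holomorphic_on ball 0 R"
          "c \<le> cmod (H 0)" "\<And>z. z \<in> ball 0 R \<Longrightarrow> \<not> is_pole u z \<Longrightarrow> u z * (z ^ k * H z) = F z"
          "\<And>z. cmod z = r \<Longrightarrow> cmod (F z) \<le> exp (A * exp (B * r))"
          "\<And>z. cmod z = r \<Longrightarrow> cmod (z ^ k * H z) \<le> exp (A * exp (B * r))"
        using Q[OF r] by blast
      have "H 0 \<noteq> 0" using FH(4) c by auto
      then have "nevanlinna_T r u \<le> ln (exp (A * exp (B * r))) - ln (cmod (H 0)) + real k * max 0 (- ln r)"
        by (intro nevanlinna_T_quotient_le[where G = "\<lambda>z. z ^ k * H z", OF u r FH(1,2,3) _ refl FH(5,6,7)])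
      also have "\<dots> \<le> A * exp (B * r) - ln c + real k * max 0 (- ln r0)"
      proof -
        have "ln c \<le> ln (cmod (H 0))" using c FH(4) by (intro ln_mono) auto
        moreover have "ln r0 \<le> ln r" using 3 r0 by (intro ln_mono) auto
        then have "real k * max 0 (- ln r) \<le> real k * max 0 (- ln r0)"
          by (intro mult_left_mono) auto
        ultimately show ?thesis by simp
      qed
      also have "\<dots> < A * exp (B * r) + D"
        using kk unfolding D_def by linarith
      also have "\<dots> \<le> \<bar>A\<bar> * exp ((\<bar>B\<bar> + 1) * r) + D * exp ((\<bar>B\<bar> + 1) * r)"
      proof (rule add_mono)
        have "B * r \<le> (\<bar>B\<bar> + 1) * r" using r by (intro mult_right_mono) auto
        then show "A * exp (B * r) \<le> \<bar>A\<bar> * exp ((\<bar>B\<bar> + 1) * r)"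
          by (intro mult_mono) auto
        show "D \<le> D * exp ((\<bar>B\<bar> + 1) * r)" using D E by simp
      qed
      finally show ?thesis by (simp add: algebra_simps)
    qed
  qed
  then show ?thesis
    using D by (intro exI[of _ "\<bar>A\<bar> + D"] exI[of _ "\<bar>B\<bar> + 1"] exI[of _ 1]) (auto intro: add_nonneg_pos)
qed

subsection \<open>Entire solutions of second-order linear equations\<close>

text \<open>Cauchy's method of majorants. Nonnegative coefficients make the value of
  \<open>h\<close> at \<open>cmod z\<close> equal to the sum of the dominating series.\<close>

lemma eval_fps_majorant:
  fixes f h :: "complex fps"
  assumes h: "fps_conv_radius h = \<infinity>" "\<And>n. fps_nth h n = of_real (hr n)" "\<And>n. hr n \<ge> 0"
    and le: "\<And>n. cmod (fps_nth f n) \<le> M * hr n"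
  shows "fps_conv_radius f = \<infinity>" "cmod (eval_fps f z) \<le> M * cmod (eval_fps h (of_real (cmod z)))"
proof -
  have sh: "summable (\<lambda>n. hr n * x ^ n)" if "x \<ge> 0" for x :: real
  proof -
    have "summable (\<lambda>n. norm (fps_nth h n * of_real x ^ n))"
      by (rule norm_summable_fps) (simp add: h)
    then show ?thesis
      using that h(3) by (simp add: h(2) norm_mult norm_power)
  qed
  have sf: "summable (\<lambda>n. cmod (fps_nth f n * z ^ n))" for z
  proof (rule summable_comparison_test')
    show "summable (\<lambda>n. M * (hr n * cmod z ^ n))"
      by (intro summable_mult sh) simp
    show "norm (cmod (fps_nth f n * z ^ n)) \<le> M * (hr n * cmod z ^ n)" if "n \<ge> 0" for n
      using mult_right_mono[OF le[of n], of "cmod z ^ n"] by (simp add: norm_mult norm_power mult_ac)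
  qed
  show "fps_conv_radius f = \<infinity>"
    unfolding fps_conv_radius_def
  proof (rule conv_radius_inftyI')
    fix r :: real assume "0 < r"
    then show "\<exists>z. norm z = r \<and> summable (\<lambda>n. fps_nth f n * z ^ n)"
      by (intro exI[of _ "of_real r"]) (use sf[of "of_real r"] in \<open>auto intro: summable_norm_cancel\<close>)
  qed
  have "cmod (eval_fps f z) \<le> (\<Sum>n. cmod (fps_nth f n * z ^ n))"
    unfolding eval_fps_def by (rule summable_norm[OF sf])
  also have "\<dots> \<le> (\<Sum>n. M * (hr n * cmod z ^ n))"
  proof (rule suminf_le[OF _ sf summable_mult[OF sh]])
    show "cmod (fps_nth f n * z ^ n) \<le> M * (hr n * cmod z ^ n)" for n
      using mult_right_mono[OF le[of n], of "cmod z ^ n"] by (simp add: norm_mult norm_power mult_ac)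
  qed simp
  also have "\<dots> = M * (\<Sum>n. hr n * cmod z ^ n)"
    by (rule suminf_mult[OF sh]) simp
  also have "(\<Sum>n. hr n * cmod z ^ n) = cmod (eval_fps h (of_real (cmod z)))"
  proof -
    have "eval_fps h (of_real (cmod z)) = (\<Sum>n. of_real (hr n * cmod z ^ n))"
      by (simp add: eval_fps_def h(2))
    also have "\<dots> = of_real (\<Sum>n. hr n * cmod z ^ n)"
      by (rule suminf_of_real[symmetric, OF sh]) simp
    moreover have "(\<Sum>n. hr n * cmod z ^ n) \<ge> 0"
      by (intro suminf_nonneg sh) (auto simp: h(3))
    ultimately show ?thesis by simp
  qed
  finally show "cmod (eval_fps f z) \<le> M * cmod (eval_fps h (of_real (cmod z)))" .
qed

context
  fixes \<beta> c \<gamma> d \<delta> f0 f1 :: complex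
begin

text \<open>Taylor coefficients at 0 of the solution of F'' = \<beta> F' + c exp(\<gamma> z) F + d
  exp(\<delta> z) with F(0) = \<open>f0\<close> and F'(0) = \<open>f1\<close>; the sum is the Cauchy
  product with the exponential series.\<close>

fun ode_coeff :: "nat \<Rightarrow> complex" where
  "ode_coeff 0 = f0"
| "ode_coeff (Suc 0) = f1"
| "ode_coeff (Suc (Suc n)) =
     (\<beta> * of_nat (Suc n) * ode_coeff (Suc n)
       + c * (\<Sum>i\<le>n. \<gamma> ^ i / fact i * ode_coeff (n - i)) + d * \<delta> ^ n / fact n)
     / (of_nat (Suc (Suc n)) * of_nat (Suc n))"

end

text \<open>The Taylor coefficients are dominated by a multiple of those of \<open>exp (A exp (K z))\<close>, which
  satisfy a first-order recursion with positive coefficients.\<close>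

lemma linear_ode_entire_at_0:
  fixes \<beta> c \<gamma> d \<delta> f0 f1 :: complex
  obtains F F' :: "complex \<Rightarrow> complex" and A K M :: real where
    "\<And>z. (F has_field_derivative F' z) (at z)"
    "\<And>z. (F' has_field_derivative \<beta> * F' z + c * exp (\<gamma> * z) * F z + d * exp (\<delta> * z)) (at z)"
    "F 0 = f0" "F' 0 = f1"
    "\<And>z. cmod (F z) \<le> M * exp (A * exp (K * cmod z))"
    "\<And>z. cmod (F' z) \<le> M * (A * K * exp (K * cmod z) * exp (A * exp (K * cmod z)))"
proof -
  define K where "K = 1 + cmod \<gamma> + cmod \<delta>"
  \<comment> \<open>The factor 3 lets each of the three terms of the recursion be absorbed by one
    third of the majorant: the coefficients \<beta>, c and 1 are bounded by \<open>AK / 3\<close>,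
    \<open>AK\<^sup>2 / 3\<close> and \<open>AK\<^sup>2 / 3\<close>, where \<open>AK\<close> is the
    product of \<open>A\<close> and \<open>K\<close>.\<close>
  define A where "A = 3 + 3 * cmod \<beta> + 3 * cmod c"
  define M where "M = 1 + cmod f0 + cmod f1 + cmod d"
  have K: "K \<ge> 1" "cmod \<gamma> \<le> K" "cmod \<delta> \<le> K" by (auto simp: K_def)
  have A: "A \<ge> 3" "3 * cmod \<beta> \<le> A" "3 * cmod c \<le> A" by (auto simp: A_def)
  have M: "M \<ge> 1" "cmod f0 \<le> M" "cmod f1 \<le> M" "cmod d \<le> M" by (auto simp: M_def)
  define AK where "AK = A * K"
  have AK: "AK \<ge> 3" "cmod \<beta> \<le> AK / 3" "cmod c \<le> AK\<^sup>2 / 3" "1 \<le> AK\<^sup>2 / 3"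
  proof -
    have "A * 1 \<le> AK" unfolding AK_def using A K by (intro mult_left_mono) auto
    then show 1: "AK \<ge> 3" and "cmod \<beta> \<le> AK / 3" using A by auto
    have "AK * 1 \<le> AK\<^sup>2" unfolding power2_eq_square using 1 by (intro mult_left_mono) auto
    then show "cmod c \<le> AK\<^sup>2 / 3" "1 \<le> AK\<^sup>2 / 3" using A \<open>A * 1 \<le> AK\<close> by auto
  qed
  define h :: "complex \<Rightarrow> complex" where "h = (\<lambda>z. exp (of_real A * exp (of_real K * z)))"
  define H where "H = fps_expansion h 0"
  have hhol: "h holomorphic_on UNIV" unfolding h_def by (intro holomorphic_intros)
  then have H: "h has_fps_expansion H"
    unfolding H_def by (intro has_fps_expansion_fps_expansion[of UNIV]) auto
  have Hrad: "fps_conv_radius H = \<infinity>"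
    using holomorphic_on_imp_fps_conv_radius_ge[OF H, of \<infinity>] holomorphic_on_subset[OF hhol] by auto
  have Heval: "eval_fps H z = h z" for z
    by (rule has_fps_expansion_imp_eval_fps_eq[OF H, of z "cmod z + 1"])
       (auto intro: holomorphic_on_subset[OF hhol])
  have dh: "deriv h = (\<lambda>z. of_real AK * exp (of_real K * z) * h z)"
    by (rule ext, rule DERIV_imp_deriv)
       (auto simp: h_def AK_def intro!: derivative_eq_intros)
  have "deriv h has_fps_expansion fps_const (of_real AK) * fps_exp (of_real K) * H"
    unfolding dh by (intro fps_expansion_intros H)
  moreover have "deriv h has_fps_expansion fps_deriv H"
    by (intro fps_expansion_intros H)
  ultimately have Hd: "fps_deriv H = fps_const (of_real AK) * fps_exp (of_real K) * H"
    using fps_expansion_unique_complex by blast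
  define hr where "hr = (\<lambda>n. Re (fps_nth H n))"
  have Hrec: "of_nat (Suc n) * fps_nth H (Suc n) =
      of_real AK * (\<Sum>i\<le>n. of_real (K ^ i / fact i) * fps_nth H (n - i))" for n
  proof -
    have "fps_nth (fps_deriv H) n = of_real AK * (\<Sum>i\<le>n. of_real (K ^ i / fact i) * fps_nth H (n - i))"
      unfolding Hd by (simp add: mult.assoc fps_mult_nth[of "fps_exp _"] atLeast0AtMost)
    then show ?thesis by (simp add: add.commute)
  qed
  have H0: "fps_nth H 0 = of_real (exp A)"
    using Heval[of 0] by (simp add: eval_fps_at_0 h_def exp_of_real)
  have Hnn: "fps_nth H n = of_real (hr n) \<and> hr n \<ge> 0" for n
  proof (induction n rule: less_induct)
    case (less n)
    show ?case
    proof (cases n)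
      case 0
      then show ?thesis by (simp add: hr_def H0)
    next
      case (Suc m)
      have "of_nat (Suc m) * fps_nth H n = of_real AK * (\<Sum>i\<le>m. of_real (K ^ i / fact i) * of_real (hr (m - i)))"
        using Hrec[of m] less Suc by simp
      also have "\<dots> = of_real (AK * (\<Sum>i\<le>m. K ^ i / fact i * hr (m - i)))"
        by simp
      finally have "fps_nth H n = of_real (AK * (\<Sum>i\<le>m. K ^ i / fact i * hr (m - i)) / real (Suc m))"
        by (simp add: field_simps del: of_nat_Suc)
      moreover have "AK * (\<Sum>i\<le>m. K ^ i / fact i * hr (m - i)) / real (Suc m) \<ge> 0"
        using AK K less Suc by (intro divide_nonneg_nonneg mult_nonneg_nonneg sum_nonneg) auto
      ultimately show ?thesis
        by (metis Re_complex_of_real hr_def)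
    qed
  qed
  have hr0: "hr 0 \<ge> 1" using A by (simp add: hr_def H0)
  have hrrec: "real (Suc n) * hr (Suc n) = AK * (\<Sum>i\<le>n. K ^ i / fact i * hr (n - i))" for n
  proof -
    have "of_real (real (Suc n) * hr (Suc n)) = (of_real (AK * (\<Sum>i\<le>n. K ^ i / fact i * hr (n - i))) :: complex)"
      using Hrec[of n] Hnn by simp
    then show ?thesis using of_real_eq_iff by blast
  qed
  define S where "S = (\<lambda>n. \<Sum>i\<le>n. K ^ i / fact i * hr (n - i))"
  have S_ge: "K ^ i / fact i * hr (n - i) \<le> S n" if "i \<le> n" for i n
    unfolding S_def using that K Hnn by (intro member_le_sum) auto
  define f where "f = ode_coeff \<beta> c \<gamma> d \<delta> f0 f1"
  have fle: "cmod (f n) \<le> M * hr n" for n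
  proof (induction n rule: less_induct)
    case (less n)
    consider "n = 0" | "n = 1" | m where "n = Suc (Suc m)"
      by (metis One_nat_def not0_implies_Suc)
    then show ?case
    proof cases
      case 1
      have "M * 1 \<le> M * hr 0" using hr0 M by (intro mult_left_mono) auto
      then show ?thesis using M(2) unfolding 1 f_def ode_coeff.simps by linarith
    next
      case 2
      have "1 * 1 \<le> AK * hr 0" using hr0 AK by (intro mult_mono) auto
      then have "1 \<le> hr 1" using hrrec[of 0] by simp
      then have "M * 1 \<le> M * hr 1" using M by (intro mult_left_mono) auto
      then show ?thesis using M(3) unfolding 2 f_def One_nat_def ode_coeff.simps by linarith
    next
      case 3
      let ?q = "real (Suc (Suc m)) * real (Suc m)"
      have Sm: "AK * S m = real (Suc m) * hr (Suc m)" unfolding S_def by (rule hrrec[symmetric])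
      have S0: "S m \<ge> 0" using S_ge[of 0 m] Hnn[of m] by simp
      \<comment> \<open>Only the term i = 0 of the convolution \<open>S (Suc m)\<close> is kept.
        Since \<open>AK * S m\<close> equals (m + 1) hr(m + 1), all three terms of the recursion are
        then measured against the same quantity.\<close>
      have q: "?q * (M * hr n) \<ge> M * AK * (real (Suc m) * hr (Suc m))"
      proof -
        have "?q * hr n = real (Suc m) * (AK * S (Suc m))"
          using hrrec[of "Suc m"] unfolding 3 S_def by (metis mult.assoc mult.commute)
        also have "\<dots> \<ge> real (Suc m) * (AK * hr (Suc m))"
          using S_ge[of 0 "Suc m"] AK by (intro mult_left_mono) auto
        finally show ?thesis
          using M mult_left_mono[of "real (Suc m) * (AK * hr (Suc m))" "?q * hr n" M] by (simp add: mult_ac)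
      qed
      have "?q * cmod (f n) = cmod (\<beta> * of_nat (Suc m) * f (Suc m)
          + c * (\<Sum>i\<le>m. \<gamma> ^ i / fact i * f (m - i)) + d * \<delta> ^ m / fact m)"
        by (simp add: 3 f_def norm_divide norm_mult del: of_nat_Suc)
      also have "\<dots> \<le> cmod \<beta> * real (Suc m) * cmod (f (Suc m))
          + cmod c * (\<Sum>i\<le>m. cmod \<gamma> ^ i / fact i * cmod (f (m - i))) + cmod d * cmod \<delta> ^ m / fact m"
      proof -
        have "cmod (\<Sum>i\<le>m. \<gamma> ^ i / fact i * f (m - i)) \<le> (\<Sum>i\<le>m. cmod \<gamma> ^ i / fact i * cmod (f (m - i)))"
          by (rule order_trans[OF norm_sum]) (simp add: norm_mult norm_divide norm_power)
        then have "cmod c * cmod (\<Sum>i\<le>m. \<gamma> ^ i / fact i * f (m - i))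
            \<le> cmod c * (\<Sum>i\<le>m. cmod \<gamma> ^ i / fact i * cmod (f (m - i)))"
          by (rule mult_left_mono) simp
        moreover have "cmod (\<beta> * of_nat (Suc m) * f (Suc m)) = cmod \<beta> * real (Suc m) * cmod (f (Suc m))"
          by (simp only: norm_mult norm_of_nat)
        moreover have "cmod (d * \<delta> ^ m / fact m) = cmod d * cmod \<delta> ^ m / fact m"
          by (simp add: norm_mult norm_divide norm_power)
        ultimately show ?thesis
          using norm_triangle_ineq[of "\<beta> * of_nat (Suc m) * f (Suc m) + c * (\<Sum>i\<le>m. \<gamma> ^ i / fact i * f (m - i))" "d * \<delta> ^ m / fact m"]
            norm_triangle_ineq[of "\<beta> * of_nat (Suc m) * f (Suc m)" "c * (\<Sum>i\<le>m. \<gamma> ^ i / fact i * f (m - i))"]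
          unfolding norm_mult[of c] by linarith
      qed
      also have "\<dots> \<le> AK / 3 * real (Suc m) * (M * hr (Suc m)) + AK\<^sup>2 / 3 * (M * S m) + M * (AK\<^sup>2 / 3 * S m)"
      proof (intro add_mono)
        show "cmod \<beta> * real (Suc m) * cmod (f (Suc m)) \<le> AK / 3 * real (Suc m) * (M * hr (Suc m))"
          using AK less[of "Suc m"] 3 by (intro mult_mono) auto
        have "(\<Sum>i\<le>m. cmod \<gamma> ^ i / fact i * cmod (f (m - i))) \<le> (\<Sum>i\<le>m. K ^ i / fact i * (M * hr (m - i)))"
          using K 3 less by (intro sum_mono mult_mono divide_right_mono power_mono) auto
        also have "\<dots> = M * S m"
          by (simp add: S_def sum_distrib_left mult_ac)
        finally show "cmod c * (\<Sum>i\<le>m. cmod \<gamma> ^ i / fact i * cmod (f (m - i))) \<le> AK\<^sup>2 / 3 * (M * S m)"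
          using AK by (intro mult_mono sum_nonneg) auto
        have "cmod d * cmod \<delta> ^ m / fact m \<le> M * (K ^ m / fact m * 1)"
          using M K by (auto intro!: divide_right_mono mult_mono power_mono)
        also have "\<dots> \<le> M * (K ^ m / fact m * hr 0)"
          using M K hr0 by (intro mult_left_mono) auto
        also have "\<dots> \<le> M * S m"
          using S_ge[of m m] M by (intro mult_left_mono) auto
        also have "\<dots> \<le> M * (AK\<^sup>2 / 3 * S m)"
          using mult_right_mono[OF AK(4) S0] M by (intro mult_left_mono) auto
        finally show "cmod d * cmod \<delta> ^ m / fact m \<le> M * (AK\<^sup>2 / 3 * S m)" .
      qed
      also have "\<dots> = M * AK * (real (Suc m) * hr (Suc m))"
      proof -
        have e: "AK\<^sup>2 / 3 * S m = AK / 3 * (real (Suc m) * hr (Suc m))"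
          unfolding Sm[symmetric] by (simp add: power2_eq_square)
        have "AK\<^sup>2 / 3 * (M * S m) = M * (AK\<^sup>2 / 3 * S m)" by simp
        then show ?thesis
          unfolding e by (simp add: field_simps del: of_nat_Suc)
      qed
      also have "\<dots> \<le> ?q * (M * hr n)" by (rule q)
      finally show ?thesis by (simp add: mult_le_cancel_left del: of_nat_Suc)
    qed
  qed
  define Ff where "Ff = Abs_fps f"
  have maj: "fps_conv_radius Ff = \<infinity>" "cmod (eval_fps Ff z) \<le> M * cmod (eval_fps H (of_real (cmod z)))" for z
    using eval_fps_majorant[of H hr Ff M] Hrad Hnn fle by (auto simp: Ff_def)
  have drad: "fps_conv_radius (fps_deriv G) = \<infinity>" if "fps_conv_radius G = \<infinity>" for G :: "complex fps"
    using fps_conv_radius_deriv[of G] that by simp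
  have dmaj: "cmod (eval_fps (fps_deriv Ff) z) \<le> M * cmod (eval_fps (fps_deriv H) (of_real (cmod z)))" for z
  proof (rule eval_fps_majorant(2)[OF drad[OF Hrad]])
    show "fps_nth (fps_deriv H) n = of_real (real (Suc n) * hr (Suc n))" for n
      using Hnn[of "Suc n"] by simp
    show "0 \<le> real (Suc n) * hr (Suc n)" for n using Hnn[of "Suc n"] by simp
    show "cmod (fps_nth (fps_deriv Ff) n) \<le> M * (real (Suc n) * hr (Suc n))" for n
    proof -
      have "cmod (fps_nth (fps_deriv Ff) n) = real (Suc n) * cmod (f (Suc n))"
        by (simp add: Ff_def norm_mult del: of_nat_Suc flip: Suc_eq_plus1)
      also have "\<dots> \<le> real (Suc n) * (M * hr (Suc n))"
        by (intro mult_left_mono fle) auto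
      finally show ?thesis by (simp add: mult_ac)
    qed
  qed
  have ode: "fps_deriv (fps_deriv Ff) = fps_const \<beta> * fps_deriv Ff
      + fps_const c * (fps_exp \<gamma> * Ff) + fps_const d * fps_exp \<delta>"
  proof (rule fps_ext)
    fix n
    have "fps_nth (fps_deriv (fps_deriv Ff)) n = of_nat (Suc (Suc n)) * of_nat (Suc n) * f (Suc (Suc n))"
      by (simp add: Ff_def algebra_simps)
    also have "\<dots> = \<beta> * of_nat (Suc n) * f (Suc n)
          + c * (\<Sum>i\<le>n. \<gamma> ^ i / fact i * f (n - i)) + d * \<delta> ^ n / fact n"
      by (simp add: f_def del: of_nat_Suc)
    also have "\<dots> = fps_nth (fps_const \<beta> * fps_deriv Ff
      + fps_const c * (fps_exp \<gamma> * Ff) + fps_const d * fps_exp \<delta>) n"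
      by (simp add: Ff_def fps_mult_nth[of "fps_exp _"] atLeast0AtMost mult.assoc add.commute)
    finally show "fps_nth (fps_deriv (fps_deriv Ff)) n = \<dots>" .
  qed
  have inf: "fps_conv_radius (F + G) = \<infinity>" "fps_conv_radius (F * G) = \<infinity>"
    if "fps_conv_radius F = \<infinity>" "fps_conv_radius G = \<infinity>" for F G :: "complex fps"
    using fps_conv_radius_add[of F G] fps_conv_radius_mult[of F G] that by auto
  show ?thesis
  proof (rule that[of "eval_fps Ff" "eval_fps (fps_deriv Ff)"])
    show "(eval_fps Ff has_field_derivative eval_fps (fps_deriv Ff) z) (at z)" for z
      by (rule has_field_derivative_eval_fps) (simp add: maj)
    have "eval_fps (fps_deriv (fps_deriv Ff)) z = \<beta> * eval_fps (fps_deriv Ff) z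
        + c * exp (\<gamma> * z) * eval_fps Ff z + d * exp (\<delta> * z)" for z
      unfolding ode by (simp add: eval_fps_add eval_fps_mult inf drad maj mult.assoc)
    then show "(eval_fps (fps_deriv Ff) has_field_derivative \<beta> * eval_fps (fps_deriv Ff) z
        + c * exp (\<gamma> * z) * eval_fps Ff z + d * exp (\<delta> * z)) (at z)" for z
      using has_field_derivative_eval_fps[of z "fps_deriv Ff" UNIV] by (simp add: drad maj)
    show "eval_fps Ff 0 = f0" "eval_fps (fps_deriv Ff) 0 = f1"
      by (simp_all add: eval_fps_at_0 Ff_def f_def)
    have hn: "cmod (h (of_real (cmod z))) = exp (A * exp (K * cmod z))" for z
      by (simp add: h_def norm_exp_eq_Re exp_of_real flip: of_real_mult)
    show "cmod (eval_fps Ff z) \<le> M * exp (A * exp (K * cmod z))" for z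
      using maj(2)[of z] by (simp add: Heval hn)
    have "eval_fps (fps_deriv H) (of_real (cmod z)) = of_real AK * exp (of_real (K * cmod z)) * h (of_real (cmod z))" for z
      unfolding Hd by (simp add: eval_fps_mult inf Hrad Heval)
    then show "cmod (eval_fps (fps_deriv Ff) z) \<le> M * (A * K * exp (K * cmod z) * exp (A * exp (K * cmod z)))" for z
      using dmaj[of z] A K by (simp add: norm_mult hn AK_def exp_of_real[symmetric] norm_exp_eq_Re abs_mult)
  qed
qed

subsection \<open>A solution of infinite order\<close>

lemma deriv_exp_tan_exp:
  assumes "cos (exp z) \<noteq> (0::complex)"
  shows "((\<lambda>w. exp w * tan (exp w)) has_field_derivative
           exp z * tan (exp z) + (exp z)\<^sup>2 * (1 + (tan (exp z))\<^sup>2)) (at z)"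
proof -
  have "inverse ((cos (exp z))\<^sup>2) = 1 + (tan (exp z))\<^sup>2"
  proof -
    have "(cos (exp z))\<^sup>2 + (sin (exp z))\<^sup>2 = 1" by simp
    then show ?thesis
      using assms by (simp add: tan_def field_simps)
  qed
  then show ?thesis
    using assms by (auto intro!: derivative_eq_intros simp: power2_eq_square algebra_simps)
qed

text \<open>\<open>tan\<close> is sin/cos with division by zero equal to 0, so the plain formula
  already takes the dummy value 0 that the normal form demands at the poles.\<close>

lemma exp_tan_exp_nice:
  defines "u \<equiv> \<lambda>z::complex. exp z * tan (exp z)"
  shows "u nicely_meromorphic_on UNIV" "is_pole u z \<longleftrightarrow> cos (exp z) = 0"
proof -
  define pts where "pts = {z::complex. cos (exp z) = 0}"
  have an: "u analytic_on UNIV - pts"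
  proof -
    have "open (UNIV - pts)"
    proof -
      have "UNIV - pts = {z. cos (exp z) \<noteq> 0}" by (auto simp: pts_def)
      then show ?thesis by (simp add: open_Collect_neq continuous_intros)
    qed
    moreover have "u holomorphic_on UNIV - pts"
      unfolding u_def tan_def pts_def by (intro holomorphic_intros) auto
    ultimately show ?thesis by (simp add: analytic_on_open)
  qed
  have pole: "is_pole u x \<and> u x = 0" if "x \<in> pts" for x
  proof
    have cx: "cos (exp x) = 0" using that by (simp add: pts_def)
    show "u x = 0" using cx by (simp add: u_def tan_def)
    have sx: "sin (exp x) \<noteq> 0"
      using cx sin_cos_squared_add[of "exp x"] by (auto simp: power2_eq_square)
    \<comment> \<open>The value here is cos pi = -1; it shows that cos(exp z) is not identically
      zero, so its zeros are isolated.\<close>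
    have nz: "cos (exp (of_real (ln pi))) \<noteq> (0::complex)"
      by (simp add: exp_of_real cos_of_real)
    have hol: "(\<lambda>z::complex. cos (exp z)) holomorphic_on UNIV"
      by (intro holomorphic_intros)
    obtain r where r: "0 < r" "\<And>z. z \<in> ball x r - {x} \<Longrightarrow> cos (exp z) \<noteq> 0"
      by (rule isolated_zeros[OF hol open_UNIV connected_UNIV UNIV_I cx UNIV_I nz]) blast
    have "eventually (\<lambda>z. z \<in> ball x r - {x}) (at x)"
      using r(1) by (intro eventually_at_in_open) auto
    then have ev: "eventually (\<lambda>z. cos (exp z) \<noteq> 0) (at x)"
      by eventually_elim (use r(2) in blast)
    have "isCont (\<lambda>z. cos (exp z)) x"
      by (intro continuous_intros)
    then have "filterlim (\<lambda>z. cos (exp z)) (at 0) (at x)"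
      using ev cx by (auto simp: filterlim_at isCont_def)
    then have "is_pole (\<lambda>z. (exp z * sin (exp z)) / cos (exp z)) x"
      using sx by (intro is_pole_divide) (auto intro!: continuous_intros)
    then show "is_pole u x" by (simp add: u_def tan_def)
  qed
  have "(\<lambda>z. (exp z * sin (exp z)) / cos (exp z)) meromorphic_on UNIV"
    by (intro meromorphic_on_divide analytic_on_imp_meromorphic_on analytic_intros)
  then have mero: "u meromorphic_on UNIV" by (simp add: u_def tan_def)
  show nice: "u nicely_meromorphic_on UNIV"
    by (rule nicely_meromorphic_onI_open[OF _ an pole])
       (auto intro: meromorphic_on_isolated_singularity meromorphic_on_subset[OF mero])
  have "u analytic_on {z}" if "z \<notin> pts"
    using analytic_on_subset[OF an, of "{z}"] that by simp
  then show "is_pole u z \<longleftrightarrow> cos (exp z) = 0"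
    using pole[of z] analytic_at_imp_no_pole by (auto simp: pts_def)
qed

text \<open>The function satisfies u' = u + u^2 + exp(2z), so with a1 = b1 = 1 and \<alpha> = 0 the
  inner factor is exp(2z), which D - 2 annihilates; this explains the parameters a2 = 0 and b2 =
  2.\<close>

lemma meromorphic_solution_exp_tan_exp:
  "meromorphic_solution 1 0 1 2 0 (\<lambda>z. exp z * tan (exp z))"
proof -
  define u :: "complex \<Rightarrow> complex" where "u = (\<lambda>z. exp z * tan (exp z))"
  define F where "F = D_minus (\<lambda>w. 1 * w + 1) u (\<lambda>x. u x - 0)"
  have F: "F w = exp (2 * w)" if "cos (exp w) \<noteq> 0" for w
  proof -
    have "deriv u w = u w + (exp w)\<^sup>2 * (1 + (tan (exp w))\<^sup>2)"
      unfolding u_def by (rule DERIV_imp_deriv[OF deriv_exp_tan_exp[OF that]])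
    moreover have "exp (2 * w) = (exp w)\<^sup>2" by (rule exp_double)
    ultimately show ?thesis
      by (simp add: F_def D_minus_def u_def power2_eq_square algebra_simps)
  qed
  have "D_minus (\<lambda>w. 0 * w + 2) u F z = 0" if "\<not> is_pole u z" for z
  proof -
    have z: "cos (exp z) \<noteq> 0" using that exp_tan_exp_nice(2)[of z] by (simp add: u_def)
    have "open {w::complex. cos (exp w) \<noteq> 0}"
      by (intro open_Collect_neq continuous_intros)
    then have "eventually (\<lambda>w::complex. cos (exp w) \<noteq> 0) (nhds z)"
      using z eventually_nhds_in_open by fastforce
    then have "eventually (\<lambda>w. F w = exp (2 * w)) (nhds z)"
      by eventually_elim (rule F)
    then have "deriv F z = deriv (\<lambda>w. exp (2 * w)) z"
      by (rule deriv_cong_ev) simp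
    also have "\<dots> = 2 * exp (2 * z)"
      by (rule DERIV_imp_deriv) (auto intro!: derivative_eq_intros)
    finally show ?thesis using F[OF z] by (simp add: D_minus_def)
  qed
  then show ?thesis
    using exp_tan_exp_nice(1) unfolding meromorphic_solution_def F_def u_def by simp
qed

text \<open>The real points ln(pi/2 + m pi) are poles. Exponentially many of them lie within r/2 of
  the origin, and each of these adds at least ln 2 to the counting function at
  \<open>r\<close>.\<close>

lemma nevanlinna_T_exp_tan_exp_ge:
  "\<forall>\<^sub>F r in at_top. nevanlinna_T r (\<lambda>z. exp z * tan (exp z)) \<ge> ln 2 / 8 * exp (1 / 2 * r powr 1)"
proof -
  define u :: "complex \<Rightarrow> complex" where "u = (\<lambda>z. exp z * tan (exp z))"
  have pole: "is_pole u z \<longleftrightarrow> cos (exp z) = 0" for z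
    using exp_tan_exp_nice(2) by (simp add: u_def)
  have mero: "u meromorphic_on UNIV"
    using exp_tan_exp_nice(1) by (simp add: u_def nicely_meromorphic_on_def)
  have bound: "nevanlinna_T r u \<ge> ln 2 / 8 * exp (r / 2)" if r: "r > 0" "exp (r / 2) \<ge> 8" for r
  proof -
    \<comment> \<open>Because pi < 4, the points \<open>x m\<close> with m < n are at most 4n, hence
      at most exp(r/2); because exp(r/2) is at least 8, the floor loses at most half of its
      argument.\<close>
    define n where "n = nat \<lfloor>exp (r / 2) / 4\<rfloor>"
    define x where "x = (\<lambda>m::nat. pi / 2 + real m * pi)"
    define p where "p = (\<lambda>m. complex_of_real (ln (x m)))"
    have x1: "x m > 1" for m
      using pi_gt3 by (simp add: x_def add_pos_nonneg less_le_trans[of 1 "pi / 2"] add_increasing2)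
    have n: "real n \<le> exp (r / 2) / 4" "real n \<ge> exp (r / 2) / 8"
    proof -
      have "real n = of_int \<lfloor>exp (r / 2) / 4\<rfloor>" by (simp add: n_def)
      then show "real n \<le> exp (r / 2) / 4" "real n \<ge> exp (r / 2) / 8"
        using r(2) by linarith+
    qed
    have cp: "cmod (p m) = ln (x m)" "p m \<noteq> 0" for m
      using x1[of m] by (auto simp: p_def)
    have inj: "inj_on p {..<n}"
    proof (rule inj_onI)
      fix i j assume "p i = p j"
      then have "x i = x j" using x1[of i] x1[of j] by (simp add: p_def)
      then show "i = j" by (simp add: x_def)
    qed
    have pm: "is_pole u (p m)" for m
    proof -
      have "exp (p m) = of_real (x m)"
        using x1[of m] by (simp add: p_def exp_of_real)
      moreover have "cos (x m) = 0"
        unfolding x_def cos_add by (simp add: sin_npi)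
      ultimately show ?thesis by (simp add: pole cos_of_real)
    qed
    have small: "ln (x m) \<le> r / 2" if "m < n" for m
    proof -
      have "x m \<le> (real m + 1) * pi" by (simp add: x_def algebra_simps)
      also have "\<dots> \<le> real n * 4"
        using that pi_less_4 by (intro mult_mono) auto
      also have "\<dots> \<le> exp (r / 2)" using n by simp
      finally have "ln (x m) \<le> ln (exp (r / 2))"
        using x1[of m] by (intro ln_mono) auto
      then show ?thesis by simp
    qed
    let ?P = "{q. cmod q \<le> r \<and> is_pole u q \<and> q \<noteq> 0}"
    have finP: "finite ?P"
      by (rule finite_subset[OF _ finite_poles_cball[OF mero, of r]]) auto
    have sub: "p ` {..<n} \<subseteq> ?P"
      using small r cp pm by (force simp: image_subset_iff)
    have summand: "real (nat (- zorder u (p m))) * ln (r / cmod (p m)) \<ge> ln 2" if "m < n" for m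
    proof -
      have iso: "isolated_singularity_at u (p m)"
        by (rule meromorphic_on_isolated_singularity) (rule meromorphic_on_subset[OF mero], simp)
      have "nat (- zorder u (p m)) > 0"
        using pole_local_form[OF iso pm] by blast
      moreover have "ln 2 \<le> ln (r / cmod (p m))"
        using small[OF that] cp[of m] x1[of m] r by (intro ln_mono) (auto simp: field_simps)
      ultimately show ?thesis
        using mult_mono[of 1 "real (nat (- zorder u (p m)))" "ln 2" "ln (r / cmod (p m))"] by simp
    qed
    have "ln 2 / 8 * exp (r / 2) \<le> ln 2 * real n"
      using mult_left_mono[OF n(2), of "ln 2"] by simp
    also have "\<dots> = (\<Sum>m<n. ln 2)" by simp
    also have "\<dots> \<le> (\<Sum>m<n. real (nat (- zorder u (p m))) * ln (r / cmod (p m)))"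
      using summand by (intro sum_mono) auto
    also have "\<dots> = (\<Sum>q\<in>p ` {..<n}. real (nat (- zorder u q)) * ln (r / cmod q))"
      by (simp add: sum.reindex[OF inj])
    also have "\<dots> \<le> (\<Sum>q\<in>?P. real (nat (- zorder u q)) * ln (r / cmod q))"
    proof (rule sum_mono2[OF finP sub])
      fix b assume "b \<in> ?P - p ` {..<n}"
      then have "0 < cmod b" "cmod b \<le> r" by auto
      then show "0 \<le> real (nat (- zorder u b)) * ln (r / cmod b)"
        by (intro mult_nonneg_nonneg ln_ge_zero) (auto simp: field_simps)
    qed
    also have "\<dots> = pole_counting r u"
    proof -
      have "cos (1::complex) \<noteq> 0"
      proof -
        have "cos (1::real) > 0" using pi_gt3 by (intro cos_gt_zero) auto
        then show ?thesis using cos_of_real[of 1, where 'a = complex] by (metis of_real_1 of_real_eq_0_iff less_irrefl)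
      qed
      then have "{z. cmod z \<le> 0 \<and> is_pole u z} = {}" by (auto simp: pole)
      then have "pole_count 0 u = 0" by (metis pole_count_def sum.empty)
      then show ?thesis using pole_counting_eq[OF mero r(1)] by simp
    qed
    also have "\<dots> \<le> nevanlinna_T r u"
    proof -
      have "integral {0..2 * pi} (\<lambda>\<theta>. log_plus (cmod (u (of_real r * cis \<theta>)))) \<ge> 0"
        by (cases "(\<lambda>\<theta>. log_plus (cmod (u (of_real r * cis \<theta>)))) integrable_on {0..2 * pi}")
           (auto intro!: integral_nonneg simp: log_plus_def not_integrable_integral)
      then have "proximity r u \<ge> 0" by (simp add: proximity_def)
      then show ?thesis using r by (simp add: nevanlinna_T_def)
    qed
    finally show ?thesis .
  qed
  have "filterlim (\<lambda>r::real. exp (r / 2)) at_top at_top" by real_asymp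
  then have "eventually (\<lambda>r::real. exp (r / 2) \<ge> 8) at_top"
    by (simp add: filterlim_at_top)
  with eventually_gt_at_top[of 0] show ?thesis
    by eventually_elim (use bound in \<open>simp add: u_def\<close>)
qed

subsection \<open>The linearisable cases\<close>

text \<open>The derivative of a function with a zero of exact order n > 0 has order n - 1, so it is
  not divisible by (z - z0)^n.\<close>

lemma no_common_zero_order:
  fixes X1 Z1 g h :: "complex \<Rightarrow> complex"
  assumes S: "open S" "z0 \<in> S"
    and hol: "X1 holomorphic_on S" "Z1 holomorphic_on S" "g holomorphic_on S" "h holomorphic_on S"
    and n: "n > 0" and nz: "X1 z0 \<noteq> 0"
    and der: "\<And>z. z \<in> S \<Longrightarrow> ((\<lambda>z. (z - z0) ^ n * X1 z) has_field_derivative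
        (z - z0) ^ n * (g z * X1 z + h z * Z1 z)) (at z)"
  shows False
proof -
  \<comment> \<open>The difference of the two expressions for the derivative, divided by (z - z0)^(n
    - 1). It vanishes away from \<open>z0\<close>, yet its value at \<open>z0\<close> is n
    X1(z0).\<close>
  define \<Phi> where "\<Phi> = (\<lambda>z. of_nat n * X1 z + (z - z0) * (deriv X1 z - (g z * X1 z + h z * Z1 z)))"
  have "\<Phi> holomorphic_on S"
    unfolding \<Phi>_def by (intro holomorphic_intros hol S)
  then have "isCont \<Phi> z0"
    using S holomorphic_on_imp_continuous_on continuous_on_eq_continuous_at by blast
  then have lim: "\<Phi> \<midarrow>z0\<rightarrow> \<Phi> z0" by (simp add: isCont_def)
  have zero: "\<Phi> z = 0" if z: "z \<in> S" "z \<noteq> z0" for z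
  proof -
    have "(X1 has_field_derivative deriv X1 z) (at z)"
      using hol(1) S z by (simp add: holomorphic_derivI)
    then have "((\<lambda>z. (z - z0) ^ n * X1 z) has_field_derivative
        (z - z0) ^ n * deriv X1 z + of_nat n * (z - z0) ^ (n - 1) * X1 z) (at z)"
      by (auto intro!: derivative_eq_intros)
    from DERIV_unique[OF this der[OF z(1)]]
    have "(z - z0) ^ n * deriv X1 z + of_nat n * (z - z0) ^ (n - 1) * X1 z
        = (z - z0) ^ n * (g z * X1 z + h z * Z1 z)" .
    moreover have "(z - z0) ^ n = (z - z0) ^ (n - 1) * (z - z0)"
      using n by (metis Suc_diff_1 power_Suc2)
    ultimately have "(z - z0) ^ (n - 1) * \<Phi> z = 0"
      by (simp add: \<Phi>_def algebra_simps)
    then show ?thesis using z(2) by simp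
  qed
  have "eventually (\<lambda>z. z \<in> S - {z0}) (at z0)"
    using S by (intro eventually_at_in_open) auto
  then have "eventually (\<lambda>z. \<Phi> z = 0) (at z0)"
    by eventually_elim (use zero in blast)
  then have "\<Phi> \<midarrow>z0\<rightarrow> 0"
    by (simp add: tendsto_eventually)
  then have "\<Phi> z0 = 0" using lim LIM_unique by blast
  then show False using n nz by (simp add: \<Phi>_def)
qed

text \<open>Uniqueness by orders of vanishing: among the components that are not identically zero,
  one whose order at \<open>z0\<close> is minimal would contradict
  \<open>no_common_zero_order\<close>. Since orders exist on all of a connected domain, the
  conclusion is global at once. An identically zero partner is represented by the factor 0 with the
  same order.\<close>

lemma linear_system_zero:
  fixes X Z g11 g12 g21 g22 :: "complex \<Rightarrow> complex"
  assumes S: "open S" "connected S" "z0 \<in> S"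
    and g: "g11 holomorphic_on S" "g12 holomorphic_on S" "g21 holomorphic_on S" "g22 holomorphic_on S"
    and X: "\<And>z. z \<in> S \<Longrightarrow> (X has_field_derivative g11 z * X z + g12 z * Z z) (at z)"
    and Z: "\<And>z. z \<in> S \<Longrightarrow> (Z has_field_derivative g21 z * X z + g22 z * Z z) (at z)"
    and 0: "X z0 = 0" "Z z0 = 0"
  shows "\<forall>z\<in>S. X z = 0 \<and> Z z = 0"
proof -
  have hol: "X holomorphic_on S" "Z holomorphic_on S"
    using X Z S by (auto simp: holomorphic_on_open)
  have key: "\<not> (m \<le> n)"
    if "X' holomorphic_on S" "Z' holomorphic_on S" "g holomorphic_on S" "h holomorphic_on S"
      and "X' z0 \<noteq> 0" and m: "m > 0"
      and Y: "\<And>z. z \<in> S \<Longrightarrow> Y z = (z - z0) ^ m * X' z" and W: "\<And>z. z \<in> S \<Longrightarrow> W z = (z - z0) ^ n * Z' z"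
      and der: "\<And>z. z \<in> S \<Longrightarrow> (Y has_field_derivative g z * Y z + h z * W z) (at z)"
    for X' Z' g h Y W :: "complex \<Rightarrow> complex" and m n
  proof
    assume mn: "m \<le> n"
    show False
    proof (rule no_common_zero_order[OF S(1,3) that(1) _ that(3,4) m that(5)])
      show "(\<lambda>z. (z - z0) ^ (n - m) * Z' z) holomorphic_on S"
        by (intro holomorphic_intros that)
      fix z assume z: "z \<in> S"
      have "(z - z0) ^ n = (z - z0) ^ m * (z - z0) ^ (n - m)"
        using mn by (simp flip: power_add)
      then have "g z * Y z + h z * W z = (z - z0) ^ m * (g z * X' z + h z * ((z - z0) ^ (n - m) * Z' z))"
        using Y[OF z] W[OF z] by (simp add: algebra_simps)
      then have "(Y has_field_derivative (z - z0) ^ m * (g z * X' z + h z * ((z - z0) ^ (n - m) * Z' z))) (at z)"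
        using der[OF z] by simp
      then show "((\<lambda>z. (z - z0) ^ m * X' z) has_field_derivative
          (z - z0) ^ m * (g z * X' z + h z * ((z - z0) ^ (n - m) * Z' z))) (at z)"
        by (rule has_field_derivative_transform_within_open[OF _ S(1) z]) (simp add: Y)
    qed
  qed
  have fac: "\<exists>m Y'. Y' holomorphic_on S \<and> Y' z0 \<noteq> 0 \<and> m > 0 \<and> (\<forall>z\<in>S. Y z = (z - z0) ^ m * Y' z)"
    if Y: "Y holomorphic_on S" "Y z0 = 0" "\<exists>w\<in>S. Y w \<noteq> 0" for Y
  proof -
    obtain n H where H: "H holomorphic_on S" "H z0 \<noteq> 0" "\<And>z. z \<in> S \<Longrightarrow> Y z = (z - z0) ^ n * H z"
      using holomorphic_factor_at[OF Y(1) S Y(3)] by metis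
    have "n > 0" using H(2) H(3)[OF S(3)] Y(2) by (cases n) auto
    then show ?thesis using H by blast
  qed
  have Z': "(Z has_field_derivative g22 z * Z z + g21 z * X z) (at z)" if "z \<in> S" for z
    using Z[OF that] by (simp add: add.commute)
  show ?thesis
  proof (cases "\<exists>w\<in>S. X w \<noteq> 0")
    case XT: True
    then obtain m X' where X': "X' holomorphic_on S" "X' z0 \<noteq> 0" "m > 0" "\<And>z. z \<in> S \<Longrightarrow> X z = (z - z0) ^ m * X' z"
      using fac[OF hol(1) 0(1)] by blast
    show ?thesis
    proof (cases "\<exists>w\<in>S. Z w \<noteq> 0")
      case True
      then obtain n Z' where Z'': "Z' holomorphic_on S" "Z' z0 \<noteq> 0" "n > 0" "\<And>z. z \<in> S \<Longrightarrow> Z z = (z - z0) ^ n * Z' z"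
        using fac[OF hol(2) 0(2)] by blast
      have "\<not> m \<le> n"
        by (rule key[OF X'(1) Z''(1) g(1,2) X'(2,3,4) Z''(4) X])
      moreover have "\<not> n \<le> m"
        by (rule key[OF Z''(1) X'(1) g(4,3) Z''(2,3,4) X'(4) Z'])
      ultimately show ?thesis by linarith
    next
      case False
      have "\<not> m \<le> m"
        by (rule key[OF X'(1) holomorphic_on_const[of 0] g(1,2) X'(2,3,4) _ X]) (use False in auto)
      then show ?thesis by simp
    qed
  next
    case False
    show ?thesis
    proof (cases "\<exists>w\<in>S. Z w \<noteq> 0")
      case True
      then obtain n Z' where Z'': "Z' holomorphic_on S" "Z' z0 \<noteq> 0" "n > 0" "\<And>z. z \<in> S \<Longrightarrow> Z z = (z - z0) ^ n * Z' z"
        using fac[OF hol(2) 0(2)] by blast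
      have "\<not> n \<le> n"
        by (rule key[OF Z''(1) holomorphic_on_const[of 0] g(4,3) Z''(2,3,4) _ Z']) (use False in auto)
      then show ?thesis by simp
    qed (use False in auto)
  qed
qed

lemma linear_ode_zero:
  fixes X g :: "complex \<Rightarrow> complex"
  assumes S: "open S" "connected S" "z0 \<in> S" and g: "g holomorphic_on S"
    and X: "\<And>z. z \<in> S \<Longrightarrow> (X has_field_derivative g z * X z) (at z)" and "X z0 = 0"
  shows "\<forall>z\<in>S. X z = 0"
proof -
  have "\<forall>z\<in>S. X z = 0 \<and> (\<lambda>_. 0 :: complex) z = 0"
    by (rule linear_system_zero[OF S g holomorphic_on_const[of 0] holomorphic_on_const[of 0] holomorphic_on_const[of 0]])
       (use X assms in auto)
  then show ?thesis by blast
qed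

section \<open>Functions of at most doubly exponential growth and quotients of such
  functions\<close>

definition double_exp_bounded :: "(complex \<Rightarrow> real) \<Rightarrow> bool" where
  "double_exp_bounded f \<longleftrightarrow> (\<exists>A B. A \<ge> 0 \<and> B \<ge> 0 \<and> (\<forall>z. \<bar>f z\<bar> \<le> exp (A * exp (B * cmod z))))"

lemma double_exp_bounded_mono:
  assumes "double_exp_bounded g" "\<And>z. \<bar>f z\<bar> \<le> g z"
  shows "double_exp_bounded f"
  using assms unfolding double_exp_bounded_def by (meson abs_ge_self order_trans)

lemma double_exp_bounded_const: "double_exp_bounded (\<lambda>_. c)"
proof -
  have "\<bar>c\<bar> \<le> exp (\<bar>c\<bar> * exp (0 * cmod z))" for z
  proof -
    have "\<bar>c\<bar> \<le> exp \<bar>c\<bar>" using exp_ge_add_one_self[of "\<bar>c\<bar>"] by linarith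
    then show ?thesis by simp
  qed
  then show ?thesis unfolding double_exp_bounded_def by (metis abs_ge_zero order_refl)
qed

lemma double_exp_bounded_exp: "double_exp_bounded (\<lambda>z. exp (K * cmod z))"
proof -
  have "\<bar>exp (K * cmod z)\<bar> \<le> exp (1 * exp (\<bar>K\<bar> * cmod z))" for z
  proof -
    have "K * cmod z \<le> \<bar>K\<bar> * cmod z" by (intro mult_right_mono) auto
    also have "\<dots> \<le> exp (\<bar>K\<bar> * cmod z)" using exp_ge_add_one_self[of "\<bar>K\<bar> * cmod z"] by linarith
    finally show ?thesis by simp
  qed
  then show ?thesis unfolding double_exp_bounded_def by (metis abs_ge_zero zero_le_one)
qed

lemma double_exp_bounded_exp_exp: "double_exp_bounded (\<lambda>z. exp (A * exp (K * cmod z)))"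
proof -
  have "\<bar>exp (A * exp (K * cmod z))\<bar> \<le> exp (\<bar>A\<bar> * exp (\<bar>K\<bar> * cmod z))" for z
  proof -
    have "K * cmod z \<le> \<bar>K\<bar> * cmod z" by (intro mult_right_mono) auto
    then have "A * exp (K * cmod z) \<le> \<bar>A\<bar> * exp (\<bar>K\<bar> * cmod z)" by (intro mult_mono) auto
    then show ?thesis by simp
  qed
  then show ?thesis unfolding double_exp_bounded_def by (metis abs_ge_zero)
qed

lemma double_exp_bounded_mult_add:
  assumes "double_exp_bounded f" "double_exp_bounded g"
  shows "double_exp_bounded (\<lambda>z. f z * g z)" "double_exp_bounded (\<lambda>z. f z + g z)"
proof -
  obtain A B where 1: "A \<ge> 0" "B \<ge> 0" "\<And>z. \<bar>f z\<bar> \<le> exp (A * exp (B * cmod z))"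
    using assms(1) unfolding double_exp_bounded_def by blast
  obtain A' B' where 2: "A' \<ge> 0" "B' \<ge> 0" "\<And>z. \<bar>g z\<bar> \<le> exp (A' * exp (B' * cmod z))"
    using assms(2) unfolding double_exp_bounded_def by blast
  have le: "A * exp (B * cmod z) + A' * exp (B' * cmod z) + 1 \<le> (A + A' + 1) * exp ((B + B') * cmod z)"
    and nn: "0 \<le> A * exp (B * cmod z)" "0 \<le> A' * exp (B' * cmod z)" for z
  proof -
    have "A * exp (B * cmod z) \<le> A * exp ((B + B') * cmod z)" "A' * exp (B' * cmod z) \<le> A' * exp ((B + B') * cmod z)"
      using 1 2 by (auto intro!: mult_left_mono mult_right_mono)
    moreover have "1 \<le> exp ((B + B') * cmod z)" using 1 2 by simp
    moreover have "(A + A' + 1) * e = A * e + A' * e + e" for e :: real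
      by (simp add: algebra_simps)
    ultimately show "A * exp (B * cmod z) + A' * exp (B' * cmod z) + 1 \<le> (A + A' + 1) * exp ((B + B') * cmod z)"
      by (smt (verit))
  qed (use 1 2 in auto)
  have "\<bar>f z * g z\<bar> \<le> exp ((A + A' + 1) * exp ((B + B') * cmod z))" for z
  proof -
    have "\<bar>f z * g z\<bar> \<le> exp (A * exp (B * cmod z)) * exp (A' * exp (B' * cmod z))"
      unfolding abs_mult using 1 2 by (intro mult_mono) auto
    also have "\<dots> \<le> exp ((A + A' + 1) * exp ((B + B') * cmod z))"
      unfolding exp_add[symmetric] using le[of z] by (subst exp_le_cancel_iff) linarith
    finally show ?thesis .
  qed
  then show "double_exp_bounded (\<lambda>z. f z * g z)"
    unfolding double_exp_bounded_def using 1 2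
    by (intro exI[of _ "A + A' + 1"] exI[of _ "B + B'"]) auto
  have "\<bar>f z + g z\<bar> \<le> exp ((A + A' + 1) * exp ((B + B') * cmod z))" for z
  proof -
    let ?s = "A * exp (B * cmod z) + A' * exp (B' * cmod z)"
    have "\<bar>f z + g z\<bar> \<le> exp (A * exp (B * cmod z)) + exp (A' * exp (B' * cmod z))"
      using 1(3)[of z] 2(3)[of z] by linarith
    also have "\<dots> \<le> exp ?s + exp ?s"
      using nn[of z] by (intro add_mono) auto
    also have "\<dots> \<le> exp 1 * exp ?s"
      using exp_ge_add_one_self[of 1] mult_right_mono[of 2 "exp 1" "exp ?s"] by simp
    also have "\<dots> \<le> exp ((A + A' + 1) * exp ((B + B') * cmod z))"
      unfolding exp_add[symmetric] using le[of z] by (subst exp_le_cancel_iff) linarith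
    finally show ?thesis .
  qed
  then show "double_exp_bounded (\<lambda>z. f z + g z)"
    unfolding double_exp_bounded_def using 1 2
    by (intro exI[of _ "A + A' + 1"] exI[of _ "B + B'"]) auto
qed

text \<open>Initial data are prescribed at an arbitrary \<open>z0\<close>, because the origin may be
  a pole of \<open>u\<close>. Translation multiplies \<open>c\<close> and \<open>d\<close> by
  exp(\<gamma> z0) and exp(\<delta> z0) and keeps the form of the equation.\<close>

lemma linear_ode_entire:
  fixes \<beta> c \<gamma> d \<delta> f0 f1 z0 :: complex
  obtains F F' :: "complex \<Rightarrow> complex" where
    "\<And>z. (F has_field_derivative F' z) (at z)"
    "\<And>z. (F' has_field_derivative \<beta> * F' z + c * exp (\<gamma> * z) * F z + d * exp (\<delta> * z)) (at z)"
    "F z0 = f0" "F' z0 = f1"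
    "double_exp_bounded (\<lambda>z. cmod (F z))" "double_exp_bounded (\<lambda>z. cmod (F' z))"
proof -
  obtain F F' and A K M :: real where F:
    "\<And>z. (F has_field_derivative F' z) (at z)"
    "\<And>z. (F' has_field_derivative \<beta> * F' z + (c * exp (\<gamma> * z0)) * exp (\<gamma> * z) * F z
        + (d * exp (\<delta> * z0)) * exp (\<delta> * z)) (at z)"
    "F 0 = f0" "F' 0 = f1"
    "\<And>z. cmod (F z) \<le> M * exp (A * exp (K * cmod z))"
    "\<And>z. cmod (F' z) \<le> M * (A * K * exp (K * cmod z) * exp (A * exp (K * cmod z)))"
    by (rule linear_ode_entire_at_0[where \<beta> = \<beta> and c = "c * exp (\<gamma> * z0)" and \<gamma> = \<gamma> and d = "d * exp (\<delta> * z0)"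
          and \<delta> = \<delta> and ?f0.0 = f0 and ?f1.0 = f1]) (rule that)
  define M' A' K' where "M' = \<bar>M\<bar>" and "A' = \<bar>A\<bar> * exp (\<bar>K\<bar> * cmod z0)" and "K' = \<bar>K\<bar>"
  have E: "exp (A * exp (K * cmod (z - z0))) \<le> exp (A' * exp (K' * cmod z))"
      "exp (K * cmod (z - z0)) \<le> exp (K' * cmod z0) * exp (K' * cmod z)" for z
  proof -
    have "K * cmod (z - z0) \<le> \<bar>K\<bar> * (cmod z0 + cmod z)"
      using norm_triangle_ineq4[of z z0] by (intro mult_mono) auto
    then have "exp (K * cmod (z - z0)) \<le> exp (\<bar>K\<bar> * (cmod z0 + cmod z))" by simp
    then show 1: "exp (K * cmod (z - z0)) \<le> exp (K' * cmod z0) * exp (K' * cmod z)"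
      by (simp add: K'_def distrib_left exp_add)
    have "A * exp (K * cmod (z - z0)) \<le> \<bar>A\<bar> * (exp (K' * cmod z0) * exp (K' * cmod z))"
      using 1 by (intro mult_mono) auto
    then show "exp (A * exp (K * cmod (z - z0))) \<le> exp (A' * exp (K' * cmod z))"
      by (simp add: A'_def K'_def mult.assoc)
  qed
  show ?thesis
  proof (rule that[of "\<lambda>z. F (z - z0)" "\<lambda>z. F' (z - z0)"])
    have e: "exp (x * z0) * exp (x * (z - z0)) = exp (x * z)" for x z :: complex
      by (simp add: algebra_simps flip: exp_add)
    show "((\<lambda>z. F (z - z0)) has_field_derivative F' (z - z0)) (at z)" for z
      by (rule DERIV_chain'[OF _ F(1), of _ 1, simplified]) (auto intro!: derivative_eq_intros)
    show "((\<lambda>z. F' (z - z0)) has_field_derivative \<beta> * F' (z - z0) + c * exp (\<gamma> * z) * F (z - z0)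
        + d * exp (\<delta> * z)) (at z)" for z
    proof -
      have "((\<lambda>z. F' (z - z0)) has_field_derivative \<beta> * F' (z - z0) + (c * exp (\<gamma> * z0)) * exp (\<gamma> * (z - z0)) * F (z - z0)
        + (d * exp (\<delta> * z0)) * exp (\<delta> * (z - z0))) (at z)"
        by (rule DERIV_chain'[OF _ F(2), of _ 1, simplified mult_1_right]) (auto intro!: derivative_eq_intros)
      moreover have "c * exp (\<gamma> * z0) * exp (\<gamma> * (z - z0)) = c * exp (\<gamma> * z)"
        "d * exp (\<delta> * z0) * exp (\<delta> * (z - z0)) = d * exp (\<delta> * z)"
        by (simp_all only: mult.assoc e)
      ultimately show ?thesis by (simp only:)
    qed
    show "double_exp_bounded (\<lambda>z. cmod (F (z - z0)))"
    proof (rule double_exp_bounded_mono)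
      show "double_exp_bounded (\<lambda>z. M' * exp (A' * exp (K' * cmod z)))"
        by (intro double_exp_bounded_mult_add double_exp_bounded_const double_exp_bounded_exp_exp)
      show "\<bar>cmod (F (z - z0))\<bar> \<le> M' * exp (A' * exp (K' * cmod z))" for z
      proof -
        have "cmod (F (z - z0)) \<le> M * exp (A * exp (K * cmod (z - z0)))" by (rule F)
        also have "\<dots> \<le> M' * exp (A' * exp (K' * cmod z))"
          using E by (intro mult_mono) (auto simp: M'_def)
        finally show ?thesis by simp
      qed
    qed
    show "double_exp_bounded (\<lambda>z. cmod (F' (z - z0)))"
    proof (rule double_exp_bounded_mono)
      show "double_exp_bounded (\<lambda>z. M' * (\<bar>A * K\<bar> * (exp (K' * cmod z0) * exp (K' * cmod z)) * exp (A' * exp (K' * cmod z))))"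
        by (intro double_exp_bounded_mult_add double_exp_bounded_const double_exp_bounded_exp double_exp_bounded_exp_exp)
      show "\<bar>cmod (F' (z - z0))\<bar> \<le> M' * (\<bar>A * K\<bar> * (exp (K' * cmod z0) * exp (K' * cmod z)) * exp (A' * exp (K' * cmod z)))" for z
      proof -
        have "cmod (F' (z - z0)) \<le> M * (A * K * exp (K * cmod (z - z0)) * exp (A * exp (K * cmod (z - z0))))" by (rule F)
        also have "\<dots> \<le> \<bar>M * (A * K * exp (K * cmod (z - z0)) * exp (A * exp (K * cmod (z - z0))))\<bar>" by simp
        also have "\<dots> = M' * (\<bar>A * K\<bar> * exp (K * cmod (z - z0)) * exp (A * exp (K * cmod (z - z0))))"
          by (simp add: abs_mult M'_def)
        also have "\<dots> \<le> M' * (\<bar>A * K\<bar> * (exp (K' * cmod z0) * exp (K' * cmod z)) * exp (A' * exp (K' * cmod z)))"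
          using E by (intro mult_mono mult_nonneg_nonneg) (auto simp: M'_def)
        finally show ?thesis by simp
      qed
    qed
  qed (use F in auto)
qed

lemma nevanlinna_growth_entire_quotient:
  fixes u F G :: "complex \<Rightarrow> complex"
  assumes u: "u nicely_meromorphic_on UNIV"
    and F: "F holomorphic_on UNIV" and G: "G holomorphic_on UNIV" "\<exists>z. G z \<noteq> 0"
    and eq: "\<And>z. \<not> is_pole u z \<Longrightarrow> u z * G z = F z"
    and bd: "double_exp_bounded (\<lambda>z. cmod (F z))" "double_exp_bounded (\<lambda>z. cmod (G z))"
  shows "\<exists>a b c :: real. a > 0 \<and> b > 0 \<and> c > 0 \<and>
           (\<forall>r\<ge>0. nevanlinna_T r u < a * exp (b * r powr c))"
proof -
  obtain k H where H: "H holomorphic_on UNIV" "H 0 \<noteq> 0" "\<And>z. G z = z ^ k * H z"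
    using holomorphic_factor_at[OF G(1) open_UNIV connected_UNIV, of 0] G(2) by (metis UNIV_I diff_zero)
  have "double_exp_bounded (\<lambda>z. cmod (F z) + cmod (G z))"
    using bd by (rule double_exp_bounded_mult_add)
  then obtain A B where AB: "\<And>z. \<bar>cmod (F z) + cmod (G z)\<bar> \<le> exp (A * exp (B * cmod z))"
    unfolding double_exp_bounded_def by blast
  have le: "cmod (F z) \<le> exp (A * exp (B * cmod z))" "cmod (G z) \<le> exp (A * exp (B * cmod z))" for z
    using AB[of z] by (auto simp: abs_if split: if_splits) (smt (verit) norm_ge_zero)+
  show ?thesis
  proof (rule nevanlinna_growth_quotient[OF u, of "cmod (H 0)" k A B])
    fix r :: real assume "r > 0"
    show "\<exists>R F H'. r < R \<and> F holomorphic_on ball 0 R \<and> H' holomorphic_on ball 0 R \<and>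
        cmod (H 0) \<le> cmod (H' 0) \<and> (\<forall>z\<in>ball 0 R. \<not> is_pole u z \<longrightarrow> u z * (z ^ k * H' z) = F z) \<and>
        (\<forall>z. cmod z = r \<longrightarrow> cmod (F z) \<le> exp (A * exp (B * r)) \<and>
              cmod (z ^ k * H' z) \<le> exp (A * exp (B * r)))"
      using eq le H(3) by (intro exI[of _ "r + 1"] exI[of _ F] exI[of _ H])
        (auto intro: holomorphic_on_subset[OF F] holomorphic_on_subset[OF H(1)])
  qed (use H in auto)
qed

section \<open>The inner factor of a solution and the Riccati equation\<close>

locale double_product_solution =
  fixes a1 a2 b1 b2 \<alpha> :: complex and u :: "complex \<Rightarrow> complex"
  assumes solution: "meromorphic_solution a1 a2 b1 b2 \<alpha> u"
begin

definition S where "S = {z. \<not> is_pole u z}"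

definition v0 where "v0 = (\<lambda>z. deriv u z - (a1 * u z + b1) * (u z - \<alpha>))"

lemma nice: "u nicely_meromorphic_on UNIV"
  using solution by (simp add: meromorphic_solution_def)

lemma mero: "u meromorphic_on UNIV"
  using nice by (simp add: nicely_meromorphic_on_def)

lemma S_open: "open S" and S_connected: "connected S" and S_nonempty: "\<exists>z. z \<in> S"
proof -
  have sp: "{z. is_pole u z} sparse_in UNIV"
    using meromorphic_on_imp_not_pole_cosparse[OF mero] by (simp add: eventually_cosparse)
  have S: "S = UNIV - {z. is_pole u z}" by (auto simp: S_def)
  show "open S" unfolding S by (rule open_diff_sparse_pts[OF open_UNIV sp])
  show "connected S" unfolding S by (rule sparse_imp_connected[OF _ connected_UNIV open_UNIV sp]) simp
  have "countable (UNIV \<inter> {z. is_pole u z})"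
    by (rule sparse_imp_countable[OF open_UNIV sp])
  then show "\<exists>z. z \<in> S"
    using uncountable_UNIV_complex unfolding S_def by (metis (mono_tags, lifting) Int_UNIV_left UNIV_eq_I mem_Collect_eq)
qed

lemma u_holomorphic: "u holomorphic_on S"
proof -
  have "u analytic_on {z}" if "z \<in> S" for z
    using nicely_meromorphic_on_imp_analytic_at[OF nice] that by (simp add: S_def)
  then have "u analytic_on S" using analytic_on_analytic_at by blast
  then show ?thesis by (rule analytic_imp_holomorphic)
qed

lemma u_deriv: "z \<in> S \<Longrightarrow> (u has_field_derivative (a1 * u z + b1) * (u z - \<alpha>) + v0 z) (at z)"
  using holomorphic_derivI[OF u_holomorphic S_open] by (simp add: v0_def)

lemma v0_holomorphic: "v0 holomorphic_on S"
  unfolding v0_def by (intro holomorphic_intros u_holomorphic S_open)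

lemma v0_deriv:
  assumes z: "z \<in> S"
  shows "(v0 has_field_derivative (a2 * u z + b2) * v0 z) (at z)"
proof -
  have eq: "D_minus (\<lambda>w. a1 * w + b1) u (\<lambda>x. u x - \<alpha>) w = v0 w" if "w \<in> S" for w
  proof -
    have "((\<lambda>x. u x - \<alpha>) has_field_derivative deriv u w) (at w)"
      using holomorphic_derivI[OF u_holomorphic S_open that] by (auto intro!: derivative_eq_intros)
    then have "deriv (\<lambda>x. u x - \<alpha>) w = deriv u w" by (rule DERIV_imp_deriv)
    then show ?thesis by (simp add: D_minus_def v0_def)
  qed
  have "eventually (\<lambda>w. w \<in> S) (nhds z)"
    using S_open z by (rule eventually_nhds_in_open)
  then have "eventually (\<lambda>w. D_minus (\<lambda>w. a1 * w + b1) u (\<lambda>x. u x - \<alpha>) w = v0 w) (nhds z)"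
    by eventually_elim (rule eq)
  then have "deriv (D_minus (\<lambda>w. a1 * w + b1) u (\<lambda>x. u x - \<alpha>)) z = deriv v0 z"
    by (rule deriv_cong_ev) simp
  then have "deriv v0 z = (a2 * u z + b2) * v0 z"
    using solution z eq[OF z] by (simp add: meromorphic_solution_def S_def D_minus_def[of "\<lambda>w. a2 * w + b2"])
  then show ?thesis
    using holomorphic_derivI[OF v0_holomorphic S_open z] by simp
qed

lemma v0_zero_or_nonzero: "(\<forall>z\<in>S. v0 z = 0) \<or> (\<forall>z\<in>S. v0 z \<noteq> 0)"
proof (rule disjCI)
  assume "\<not> (\<forall>z\<in>S. v0 z \<noteq> 0)"
  then obtain z0 where "z0 \<in> S" "v0 z0 = 0" by blast
  then show "\<forall>z\<in>S. v0 z = 0"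
    by (intro linear_ode_zero[OF S_open S_connected _ _ v0_deriv]) (auto intro!: holomorphic_intros u_holomorphic)
qed

lemma w_deriv:
  assumes "z \<in> S"
  shows "((\<lambda>z. u z - \<alpha>) has_field_derivative a1 * (u z - \<alpha>)\<^sup>2 + (a1 * \<alpha> + b1) * (u z - \<alpha>) + v0 z) (at z)"
proof -
  have "((\<lambda>z. u z - \<alpha>) has_field_derivative (a1 * u z + b1) * (u z - \<alpha>) + v0 z) (at z)"
    using u_deriv[OF assms] by (auto intro!: derivative_eq_intros)
  then show ?thesis by (simp add: power2_eq_square algebra_simps)
qed

abbreviation growth_bound where
  "growth_bound \<equiv> (\<exists>a b c :: real. a > 0 \<and> b > 0 \<and> c > 0 \<and>
           (\<forall>r\<ge>0. nevanlinna_T r u < a * exp (b * r powr c)))"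

text \<open>When the inner factor is an exponential, the Riccati equation for \<open>w = u - \<alpha>\<close> is linearised by
  \<open>w = - F' / (a1 F)\<close> with \<open>F'' = \<beta> F' - a1 c exp (b z) F\<close>.\<close>

lemma growth_v0_exponential:
  assumes v0: "\<And>z. z \<in> S \<Longrightarrow> v0 z = c * exp (b * z)"
  shows growth_bound
proof -
  obtain z0 where z0: "z0 \<in> S" using S_nonempty by blast
  define \<beta> where "\<beta> = a1 * \<alpha> + b1"
  have w': "((\<lambda>z. u z - \<alpha>) has_field_derivative a1 * (u z - \<alpha>)\<^sup>2 + \<beta> * (u z - \<alpha>) + c * exp (b * z)) (at z)"
    if "z \<in> S" for z
    using w_deriv[OF that] v0[OF that] by (simp add: \<beta>_def)
  show ?thesis
  proof (cases "a1 = 0")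
    case False
    obtain F F' where F: "\<And>z. (F has_field_derivative F' z) (at z)"
      "\<And>z. (F' has_field_derivative \<beta> * F' z + (- a1 * c) * exp (b * z) * F z + 0 * exp (0 * z)) (at z)"
      "F z0 = 1" "F' z0 = - a1 * (u z0 - \<alpha>)"
      "double_exp_bounded (\<lambda>z. cmod (F z))" "double_exp_bounded (\<lambda>z. cmod (F' z))"
      by (rule linear_ode_entire[where \<beta> = \<beta> and c = "- a1 * c" and \<gamma> = b and d = 0 and \<delta> = 0
          and ?f0.0 = 1 and ?f1.0 = "- a1 * (u z0 - \<alpha>)" and ?z0.0 = z0]) (rule that)
    have hol: "F holomorphic_on UNIV" "F' holomorphic_on UNIV"
      using F(1,2) by (auto simp: holomorphic_on_open)
    \<comment> \<open>The initial values make this combination vanish at \<open>z0\<close>, and the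
      Riccati equation makes it solve a homogeneous linear equation; hence w = -F'/(a1 F) holds on
      all of \<open>S\<close>.\<close>
    have "\<forall>z\<in>S. F' z + a1 * (u z - \<alpha>) * F z = 0"
    proof (rule linear_ode_zero[OF S_open S_connected z0])
      show "(\<lambda>z. \<beta> + a1 * (u z - \<alpha>)) holomorphic_on S"
        by (intro holomorphic_intros u_holomorphic)
      show "((\<lambda>z. F' z + a1 * (u z - \<alpha>) * F z) has_field_derivative
          (\<beta> + a1 * (u z - \<alpha>)) * (F' z + a1 * (u z - \<alpha>) * F z)) (at z)" if "z \<in> S" for z
        by (rule DERIV_cong[OF DERIV_add[OF F(2) DERIV_mult[OF DERIV_cmult[OF w'[OF that]] F(1)]]])
           (simp add: power2_eq_square algebra_simps)
    qed (simp add: F)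
    then have eq: "u z * (a1 * F z) = \<alpha> * (a1 * F z) - F' z" if "z \<in> S" for z
      using that by (simp add: algebra_simps eq_neg_iff_add_eq_0)
    show ?thesis
    proof (rule nevanlinna_growth_entire_quotient[OF nice, of "\<lambda>z. \<alpha> * (a1 * F z) - F' z" "\<lambda>z. a1 * F z"])
      show "\<exists>z. a1 * F z \<noteq> 0" using F(3) False by (intro exI[of _ z0]) simp
      show "double_exp_bounded (\<lambda>z. cmod (a1 * F z))"
        unfolding norm_mult by (intro double_exp_bounded_mult_add double_exp_bounded_const F)
      show "double_exp_bounded (\<lambda>z. cmod (\<alpha> * (a1 * F z) - F' z))"
      proof (rule double_exp_bounded_mono)
        show "double_exp_bounded (\<lambda>z. cmod (\<alpha> * a1) * cmod (F z) + cmod (F' z))"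
          by (intro double_exp_bounded_mult_add double_exp_bounded_const F)
        show "\<bar>cmod (\<alpha> * (a1 * F z) - F' z)\<bar> \<le> cmod (\<alpha> * a1) * cmod (F z) + cmod (F' z)" for z
          using norm_triangle_ineq4[of "\<alpha> * (a1 * F z)" "F' z"] by (simp add: norm_mult mult.assoc)
      qed
    qed (use eq in \<open>auto simp: S_def intro!: holomorphic_intros hol\<close>)
  next
    case True
    \<comment> \<open>For a1 = 0 the equation w' = \<beta> w + c exp(b z) is already linear. Its
      derivative has the second-order form treated above, and the initial value of F' restores the
      first-order equation.\<close>
    obtain F F' where F: "\<And>z. (F has_field_derivative F' z) (at z)"
      "\<And>z. (F' has_field_derivative \<beta> * F' z + 0 * exp (0 * z) * F z + (c * b) * exp (b * z)) (at z)"
      "F z0 = u z0 - \<alpha>" "F' z0 = \<beta> * (u z0 - \<alpha>) + c * exp (b * z0)"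
      "double_exp_bounded (\<lambda>z. cmod (F z))" "double_exp_bounded (\<lambda>z. cmod (F' z))"
      by (rule linear_ode_entire[where \<beta> = \<beta> and c = 0 and \<gamma> = 0 and d = "c * b" and \<delta> = b
          and ?f0.0 = "u z0 - \<alpha>" and ?f1.0 = "\<beta> * (u z0 - \<alpha>) + c * exp (b * z0)" and ?z0.0 = z0]) (rule that)
    have hol: "F holomorphic_on UNIV"
      using F(1) by (auto simp: holomorphic_on_open)
    have "\<forall>z\<in>S. F' z - \<beta> * F z - c * exp (b * z) = 0"
    proof (rule linear_ode_zero[OF S_open S_connected z0, of "\<lambda>_. 0"])
      show "((\<lambda>z. F' z - \<beta> * F z - c * exp (b * z)) has_field_derivative
          0 * (F' z - \<beta> * F z - c * exp (b * z))) (at z)" if "z \<in> S" for z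
        by (auto intro!: derivative_eq_intros F(1,2))
    qed (auto simp: F)
    then have F': "F' z = \<beta> * F z + c * exp (b * z)" if "z \<in> S" for z
      using that by (simp add: algebra_simps)
    have "\<forall>z\<in>S. (u z - \<alpha>) - F z = 0"
    proof (rule linear_ode_zero[OF S_open S_connected z0 holomorphic_on_const[of \<beta>]])
      show "((\<lambda>z. u z - \<alpha> - F z) has_field_derivative \<beta> * (u z - \<alpha> - F z)) (at z)" if "z \<in> S" for z
        by (rule DERIV_cong[OF DERIV_diff[OF w'[OF that] F(1)]])
           (simp add: True F'[OF that] algebra_simps)
    qed (simp add: F)
    then have eq: "u z * 1 = F z + \<alpha>" if "z \<in> S" for z
      using that by (simp add: algebra_simps)
    show ?thesis
    proof (rule nevanlinna_growth_entire_quotient[OF nice, of "\<lambda>z. F z + \<alpha>" "\<lambda>z. 1"])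
      show "double_exp_bounded (\<lambda>z. cmod (F z + \<alpha>))"
      proof (rule double_exp_bounded_mono)
        show "double_exp_bounded (\<lambda>z. cmod (F z) + cmod \<alpha>)"
          by (intro double_exp_bounded_mult_add double_exp_bounded_const F)
        show "\<bar>cmod (F z + \<alpha>)\<bar> \<le> cmod (F z) + cmod \<alpha>" for z
          using norm_triangle_ineq[of "F z" \<alpha>] by simp
      qed
    qed (use eq in \<open>auto simp: S_def double_exp_bounded_const intro!: holomorphic_intros hol\<close>)
  qed
qed

text \<open>For \<open>a1 = a2 = a\<close> the substitution \<open>w = - F' / (a F)\<close> gives the inhomogeneous equation
  \<open>F'' = \<beta> F' + d exp (\<gamma> z)\<close>.\<close>

lemma growth_equal_coeffs:
  assumes a: "a2 = a1" "a1 \<noteq> 0"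
  shows growth_bound
proof -
  obtain z0 where z0: "z0 \<in> S" using S_nonempty by blast
  define \<beta> where "\<beta> = a1 * \<alpha> + b1"
  define \<gamma> where "\<gamma> = b2 + a1 * \<alpha>"
  \<comment> \<open>Chosen so that \<open>Z\<close> below vanishes at \<open>z0\<close>, where F =
    1.\<close>
  define d where "d = - a1 * v0 z0 * exp (- \<gamma> * z0)"
  have w': "((\<lambda>z. u z - \<alpha>) has_field_derivative a1 * (u z - \<alpha>)\<^sup>2 + \<beta> * (u z - \<alpha>) + v0 z) (at z)"
    if "z \<in> S" for z
    using w_deriv[OF that] by (simp add: \<beta>_def)
  have v': "(v0 has_field_derivative (a1 * (u z - \<alpha>) + \<gamma>) * v0 z) (at z)" if "z \<in> S" for z
    using v0_deriv[OF that] by (simp add: a \<gamma>_def algebra_simps)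
  obtain F F' where F: "\<And>z. (F has_field_derivative F' z) (at z)"
      "\<And>z. (F' has_field_derivative \<beta> * F' z + 0 * exp (0 * z) * F z + d * exp (\<gamma> * z)) (at z)"
      "F z0 = 1" "F' z0 = - a1 * (u z0 - \<alpha>)"
      "double_exp_bounded (\<lambda>z. cmod (F z))" "double_exp_bounded (\<lambda>z. cmod (F' z))"
    by (rule linear_ode_entire[where \<beta> = \<beta> and c = 0 and \<gamma> = 0 and d = d and \<delta> = \<gamma>
          and ?f0.0 = 1 and ?f1.0 = "- a1 * (u z0 - \<alpha>)" and ?z0.0 = z0]) (rule that)
  have hol: "F holomorphic_on UNIV" "F' holomorphic_on UNIV"
    using F(1,2) by (auto simp: holomorphic_on_open)
  \<comment> \<open>The equation for \<open>X\<close> alone does not close because \<open>v0\<close>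
    is not explicit. \<open>Z\<close> records the deviation of a1 v0 F from -d exp(\<gamma> z), and
    the pair solves a homogeneous linear system.\<close>
  define X where "X = (\<lambda>z. F' z + a1 * (u z - \<alpha>) * F z)"
  define Z where "Z = (\<lambda>z. d * exp (\<gamma> * z) + a1 * v0 z * F z)"
  have "\<forall>z\<in>S. X z = 0 \<and> Z z = 0"
  proof (rule linear_system_zero[where ?g11.0 = "\<lambda>z. \<beta> + a1 * (u z - \<alpha>)" and ?g12.0 = "\<lambda>_. 1"
      and ?g21.0 = "\<lambda>z. a1 * v0 z" and ?g22.0 = "\<lambda>_. \<gamma>", OF S_open S_connected z0])
    show "(\<lambda>z. \<beta> + a1 * (u z - \<alpha>)) holomorphic_on S" "(\<lambda>z. a1 * v0 z) holomorphic_on S"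
      by (intro holomorphic_intros u_holomorphic v0_holomorphic)+
    show "(X has_field_derivative (\<beta> + a1 * (u z - \<alpha>)) * X z + 1 * Z z) (at z)" if "z \<in> S" for z
      unfolding X_def Z_def
      by (rule DERIV_cong[OF DERIV_add[OF F(2) DERIV_mult[OF DERIV_cmult[OF w'[OF that]] F(1)]]])
         (simp add: power2_eq_square algebra_simps)
    have e: "((\<lambda>z. d * exp (\<gamma> * z)) has_field_derivative d * (exp (\<gamma> * z) * \<gamma>)) (at z)" for z
      by (auto intro!: derivative_eq_intros)
    show "(Z has_field_derivative a1 * v0 z * X z + \<gamma> * Z z) (at z)" if "z \<in> S" for z
      unfolding X_def Z_def
      by (rule DERIV_cong[OF DERIV_add[OF e DERIV_mult[OF DERIV_cmult[OF v'[OF that]] F(1)]]])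
         (simp add: power2_eq_square algebra_simps)
    show "X z0 = 0" by (simp add: X_def F)
    show "Z z0 = 0" by (simp add: Z_def F d_def exp_minus)
  qed auto
  then have eq: "u z * (a1 * F z) = \<alpha> * (a1 * F z) - F' z" if "z \<in> S" for z
    using that by (simp add: X_def algebra_simps eq_neg_iff_add_eq_0)
  show ?thesis
  proof (rule nevanlinna_growth_entire_quotient[OF nice, of "\<lambda>z. \<alpha> * (a1 * F z) - F' z" "\<lambda>z. a1 * F z"])
    show "\<exists>z. a1 * F z \<noteq> 0" using F(3) a by (intro exI[of _ z0]) simp
    show "double_exp_bounded (\<lambda>z. cmod (a1 * F z))"
      unfolding norm_mult by (intro double_exp_bounded_mult_add double_exp_bounded_const F)
    show "double_exp_bounded (\<lambda>z. cmod (\<alpha> * (a1 * F z) - F' z))"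
    proof (rule double_exp_bounded_mono)
      show "double_exp_bounded (\<lambda>z. cmod (\<alpha> * a1) * cmod (F z) + cmod (F' z))"
        by (intro double_exp_bounded_mult_add double_exp_bounded_const F)
      show "\<bar>cmod (\<alpha> * (a1 * F z) - F' z)\<bar> \<le> cmod (\<alpha> * a1) * cmod (F z) + cmod (F' z)" for z
        using norm_triangle_ineq4[of "\<alpha> * (a1 * F z)" "F' z"] by (simp add: norm_mult mult.assoc)
    qed
  qed (use eq in \<open>auto simp: S_def intro!: holomorphic_intros hol\<close>)
qed

end

subsection \<open>Laurent coefficients at a double pole\<close>

text \<open>The case k = -1/4. Orders 1 and 2 determine all four coefficients as polynomials in
  \<open>p\<close> and \<open>q\<close>; at order 3 both equations involve \<open>V3\<close> and
  \<open>s3\<close> only through V3 - s3, and eliminating it leaves a relation between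
  \<open>p\<close> and \<open>q\<close>. Resonances 4 and 6 are treated by the same
  elimination.\<close>

lemma obstruction_order_3:
  fixes p q s1 s2 s3 V1 V2 V3 :: complex
  assumes "V1 = - s1 + 2 * p" "V1 = 3 * s1"
    "4 * V2 = s1 ^ 2 - 4 * p * s1 - 4 * q" "2 * V2 = 3 * s2 + s1 * V1"
    "4 * V3 = 4 * s3 + 2 * s1 * s2 - 4 * p * s2" "3 * V3 = 3 * s3 + s1 * V2 + s2 * V1"
  shows "p * (3 * p ^ 2 + 4 * q) = 0"
proof -
  have 1: "2 * s1 = p" "2 * V1 = 3 * p" using assms(1,2) by algebra+
  have 2: "16 * V2 = - 16 * q - 7 * p ^ 2" "24 * s2 = - 16 * q - 13 * p ^ 2"
    using assms(3,4) 1 by algebra+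
  show ?thesis using assms(5,6) 1 2 by algebra
qed

lemma obstruction_order_4:
  fixes p q s1 s2 s3 s4 V1 V2 V3 V4 :: complex
  assumes "V1 = - 2 * s1 + 2 * p" "V1 = 4 * s1"
    "2 * V2 = - 2 * s2 + s1 ^ 2 - 2 * p * s1 - 2 * q" "2 * V2 = 4 * s2 + s1 * V1"
    "2 * V3 = 2 * s1 * s2 - 2 * p * s2" "3 * V3 = 4 * s3 + s1 * V2 + s2 * V1"
    "2 * V4 = 2 * s4 + 2 * s1 * s3 + s2 ^ 2 - 2 * p * s3" "4 * V4 = 4 * s4 + s1 * V3 + s2 * V2 + s3 * V1"
  shows "p * (4 * p ^ 2 + 9 * q) = 0"
proof -
  have 1: "3 * s1 = p" "3 * V1 = 4 * p" using assms(1,2) by algebra+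
  have 2: "6 * s2 = - 2 * q - p ^ 2" "9 * V2 = - 6 * q - p ^ 2"
    using assms(3,4) 1 by algebra+
  have 3: "27 * s3 = 9 * p * q + 4 * p ^ 3" "9 * V3 = 2 * p * q + p ^ 3"
    using assms(5,6) 1 2 by algebra+
  \<comment> \<open>The elimination yields the square of \<open>p\<close>; in a field this carries
    the same information as the first power.\<close>
  have "p ^ 2 * (4 * p ^ 2 + 9 * q) = 0"
    using assms(7,8) 1 2 3 by algebra
  then show ?thesis by simp
qed

lemma obstruction_order_6:
  fixes p q s1 s2 s3 s4 s5 s6 V1 V2 V3 V4 V5 V6 :: complex
  assumes "V1 = - 4 * s1 + 2 * p" "V1 = 6 * s1"
    "V2 = - 3 * s2 + s1 ^ 2 - p * s1 - q" "2 * V2 = 6 * s2 + s1 * V1"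
    "V3 = - 2 * s3 + 2 * s1 * s2 - p * s2" "3 * V3 = 6 * s3 + s1 * V2 + s2 * V1"
    "V4 = - s4 + 2 * s1 * s3 + s2 ^ 2 - p * s3" "4 * V4 = 6 * s4 + s1 * V3 + s2 * V2 + s3 * V1"
    "V5 = 2 * s1 * s4 + 2 * s2 * s3 - p * s4" "5 * V5 = 6 * s5 + s1 * V4 + s2 * V3 + s3 * V2 + s4 * V1"
    "V6 = s6 + 2 * s1 * s5 + 2 * s2 * s4 + s3 ^ 2 - p * s5"
    "6 * V6 = 6 * s6 + s1 * V5 + s2 * V4 + s3 * V3 + s4 * V2 + s5 * V1"
  shows "p * (36 * p ^ 4 - 625 * q ^ 2) = 0"
proof -
  have 1: "5 * s1 = p" "5 * V1 = 6 * p" using assms(1,2) by algebra+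
  have 2: "150 * s2 = - 25 * q - 7 * p ^ 2" "50 * V2 = - 25 * q - p ^ 2"
    using assms(3,4) 1 by algebra+
  have 3: "500 * s3 = 25 * p * q + 6 * p ^ 3" "250 * V3 = p ^ 3"
    using assms(5,6) 1 2 by algebra+
  have 4: "45000 * s4 = 125 * q ^ 2 - 650 * p ^ 2 * q - 163 * p ^ 4" "5000 * V4 = 125 * q ^ 2 - 7 * p ^ 4"
    using assms(7,8) 1 2 3 by algebra+
  have 5: "150000 * s5 = - 1875 * p * q ^ 2 + 625 * p ^ 3 * q + 258 * p ^ 5"
    "75000 * V5 = - 1375 * p * q ^ 2 + 79 * p ^ 5"
    using assms(9,10) 1 2 3 4 by algebra+
  have "p ^ 2 * (36 * p ^ 4 - 625 * q ^ 2) = 0"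
    using assms(11,12) 1 2 3 4 5 by algebra
  then show ?thesis by simp
qed

text \<open>\<open>s\<close> and \<open>V\<close> are the Taylor coefficients of s(t) and V(t) in
  l(z0 + t) = (s(t) - 2)/t and v(z0 + t) = V(t)/t^2 at a double pole z0 of v.
  \<open>log_deriv\<close> is t V' = s V, that is v' = l v, and \<open>riccati\<close> is the
  equation defining v multiplied by t^2.\<close>

locale laurent_coefficients =
  fixes k p q :: complex and s V :: "nat \<Rightarrow> complex"
  assumes s_0: "s 0 = 0"
    and log_deriv: "\<And>n. of_nat n * V n = (\<Sum>i\<le>n. s i * V (n - i))"
    and riccati: "\<And>n. V n = (if n = 0 then 2 - 4 * k else 0) + (4 * k - 1 + of_nat n) * s n
        - k * (\<Sum>i\<le>n. s i * s (n - i)) + (if n = 1 then 2 * p else 0)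
        - (if n \<ge> 1 then p * s (n - 1) else 0) - (if n = 2 then q else 0)"
begin

lemma V_0: "V 0 = 2 - 4 * k"
  using riccati[of 0] by (simp add: s_0)

text \<open>The listed values of k are those with 2 - 4k = 2 - 4k equal to 1, 2, 3, 4 and 6 in the
  order k = 1/4, 0, -1/4, -1/2, -1. At the order 2 - 4k the two linear equations for the new
  coefficients become dependent, so a solution exists only under the stated relation.\<close>

lemma integrability:
  shows "k = 1 / 4 \<Longrightarrow> p = 0" "k = 0 \<Longrightarrow> q = - 2 * p ^ 2"
    "k = - 1 / 4 \<Longrightarrow> p * (3 * p ^ 2 + 4 * q) = 0" "k = - 1 / 2 \<Longrightarrow> p * (4 * p ^ 2 + 9 * q) = 0"
    "k = - 1 \<Longrightarrow> p * (36 * p ^ 4 - 625 * q ^ 2) = 0"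
proof -
  have S: "(\<Sum>i\<le>1. f i) = f 0 + f 1" "(\<Sum>i\<le>2. f i) = f 0 + f 1 + f 2"
    "(\<Sum>i\<le>3. f i) = f 0 + f 1 + f 2 + f 3" "(\<Sum>i\<le>4. f i) = f 0 + f 1 + f 2 + f 3 + f 4"
    "(\<Sum>i\<le>5. f i) = f 0 + f 1 + f 2 + f 3 + f 4 + f 5"
    "(\<Sum>i\<le>6. f i) = f 0 + f 1 + f 2 + f 3 + f 4 + f 5 + f 6" for f :: "nat \<Rightarrow> complex"
    by (simp_all add: eval_nat_numeral)
  define s1 s2 s3 s4 s5 s6 where "s1 = s 1" and "s2 = s 2" and "s3 = s 3" and "s4 = s 4" and "s5 = s 5" and "s6 = s 6"
  define V1 V2 V3 V4 V5 V6 where "V1 = V 1" and "V2 = V 2" and "V3 = V 3" and "V4 = V 4" and "V5 = V 5" and "V6 = V 6"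
  note defs = s1_def s2_def s3_def s4_def s5_def s6_def V1_def V2_def V3_def V4_def V5_def V6_def
  have A: "V1 = s1 * (2 - 4 * k)" "V1 = 4 * k * s1 + 2 * p"
    using log_deriv[of 1] riccati[of 1] unfolding S by (simp_all add: s_0 V_0 defs algebra_simps)
  have A2: "2 * V2 = s2 * (2 - 4 * k) + s1 * V1"
    using log_deriv[of 2] unfolding S by (simp add: s_0 V_0 defs)
  have B2: "V2 = (4 * k + 1) * s2 - k * s1 ^ 2 - p * s1 - q"
    using riccati[of 2] unfolding S by (simp add: s_0 V_0 defs power2_eq_square algebra_simps)
  have A3: "3 * V3 = s3 * (2 - 4 * k) + s1 * V2 + s2 * V1"
    using log_deriv[of 3] unfolding S by (simp add: s_0 V_0 defs)
  have B3: "V3 = (4 * k + 2) * s3 - k * (2 * s1 * s2) - p * s2"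
    using riccati[of 3] unfolding S by (simp add: s_0 V_0 defs power2_eq_square algebra_simps)
  have A4: "4 * V4 = s4 * (2 - 4 * k) + s1 * V3 + s2 * V2 + s3 * V1"
    using log_deriv[of 4] unfolding S by (simp add: s_0 V_0 defs)
  have B4: "V4 = (4 * k + 3) * s4 - k * (2 * s1 * s3 + s2 ^ 2) - p * s3"
    using riccati[of 4] unfolding S by (simp add: s_0 V_0 defs power2_eq_square algebra_simps)
  have A5: "5 * V5 = s5 * (2 - 4 * k) + s1 * V4 + s2 * V3 + s3 * V2 + s4 * V1"
    using log_deriv[of 5] unfolding S by (simp add: s_0 V_0 defs)
  have B5: "V5 = (4 * k + 4) * s5 - k * (2 * s1 * s4 + 2 * s2 * s3) - p * s4"
    using riccati[of 5] unfolding S by (simp add: s_0 V_0 defs power2_eq_square algebra_simps)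
  have A6: "6 * V6 = s6 * (2 - 4 * k) + s1 * V5 + s2 * V4 + s3 * V3 + s4 * V2 + s5 * V1"
    using log_deriv[of 6] unfolding S by (simp add: s_0 V_0 defs)
  have B6: "V6 = (4 * k + 5) * s6 - k * (2 * s1 * s5 + 2 * s2 * s4 + s3 ^ 2) - p * s5"
    using riccati[of 6] unfolding S by (simp add: s_0 V_0 defs power2_eq_square algebra_simps)
  note A = A A2 B2 A3 B3 A4 B4 A5 B5 A6 B6
  show "p = 0" if "k = 1 / 4" using A(1,2) that by simp
  show "q = - 2 * p ^ 2" if "k = 0"
  proof -
    have "V1 = s1 * 2" "V1 = 2 * p" "2 * V2 = s2 * 2 + s1 * V1" "V2 = s2 - p * s1 - q"
      using A(1-4) that by simp_all
    then show ?thesis by algebra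
  qed
  show "p * (3 * p ^ 2 + 4 * q) = 0" if "k = - 1 / 4"
  proof -
    have K: "4 * k = - 1" using that by simp
    show ?thesis
      by (rule obstruction_order_3[of V1 s1 p V2 q s2 V3 s3])
        ((use A(2) K in algebra),
         (use A(1) K in algebra),
         (use A(4) K in algebra),
         (use A(3) K in algebra),
         (use A(6) K in algebra),
         (use A(5) K in algebra))
  qed
  show "p * (4 * p ^ 2 + 9 * q) = 0" if "k = - 1 / 2"
  proof -
    have K: "2 * k = - 1" using that by simp
    show ?thesis
      by (rule obstruction_order_4[of V1 s1 p V2 s2 q V3 s3 V4 s4])
        ((use A(2) K in algebra),
         (use A(1) K in algebra),
         (use A(4) K in algebra),
         (use A(3) K in algebra),
         (use A(6) K in algebra),
         (use A(5) K in algebra),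
         (use A(8) K in algebra),
         (use A(7) K in algebra))
  qed
  show "p * (36 * p ^ 4 - 625 * q ^ 2) = 0" if "k = - 1"
  proof -
    have K: "k = - 1" using that by simp
    show ?thesis
      by (rule obstruction_order_6[of V1 s1 p V2 s2 q V3 s3 V4 s4 V5 s5 V6 s6])
        ((use A(2) K in algebra),
         (use A(1) K in algebra),
         (use A(4) K in algebra),
         (use A(3) K in algebra),
         (use A(6) K in algebra),
         (use A(5) K in algebra),
         (use A(8) K in algebra),
         (use A(7) K in algebra),
         (use A(10) K in algebra),
         (use A(9) K in algebra),
         (use A(12) K in algebra),
         (use A(11) K in algebra))
  qed
qed

text \<open>If two solutions agree below order n, subtracting their equations gives (n + 1)(n - (2 -
  4k))(s n - s' n) = 0, so the only possible obstruction to uniqueness is at n = 2 - 4k.\<close>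

lemma determined:
  assumes other: "laurent_coefficients k p q s' V'"
    and nonres: "\<And>n. n \<ge> 1 \<Longrightarrow> 2 - 4 * k \<noteq> of_nat n"
  shows "s n = s' n \<and> V n = V' n"
proof (induction n rule: less_induct)
  case (less n)
  interpret o: laurent_coefficients k p q s' V' by fact
  show ?case
  proof (cases "n = 0")
    case True
    then show ?thesis by (simp add: s_0 o.s_0 V_0 o.V_0)
  next
    case False
    then have split: "{..n} = insert 0 (insert n {0<..<n})" by auto
    have sumV: "(\<Sum>i\<le>n. f i * g (n - i)) = f 0 * g n + f n * g 0 + (\<Sum>i\<in>{0<..<n}. f i * g (n - i))"
      for f g :: "nat \<Rightarrow> complex"
      unfolding split using False by simp
    have e1: "(\<Sum>i\<in>{0<..<n}. s i * V (n - i)) = (\<Sum>i\<in>{0<..<n}. s' i * V' (n - i))"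
      and e2: "(\<Sum>i\<in>{0<..<n}. s i * s (n - i)) = (\<Sum>i\<in>{0<..<n}. s' i * s' (n - i))"
      using less by (auto intro!: sum.cong)
    have e3: "s (n - 1) = s' (n - 1)" using less[of "n - 1"] False by simp
    have d1: "of_nat n * (V n - V' n) = (2 - 4 * k) * (s n - s' n)"
      using log_deriv[of n] o.log_deriv[of n] unfolding sumV e1
      by (simp add: s_0 o.s_0 V_0 o.V_0 algebra_simps)
    define R where "R = - k * (\<Sum>i\<in>{0<..<n}. s' i * s' (n - i)) + (if n = 1 then 2 * p else 0)
        - (if n \<ge> 1 then p * s' (n - 1) else 0) - (if n = 2 then q else 0)"
    have "V n = (4 * k - 1 + of_nat n) * s n + R" "V' n = (4 * k - 1 + of_nat n) * s' n + R"
      using False unfolding riccati[of n] o.riccati[of n] sumV e2 e3 R_def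
      by (simp_all only: s_0 o.s_0 algebra_simps) simp_all
    then have d2: "V n - V' n = (4 * k - 1 + of_nat n) * (s n - s' n)"
      by algebra
    have "(of_nat n + 1) * (of_nat n - (2 - 4 * k)) * (s n - s' n) = 0"
      using d1 d2 by algebra
    moreover have "of_nat n + 1 \<noteq> (0::complex)"
      by (metis of_nat_1 of_nat_add of_nat_eq_0_iff add_is_0 one_neq_zero)
    moreover have "of_nat n - (2 - 4 * k) \<noteq> 0"
      using nonres[of n] False by auto
    ultimately have "s n = s' n" by simp
    then show ?thesis using d2 by simp
  qed
qed

end

subsection \<open>Local structure of the poles\<close>

text \<open>At a pole of \<open>l\<close> the function \<open>v\<close> has either a double pole or
  a zero, so the prescribed value 0 is the dummy value in the first case and the true value in the
  second. The condition on \<open>k\<close> excludes simple poles of \<open>v\<close>.\<close>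

locale log_deriv_ode =
  fixes k p q :: complex and l v :: "complex \<Rightarrow> complex"
  assumes l_nice: "l nicely_meromorphic_on UNIV"
    and v_eq: "\<And>z. \<not> is_pole l z \<Longrightarrow> v z = deriv l z - k * (l z)\<^sup>2 - p * l z - q"
    and v_pole: "\<And>z. is_pole l z \<Longrightarrow> v z = 0"
    and v_deriv: "\<And>z. \<not> is_pole l z \<Longrightarrow> (v has_field_derivative l z * v z) (at z)"
    and v_nz: "\<And>z. \<not> is_pole l z \<Longrightarrow> v z \<noteq> 0"
    and k_ne_1: "k \<noteq> 1"
begin

lemma l_mero: "l meromorphic_on UNIV"
  using l_nice by (simp add: nicely_meromorphic_on_def)

lemma l_isolated: "isolated_singularity_at l z"
  by (rule meromorphic_on_isolated_singularity) (rule meromorphic_on_subset[OF l_mero], simp)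

lemma ev_not_pole: "eventually (\<lambda>w. \<not> is_pole l w) (at z)"
proof -
  obtain r where r: "r > 0" "l analytic_on ball z r - {z}"
    using l_isolated[of z] unfolding isolated_singularity_at_def by blast
  have "eventually (\<lambda>w. w \<in> ball z r - {z}) (at z)"
    using r(1) by (intro eventually_at_in_open) auto
  then show ?thesis
  proof eventually_elim
    case (elim w)
    then have "l analytic_on {w}" using analytic_on_subset[OF r(2), of "{w}"] by simp
    then show ?case by (rule analytic_at_imp_no_pole)
  qed
qed

lemma l_analytic: "\<not> is_pole l z \<Longrightarrow> l analytic_on {z}"
  using nicely_meromorphic_on_imp_analytic_at[OF l_nice] by simp

lemma not_pole_open: "open {z. \<not> is_pole l z}" and not_pole_connected: "connected {z. \<not> is_pole l z}"
proof -
  have sp: "{z. is_pole l z} sparse_in UNIV"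
    using meromorphic_on_imp_not_pole_cosparse[OF l_mero] by (simp add: eventually_cosparse)
  have S: "{z. \<not> is_pole l z} = UNIV - {z. is_pole l z}" by auto
  show "open {z. \<not> is_pole l z}" unfolding S by (rule open_diff_sparse_pts[OF open_UNIV sp])
  show "connected {z. \<not> is_pole l z}"
    unfolding S by (rule sparse_imp_connected[OF _ connected_UNIV open_UNIV sp]) simp
qed

lemma l_deriv:
  assumes "\<not> is_pole l z"
  shows "(l has_field_derivative v z + k * (l z)\<^sup>2 + p * l z + q) (at z)"
proof -
  have "l field_differentiable at z"
    using l_analytic[OF assms] by (simp add: analytic_on_imp_differentiable_at)
  then have "(l has_field_derivative deriv l z) (at z)"
    by (simp add: field_differentiable_derivI)
  then show ?thesis using v_eq[OF assms] by simp
qed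

lemma v_analytic: "\<not> is_pole l z \<Longrightarrow> v analytic_on {z}"
proof -
  assume z: "\<not> is_pole l z"
  have "v holomorphic_on {z. \<not> is_pole l z}"
    using v_deriv not_pole_open by (auto simp: holomorphic_on_open)
  then show ?thesis using z not_pole_open by (meson analytic_at mem_Collect_eq)
qed

lemma v_mero: "v meromorphic_on UNIV"
proof -
  have "(\<lambda>z. deriv l z - k * (l z)\<^sup>2 - p * l z - q) meromorphic_on UNIV"
    by (intro meromorphic_intros l_mero)
  moreover have "v meromorphic_on UNIV \<longleftrightarrow> (\<lambda>z. deriv l z - k * (l z)\<^sup>2 - p * l z - q) meromorphic_on UNIV"
    by (intro meromorphic_on_cong refl eventually_mono[OF ev_not_pole]) (simp add: v_eq)
  ultimately show ?thesis by simp
qed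

lemma v_isolated: "isolated_singularity_at v z"
  by (rule meromorphic_on_isolated_singularity) (rule meromorphic_on_subset[OF v_mero], simp)

text \<open>Near a pole of \<open>l\<close> the order \<open>n\<close> of \<open>v\<close> satisfies \<open>n = - 2\<close> or \<open>n > 0\<close>: balancing the
  leading terms excludes every other order.\<close>

lemma pole_of_l_local:
  assumes pole: "is_pole l z0"
  obtains n r s W y where "r > 0" "s holomorphic_on ball 0 r" "W holomorphic_on ball 0 r" "y holomorphic_on ball 0 r"
    "y 0 \<noteq> 0" "n = - 2 \<or> n > (0::int)" "s 0 = of_int n + 2"
    "\<And>t. t \<in> ball 0 r - {0} \<Longrightarrow> \<not> is_pole l (z0 + t) \<and> v (z0 + t) = y t * t powi n \<and>
        v (z0 + t) = W t / t\<^sup>2 \<and> l (z0 + t) = (s t - 2) / t"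
    "\<And>t. t \<in> ball 0 r \<Longrightarrow> W t = (2 - 4 * k) + (4 * k - 1) * s t + t * deriv s t - k * (s t)\<^sup>2
        + 2 * p * t - p * t * s t - q * t\<^sup>2"
    "\<And>t. t \<in> ball 0 r \<Longrightarrow> n = - 2 \<Longrightarrow> t * deriv W t = s t * W t"
proof -
  have ness: "not_essential v z0"
    by (rule meromorphic_on_not_essential) (rule meromorphic_on_subset[OF v_mero], simp)
  have freq: "\<exists>\<^sub>F w in at z0. v w \<noteq> 0"
    using ev_not_pole[of z0] v_nz by (intro eventually_frequently) (auto elim: eventually_mono)
  define n where "n = zorder v z0"
  obtain r1 where r1: "r1 > 0" "zor_poly v z0 z0 \<noteq> 0" "zor_poly v z0 holomorphic_on cball z0 r1"
    "\<And>w. w \<in> cball z0 r1 - {z0} \<Longrightarrow> v w = zor_poly v z0 w * (w - z0) powi n \<and> zor_poly v z0 w \<noteq> 0"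
    using zorder_exist[OF v_isolated ness freq] unfolding n_def by blast
  obtain r2 where r2: "r2 > 0" "\<And>w. dist w z0 < r2 \<Longrightarrow> w \<noteq> z0 \<Longrightarrow> \<not> is_pole l w"
    using ev_not_pole[of z0] unfolding eventually_at by (auto simp: dist_commute)
  define r where "r = min r1 r2"
  have r: "r > 0" using r1 r2 by (simp add: r_def)
  define y where "y = (\<lambda>t. zor_poly v z0 (z0 + t))"
  have yhol: "y holomorphic_on ball 0 r"
    unfolding y_def
    by (rule holomorphic_on_compose_gen[OF _ r1(3), unfolded o_def])
       (auto intro!: holomorphic_intros simp: r_def dist_norm)
  have ynz: "y t \<noteq> 0" and np: "t \<noteq> 0 \<Longrightarrow> \<not> is_pole l (z0 + t)"
    and vy: "t \<noteq> 0 \<Longrightarrow> v (z0 + t) = y t * t powi n" if "t \<in> ball 0 r" for t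
    using r1(2) r1(4)[of "z0 + t"] r2(2)[of "z0 + t"] that
    by (cases "t = 0"; auto simp: y_def r_def dist_norm)+
  \<comment> \<open>From v = y t^n one gets t l = t v'/v = n + t y'/y; the shift by 2 makes
    \<open>s\<close> vanish at 0 exactly when the pole of \<open>v\<close> is double.\<close>
  define s where "s = (\<lambda>t. of_int n + 2 + t * (deriv y t / y t))"
  have shol: "s holomorphic_on ball 0 r"
    unfolding s_def using ynz by (intro holomorphic_intros yhol) auto
  define W where "W = (\<lambda>t. (2 - 4 * k) + (4 * k - 1) * s t + t * deriv s t - k * (s t)\<^sup>2
        + 2 * p * t - p * t * s t - q * t\<^sup>2)"
  have Whol: "W holomorphic_on ball 0 r"
    unfolding W_def by (intro holomorphic_intros shol) auto
  have yd: "(y has_field_derivative deriv y t) (at t)" and sd: "(s has_field_derivative deriv s t) (at t)"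
    if "t \<in> ball 0 r" for t
    using that by (auto intro!: holomorphic_derivI[OF yhol] holomorphic_derivI[OF shol])
  have shift: "((\<lambda>t. f (z0 + t)) has_field_derivative D) (at t)" if "(f has_field_derivative D) (at (z0 + t))" for f D t
  proof -
    have "((\<lambda>t. z0 + t) has_field_derivative 1) (at t)" by (auto intro!: derivative_eq_intros)
    from DERIV_chain'[OF this that] show ?thesis by simp
  qed
  have lt: "l (z0 + t) = (s t - 2) / t" if t: "t \<in> ball 0 r" "t \<noteq> 0" for t
  proof -
    have open': "open (ball 0 r - {0::complex})" by auto
    have "((\<lambda>t. v (z0 + t)) has_field_derivative l (z0 + t) * v (z0 + t)) (at t)"
      by (rule shift[OF v_deriv[OF np[OF t]]])
    then have 1: "((\<lambda>t. y t * t powi n) has_field_derivative l (z0 + t) * v (z0 + t)) (at t)"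
      by (rule has_field_derivative_transform_within_open[OF _ open']) (use t vy in auto)
    have 2: "((\<lambda>t. y t * t powi n) has_field_derivative y t * (of_int n * t powi (n - 1)) + deriv y t * t powi n) (at t)"
      using t by (auto intro!: derivative_eq_intros yd)
    have "l (z0 + t) * (y t * t powi n) = y t * (of_int n * t powi (n - 1)) + deriv y t * t powi n"
      using DERIV_unique[OF 1 2] vy[OF t] by simp
    moreover have "t powi n = t powi (n - 1) * t"
      using t by (simp add: power_int_minus_mult)
    ultimately have "t powi (n - 1) * (l (z0 + t) * (y t * t) - (y t * of_int n + deriv y t * t)) = 0"
      by (simp add: algebra_simps)
    then have "l (z0 + t) * (y t * t) = y t * of_int n + deriv y t * t"
      using t by simp
    then show ?thesis
      using t ynz[OF t(1)] by (simp add: s_def field_simps)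
  qed
  have vW: "v (z0 + t) = W t / t\<^sup>2" if t: "t \<in> ball 0 r" "t \<noteq> 0" for t
  proof -
    have open': "open (ball 0 r - {0::complex})" by auto
    have "((\<lambda>t. l (z0 + t)) has_field_derivative v (z0 + t) + k * (l (z0 + t))\<^sup>2 + p * l (z0 + t) + q) (at t)"
      by (rule shift[OF l_deriv[OF np[OF t]]])
    then have 1: "((\<lambda>t. (s t - 2) / t) has_field_derivative v (z0 + t) + k * (l (z0 + t))\<^sup>2 + p * l (z0 + t) + q) (at t)"
      by (rule has_field_derivative_transform_within_open[OF _ open']) (use t lt in auto)
    have 2: "((\<lambda>t. (s t - 2) / t) has_field_derivative (deriv s t * t - (s t - 2)) / (t * t)) (at t)"
      using t by (auto intro!: derivative_eq_intros sd)
    have e: "v (z0 + t) = (deriv s t * t - (s t - 2)) / (t * t) - k * ((s t - 2) / t)\<^sup>2 - p * ((s t - 2) / t) - q"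
      using DERIV_unique[OF 1 2] lt[OF t] by (simp add: algebra_simps)
    show ?thesis
      unfolding e W_def using t by (simp add: field_simps power2_eq_square)
  qed
  have Wy: "W t = y t * t powi (n + 2)" if t: "t \<in> ball 0 r" "t \<noteq> 0" for t
    using vW[OF t] vy[OF t] t by (simp add: field_simps power_int_add)
  have lim: "f \<midarrow>0\<rightarrow> f 0" if "f holomorphic_on ball 0 r" for f :: "complex \<Rightarrow> complex"
    using continuous_on_interior[OF holomorphic_on_imp_continuous_on[OF that], of 0] r by (simp add: isCont_def)
  have ev0: "eventually (\<lambda>t. t \<in> ball 0 r - {0}) (at (0::complex))"
    using r by (intro eventually_at_in_open) auto
  \<comment> \<open>\<open>W\<close> is t^2 v computed from \<open>l\<close>, while t^2 v = y t^(n +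
    2). For n = -1 the latter tends to 0 although W(0) = 1 - k; for n <= -3 it is unbounded although
    \<open>W\<close> is continuous; for n = 0 already l = v'/v would be bounded at its own
    pole.\<close>
  have W0: "W 0 = - of_int n - k * (of_int n)\<^sup>2"
    by (simp add: W_def s_def power2_eq_square algebra_simps)
  have n0: "n \<noteq> 0"
  proof
    assume n: "n = 0"
    have "l \<midarrow>z0\<rightarrow> deriv y 0 / y 0"
    proof -
      have "(\<lambda>t. deriv y t / y t) holomorphic_on ball 0 r"
        using ynz by (intro holomorphic_intros yhol) auto
      then have 1: "(\<lambda>t. deriv y t / y t) \<midarrow>0\<rightarrow> deriv y 0 / y 0" by (rule lim)
      have 2: "eventually (\<lambda>t. l (z0 + t) = deriv y t / y t) (at 0)"
        using ev0 by eventually_elim (use lt n in \<open>auto simp: s_def\<close>)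
      have "(\<lambda>t. l (z0 + t)) \<midarrow>0\<rightarrow> deriv y 0 / y 0"
        by (rule tendsto_cong[OF 2, THEN iffD2, OF 1])
      then show ?thesis by (simp add: LIM_offset_zero_iff)
    qed
    from not_tendsto_and_filterlim_at_infinity[OF at_neq_bot this] pole
    show False by (simp add: is_pole_def)
  qed
  have n1: "n \<noteq> - 1"
  proof
    assume n: "n = - 1"
    have 1: "eventually (\<lambda>t. W t = y t * t) (at 0)"
      using ev0 by eventually_elim (use Wy n in auto)
    have 2: "(\<lambda>t. y t * t) \<midarrow>0\<rightarrow> y 0 * 0"
      by (intro tendsto_intros lim yhol)
    have "W \<midarrow>0\<rightarrow> y 0 * 0" by (rule tendsto_cong[OF 1, THEN iffD2, OF 2])
    then have "W \<midarrow>0\<rightarrow> 0" by simp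
    then have "W 0 = 0" using lim[OF Whol] LIM_unique by blast
    then show False using k_ne_1 n by (simp add: W0)
  qed
  have n3: "\<not> n \<le> - 3"
  proof
    assume n: "n \<le> - 3"
    define m where "m = nat (- (n + 2))"
    have m: "m > 0" "n + 2 = - int m" using n by (auto simp: m_def)
    have 1: "eventually (\<lambda>t. y t = W t * t ^ m) (at 0)"
      using ev0 by eventually_elim (use Wy m in \<open>auto simp: power_int_minus field_simps\<close>)
    have 2: "(\<lambda>t. W t * t ^ m) \<midarrow>0\<rightarrow> W 0 * 0 ^ m"
      by (intro tendsto_intros lim Whol)
    have "y \<midarrow>0\<rightarrow> W 0 * 0 ^ m" by (rule tendsto_cong[OF 1, THEN iffD2, OF 2])
    then have "y \<midarrow>0\<rightarrow> 0" using m by (simp add: power_0_left)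
    then have "y 0 = 0" using lim[OF yhol] LIM_unique by blast
    then show False using ynz[of 0] r by simp
  qed
  show ?thesis
  proof (rule that[OF r shol Whol yhol _ _ _ _ _ _, of n])
    show "y 0 \<noteq> 0" using ynz r by simp
    show "n = - 2 \<or> n > 0" using n0 n1 n3 by linarith
    show "s 0 = of_int n + 2" by (simp add: s_def)
    show "t * deriv W t = s t * W t" if t: "t \<in> ball 0 r" and n: "n = - 2" for t
    proof (cases "t = 0")
      case True
      then show ?thesis using n by (simp add: s_def)
    next
      case False
      have open': "open (ball 0 r - {0::complex})" by auto
      have eq: "W x = y x" if "x \<in> ball 0 r - {0}" for x using Wy[of x] that n by simp
      have "(W has_field_derivative deriv y t) (at t)"
        by (rule has_field_derivative_transform_within_open[OF yd[OF t] open']) (use t False eq in auto)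
      then have "deriv W t = deriv y t" by (rule DERIV_imp_deriv)
      then show ?thesis using eq[of t] t False ynz[OF t] n by (simp add: s_def)
    qed
  qed (use np vy vW lt in \<open>auto simp: W_def\<close>)
qed

lemma pole_of_v_imp_pole_of_l: "is_pole v z \<Longrightarrow> is_pole l z"
  using v_analytic analytic_at_imp_no_pole by blast

lemma pole_local:
  assumes pole: "is_pole v z0"
  obtains r s W where "r > 0" "s holomorphic_on ball 0 r" "W holomorphic_on ball 0 r" "s 0 = 0" "W 0 \<noteq> 0"
    "\<And>t. t \<in> ball 0 r - {0} \<Longrightarrow> \<not> is_pole l (z0 + t) \<and> v (z0 + t) = W t / t\<^sup>2 \<and> l (z0 + t) = (s t - 2) / t"
    "\<And>t. t \<in> ball 0 r \<Longrightarrow> W t = (2 - 4 * k) + (4 * k - 1) * s t + t * deriv s t - k * (s t)\<^sup>2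
        + 2 * p * t - p * t * s t - q * t\<^sup>2"
    "\<And>t. t \<in> ball 0 r \<Longrightarrow> t * deriv W t = s t * W t"
proof -
  obtain n r s W y where L: "r > 0" "s holomorphic_on ball 0 r" "W holomorphic_on ball 0 r" "y holomorphic_on ball 0 r"
    "y 0 \<noteq> 0" "n = - 2 \<or> n > (0::int)" "s 0 = of_int n + 2"
    "\<And>t. t \<in> ball 0 r - {0} \<Longrightarrow> \<not> is_pole l (z0 + t) \<and> v (z0 + t) = y t * t powi n \<and>
        v (z0 + t) = W t / t\<^sup>2 \<and> l (z0 + t) = (s t - 2) / t"
    "\<And>t. t \<in> ball 0 r \<Longrightarrow> W t = (2 - 4 * k) + (4 * k - 1) * s t + t * deriv s t - k * (s t)\<^sup>2
        + 2 * p * t - p * t * s t - q * t\<^sup>2"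
    "\<And>t. t \<in> ball 0 r \<Longrightarrow> n = - 2 \<Longrightarrow> t * deriv W t = s t * W t"
    using pole_of_l_local[OF pole_of_v_imp_pole_of_l[OF pole]] by metis
  have lim: "f \<midarrow>0\<rightarrow> f 0" if "f holomorphic_on ball 0 r" for f :: "complex \<Rightarrow> complex"
    using continuous_on_interior[OF holomorphic_on_imp_continuous_on[OF that], of 0] L(1) by (simp add: isCont_def)
  have ev0: "eventually (\<lambda>t. t \<in> ball 0 r - {0}) (at (0::complex))"
    using L(1) by (intro eventually_at_in_open) auto
  have n: "n = - 2"
  proof (rule ccontr)
    assume "n \<noteq> - 2"
    then have n: "n = int (nat n)" using L(6) by simp
    have 1: "(\<lambda>t. y t * t ^ nat n) \<midarrow>0\<rightarrow> y 0 * 0 ^ nat n"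
      by (intro tendsto_intros lim L)
    have 2: "eventually (\<lambda>t. v (z0 + t) = y t * t ^ nat n) (at 0)"
      using ev0
    proof eventually_elim
      case (elim t)
      then have "v (z0 + t) = y t * t powi int (nat n)" using L(8) n by metis
      then show ?case by (simp only: power_int_of_nat)
    qed
    have "(\<lambda>t. v (z0 + t)) \<midarrow>0\<rightarrow> y 0 * 0 ^ nat n"
      by (rule tendsto_cong[OF 2, THEN iffD2, OF 1])
    then have "v \<midarrow>z0\<rightarrow> y 0 * 0 ^ nat n" by (simp add: LIM_offset_zero_iff)
    from not_tendsto_and_filterlim_at_infinity[OF at_neq_bot this] pole
    show False by (simp add: is_pole_def)
  qed
  have "W 0 = y 0"
  proof -
    have 1: "eventually (\<lambda>t. W t = y t) (at 0)"
      using ev0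
    proof eventually_elim
      case (elim t)
      then have "y t * t powi (- 2) = W t / t\<^sup>2" using L(8)[of t] n by metis
      then show ?case using elim by (simp add: power_int_minus field_simps)
    qed
    have "W \<midarrow>0\<rightarrow> y 0" by (rule tendsto_cong[OF 1, THEN iffD2, OF lim[OF L(4)]])
    then show ?thesis using lim[OF L(3)] LIM_unique by blast
  qed
  show ?thesis
  proof (rule that[OF L(1-3)])
    show "s 0 = 0" using L(7) n by simp
    show "W 0 \<noteq> 0" using L(5) \<open>W 0 = y 0\<close> by simp
    show "\<not> is_pole l (z0 + t) \<and> v (z0 + t) = W t / t\<^sup>2 \<and> l (z0 + t) = (s t - 2) / t"
      if "t \<in> ball 0 r - {0}" for t using L(8)[OF that] by blast
  qed (use L(9,10) n in blast)+
qed

text \<open>At a pole of \<open>l\<close> that is not a pole of \<open>v\<close> the order of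
  \<open>v\<close> is positive, so the prescribed value 0 is also the limit.\<close>

lemma v_nice: "v nicely_meromorphic_on UNIV"
proof (rule nicely_meromorphic_onI_open[of UNIV v "{z. is_pole v z}"])
  show "v analytic_on UNIV - {z. is_pole v z}"
  proof (subst analytic_on_analytic_at, rule ballI)
    fix z0 assume "z0 \<in> UNIV - {z. is_pole v z}"
    then have nv: "\<not> is_pole v z0" by simp
    show "v analytic_on {z0}"
    proof (cases "is_pole l z0")
      case True
      obtain n r s W y where L: "r > 0" "y holomorphic_on ball 0 r" "y 0 \<noteq> 0" "n = - 2 \<or> n > (0::int)"
        "\<And>t. t \<in> ball 0 r - {0} \<Longrightarrow> v (z0 + t) = y t * t powi n"
        using pole_of_l_local[OF True] by metis
      have y0: "y \<midarrow>0\<rightarrow> y 0"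
        using continuous_on_interior[OF holomorphic_on_imp_continuous_on[OF L(2)], of 0] L(1) by (simp add: isCont_def)
      have ev0: "eventually (\<lambda>t. t \<in> ball 0 r - {0}) (at (0::complex))"
        using L(1) by (intro eventually_at_in_open) auto
      have "n \<noteq> - 2"
      proof
        assume n: "n = - 2"
        have "is_pole (\<lambda>t. y t / t ^ 2) 0"
          by (rule is_pole_basic'[of _ "ball 0 r"]) (use L in auto)
        moreover have ev: "eventually (\<lambda>t. y t / t ^ 2 = v (z0 + t)) (at 0)"
          using ev0 by eventually_elim (use L(5) n in \<open>auto simp: power_int_minus field_simps\<close>)
        ultimately have "is_pole (\<lambda>t. v (z0 + t)) 0"
          using is_pole_cong[OF ev refl] by blast
        then have "is_pole v z0" using is_pole_shift_0[of v z0] by simp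
        then show False using nv by simp
      qed
      then have n: "n = int (nat n)" "nat n > 0" using L(4) by auto
      have 1: "(\<lambda>t. y t * t ^ nat n) \<midarrow>0\<rightarrow> y 0 * 0 ^ nat n"
        by (intro tendsto_intros y0)
      have 2: "eventually (\<lambda>t. v (z0 + t) = y t * t ^ nat n) (at 0)"
        using ev0
      proof eventually_elim
        case (elim t)
        then have "v (z0 + t) = y t * t powi int (nat n)" using L(5) n by metis
        then show ?case by (simp only: power_int_of_nat)
      qed
      have "(\<lambda>t. v (z0 + t)) \<midarrow>0\<rightarrow> y 0 * 0 ^ nat n"
        by (rule tendsto_cong[OF 2, THEN iffD2, OF 1])
      then have "v \<midarrow>z0\<rightarrow> v z0" using n v_pole[OF True] by (simp add: LIM_offset_zero_iff power_0_left)
      then have "isCont v z0" by (simp add: isCont_def)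
      then show ?thesis
        by (intro meromorphic_at_isCont_imp_analytic meromorphic_on_subset[OF v_mero]) auto
    qed (rule v_analytic)
  qed
  show "is_pole v x \<and> v x = 0" if "x \<in> {z. is_pole v z}" for x
    using that pole_of_v_imp_pole_of_l v_pole by auto
qed (use v_isolated in auto)

lemma pole_coefficients:
  assumes r: "r > 0" and s: "s holomorphic_on ball 0 r" and W: "W holomorphic_on ball 0 r" and s0: "s 0 = 0"
    and ric: "\<And>t. t \<in> ball 0 r \<Longrightarrow> W t = (2 - 4 * k) + (4 * k - 1) * s t + t * deriv s t - k * (s t)\<^sup>2
        + 2 * p * t - p * t * s t - q * t\<^sup>2"
    and ld: "\<And>t. t \<in> ball 0 r \<Longrightarrow> t * deriv W t = s t * W t"
  shows "laurent_coefficients k p q (fps_nth (fps_expansion s 0)) (fps_nth (fps_expansion W 0))"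
proof -
  define A where "A = fps_expansion s 0"
  define B where "B = fps_expansion W 0"
  have A: "s has_fps_expansion A" and B: "W has_fps_expansion B"
    unfolding A_def B_def using r s W by (auto intro!: has_fps_expansion_fps_expansion[of "ball 0 r"])
  have ev: "eventually (\<lambda>t. t \<in> ball 0 r) (nhds (0::complex))"
    using r by (intro eventually_nhds_in_open) auto
  have cong: "F = G" if "f has_fps_expansion F" "g has_fps_expansion G" "\<And>t. t \<in> ball 0 r \<Longrightarrow> f t = g t"
    for f g :: "complex \<Rightarrow> complex" and F G
  proof -
    have "eventually (\<lambda>t. eval_fps F t = g t) (nhds 0)"
      using that(1) ev unfolding has_fps_expansion_def by (auto elim: eventually_elim2 simp: that(3))
    then have "g has_fps_expansion F" using that(1) by (simp add: has_fps_expansion_def)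
    then show ?thesis using that(2) fps_expansion_unique_complex by blast
  qed
  have 1: "fps_X * fps_deriv B = A * B"
    by (rule cong[OF has_fps_expansion_mult[OF has_fps_expansion_fps_X has_fps_expansion_deriv[OF B]]
          has_fps_expansion_mult[OF A B] ld])
  have 2: "B = fps_const (2 - 4 * k) + fps_const (4 * k - 1) * A + fps_X * fps_deriv A - fps_const k * (A * A)
      + fps_const (2 * p) * fps_X - fps_const p * (fps_X * A) - fps_const q * (fps_X * fps_X)"
  proof (rule cong[OF B])
    show "(\<lambda>t. (2 - 4 * k) + (4 * k - 1) * s t + t * deriv s t - k * (s t * s t) + (2 * p) * t - p * (t * s t) - q * (t * t))
        has_fps_expansion fps_const (2 - 4 * k) + fps_const (4 * k - 1) * A + fps_X * fps_deriv A - fps_const k * (A * A)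
      + fps_const (2 * p) * fps_X - fps_const p * (fps_X * A) - fps_const q * (fps_X * fps_X)"
      by (intro fps_expansion_intros A)
  qed (simp add: ric power2_eq_square mult.assoc)
  have A0: "fps_nth A 0 = 0"
    using A s0 by (simp add: A_def fps_expansion_def)
  show ?thesis
    unfolding A_def[symmetric] B_def[symmetric]
  proof
    show "fps_nth A 0 = 0" by (rule A0)
    show "of_nat n * fps_nth B n = (\<Sum>i\<le>n. fps_nth A i * fps_nth B (n - i))" for n
    proof -
      have "fps_nth (fps_X * fps_deriv B) n = of_nat n * fps_nth B n" by (cases n) auto
      then show ?thesis unfolding 1 by (simp add: fps_mult_nth atLeast0AtMost)
    qed
    show "fps_nth B n = (if n = 0 then 2 - 4 * k else 0) + (4 * k - 1 + of_nat n) * fps_nth A n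
        - k * (\<Sum>i\<le>n. fps_nth A i * fps_nth A (n - i)) + (if n = 1 then 2 * p else 0)
        - (if n \<ge> 1 then p * fps_nth A (n - 1) else 0) - (if n = 2 then q else 0)" for n
    proof -
      have e1: "fps_nth (fps_X * fps_deriv A) n = of_nat n * fps_nth A n" by (cases n) auto
      have e2: "fps_nth (fps_X * A) n = (if n \<ge> 1 then fps_nth A (n - 1) else 0)" by (cases n) auto
      have e3: "fps_nth (fps_X * fps_X :: complex fps) n = (if n = 2 then 1 else 0)"
        by (auto simp: fps_X_nth numeral_2_eq_2 split: nat.splits) 
      have e4: "fps_nth (A * A) n = (\<Sum>i\<le>n. fps_nth A i * fps_nth A (n - i))"
        by (simp add: fps_mult_nth atLeast0AtMost)
      show ?thesis
        by (subst 2) (simp only: fps_add_nth fps_sub_nth fps_mult_left_const_nth e1 e2 e3 e4 fps_nth_fps_const fps_X_nth,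
            simp add: algebra_simps)
    qed
  qed
qed

end

subsection \<open>Growth away from the poles\<close>

lemma locally_bounded_imp_bounded_on_compact:
  fixes \<phi> :: "'a::topological_space \<Rightarrow> real"
  assumes "compact K" and loc: "\<And>x. x \<in> K \<Longrightarrow> \<exists>U M. open U \<and> x \<in> U \<and> (\<forall>z\<in>U. \<phi> z \<le> M)"
  shows "\<exists>M. \<forall>z\<in>K. \<phi> z \<le> M"
proof -
  define C where "C = {U. open U \<and> (\<exists>M. \<forall>z\<in>U. \<phi> z \<le> M)}"
  have "K \<subseteq> \<Union>C" using loc unfolding C_def by blast
  then obtain F where F: "F \<subseteq> C" "finite F" "K \<subseteq> \<Union>F"
    using compactE[OF assms(1), of C] unfolding C_def by blast
  have "\<exists>M. \<forall>z\<in>\<Union>F. \<phi> z \<le> M" using F(2,1)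
  proof (induction F)
    case (insert U F)
    then obtain M1 M2 where "\<forall>z\<in>U. \<phi> z \<le> M1" "\<forall>z\<in>\<Union>F. \<phi> z \<le> M2"
      unfolding C_def by blast
    then have "\<forall>z\<in>\<Union>(insert U F). \<phi> z \<le> max M1 M2" by (auto simp: le_max_iff_disj)
    then show ?case by blast
  qed auto
  then show ?thesis using F(3) by blast
qed

context log_deriv_ode
begin

lemma v_second_deriv:
  assumes z: "\<not> is_pole l z"
  shows "deriv (deriv v) z = (v z + (k + 1) * (l z)\<^sup>2 + p * l z + q) * v z"
proof -
  have "((\<lambda>w. l w * v w) has_field_derivative
      (v z + k * (l z)\<^sup>2 + p * l z + q) * v z + l z * v z * l z) (at z)"
    using DERIV_mult[OF l_deriv[OF z] v_deriv[OF z]] by (simp add: mult_ac)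
  then have "(deriv v has_field_derivative
      (v z + k * (l z)\<^sup>2 + p * l z + q) * v z + l z * v z * l z) (at z)"
    by (rule has_field_derivative_transform_within_open[OF _ not_pole_open])
       (use z DERIV_imp_deriv[OF v_deriv] in auto)
  then show ?thesis
    by (simp add: DERIV_imp_deriv algebra_simps power2_eq_square)
qed

text \<open>The equation \<open>v\<^sup>3 = v'' v - (k + 1) v'\<^sup>2 - p v v' - q v\<^sup>2\<close> has weight six on the left and at most
  six on the right, so Cauchy's estimates bound \<open>v\<close> at a point where it is nearly maximal.\<close>

lemma v_le_of_nearly_maximal:
  assumes \<rho>: "0 < \<rho>" "\<rho> \<le> 1" and np: "\<And>z. z \<in> ball z0 \<rho> \<Longrightarrow> \<not> is_pole v z"
    and bd: "\<And>z. z \<in> ball z0 \<rho> \<Longrightarrow> cmod (v z) \<le> 32 * cmod (v z0)"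
  shows "cmod (v z0) * \<rho>\<^sup>2 \<le> 256 + 4096 * cmod (k + 1) + 64 * cmod p + cmod q"
proof (cases "v z0 = 0")
  case True
  then show ?thesis by simp
next
  case False
  then have z0: "\<not> is_pole l z0" using v_pole by blast
  define m where "m = cmod (v z0)"
  have m: "m > 0" using False by (simp add: m_def)
  have hol: "v holomorphic_on ball z0 \<rho>"
  proof -
    have "v analytic_on {z}" if "z \<in> ball z0 \<rho>" for z
      using nicely_meromorphic_on_imp_analytic_at[OF v_nice] np[OF that] by simp
    then show ?thesis using analytic_on_analytic_at analytic_imp_holomorphic by blast
  qed
  have hol': "v holomorphic_on ball z0 (\<rho> / 2)" and cont: "continuous_on (cball z0 (\<rho> / 2)) v"
    using \<rho> by (auto intro!: holomorphic_on_subset[OF hol] continuous_on_subset[OF holomorphic_on_imp_continuous_on[OF hol]])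
  \<comment> \<open>Radius \<rho>/2 keeps the closed disc inside the ball. It turns 32 into 64 for
    v' and into 256 for v''; the square of 64 accounts for 4096 in the statement.\<close>
  have Cauchy: "cmod ((deriv ^^ n) v z0) \<le> fact n * (32 * m) / (\<rho> / 2) ^ n" for n
    by (rule Cauchy_inequality[OF hol' cont]) (use \<rho> bd in \<open>auto simp: m_def dist_norm\<close>)
  have 1: "cmod (deriv v z0) \<le> 64 * m / \<rho>" using Cauchy[of 1] by simp
  have 2: "cmod (deriv (deriv v) z0) \<le> 256 * m / \<rho>\<^sup>2"
    using Cauchy[of 2] by (simp add: numeral_2_eq_2 power2_eq_square field_simps)
  have dv: "deriv v z0 = l z0 * v z0" using v_deriv[OF z0] by (rule DERIV_imp_deriv)
  have eq: "v z0 ^ 3 = deriv (deriv v) z0 * v z0 - (k + 1) * (deriv v z0)\<^sup>2 - p * v z0 * deriv v z0 - q * (v z0)\<^sup>2"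
    unfolding v_second_deriv[OF z0] dv by (simp add: algebra_simps power2_eq_square power3_eq_cube)
  have "m ^ 3 = cmod (v z0 ^ 3)" by (simp add: m_def norm_power)
  also have "\<dots> \<le> cmod (deriv (deriv v) z0) * m + cmod (k + 1) * (cmod (deriv v z0))\<^sup>2
      + cmod p * m * cmod (deriv v z0) + cmod q * m\<^sup>2"
    unfolding eq m_def norm_mult[symmetric] norm_power[symmetric]
    by (meson norm_triangle_ineq4 order_trans add_right_mono)
  \<comment> \<open>Since \<rho> <= 1, the terms of lower weight can also be given the denominator
    \<rho>^2, and m^2 / \<rho>^2 factors out of the whole sum.\<close>
  also have "\<dots> \<le> 256 * m / \<rho>\<^sup>2 * m + cmod (k + 1) * (64 * m / \<rho>)\<^sup>2
      + cmod p * m * (64 * m / \<rho>\<^sup>2) + cmod q * (m / \<rho>)\<^sup>2"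
  proof (intro add_mono mult_left_mono mult_right_mono power_mono 1 2)
    have "64 * m / \<rho> \<le> 64 * m / \<rho>\<^sup>2"
      using \<rho> m by (intro divide_left_mono) (auto simp: power2_eq_square mult_le_one mult_left_le)
    then show "cmod (deriv v z0) \<le> 64 * m / \<rho>\<^sup>2" using 1 by linarith
    show "m \<le> m / \<rho>" using \<rho> m by (simp add: field_simps)
  qed (use m in auto)
  also have "\<dots> = m\<^sup>2 / \<rho>\<^sup>2 * (256 + 4096 * cmod (k + 1) + 64 * cmod p + cmod q)"
    using \<rho> by (simp add: field_simps power2_eq_square)
  finally have "m\<^sup>2 * (m * \<rho>\<^sup>2) \<le> m\<^sup>2 * (256 + 4096 * cmod (k + 1) + 64 * cmod p + cmod q)"
    using \<rho> by (simp add: field_simps power2_eq_square power3_eq_cube)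
  then show ?thesis using m by (simp add: m_def)
qed

definition D where "D = {z. is_pole v z}"

text \<open>\<open>infdist\<close> to the empty set is 0, hence the separate case. The cap at 1
  keeps all radii at most 1, which is what lets the lower-order terms with \<open>p\<close> and
  \<open>q\<close> be absorbed.\<close>

definition pole_dist where "pole_dist = (\<lambda>z. if D = {} then 1 else min 1 (infdist z D))"

lemma D_closed: "closed D" and D_finite: "finite (D \<inter> cball 0 R)"
proof -
  have sp: "D sparse_in UNIV"
    using meromorphic_on_imp_not_pole_cosparse[OF v_mero] by (simp add: eventually_cosparse D_def)
  then show "closed D" by (rule sparse_in_UNIV_imp_closed)
  have "finite {z. cmod z \<le> R \<and> is_pole v z}" by (rule finite_poles_cball[OF v_mero])
  moreover have "D \<inter> cball 0 R = {z. cmod z \<le> R \<and> is_pole v z}" by (auto simp: D_def)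
  ultimately show "finite (D \<inter> cball 0 R)" by simp
qed

lemma pole_dist_le_1: "pole_dist z \<le> 1" and pole_dist_nonneg: "0 \<le> pole_dist z" and pole_dist_pos: "0 < pole_dist z \<longleftrightarrow> z \<notin> D"
  using in_closed_iff_infdist_zero[OF D_closed, of z] infdist_nonneg[of z D]
  by (auto simp: pole_dist_def less_le)

lemma pole_dist_le_dist: "a \<in> D \<Longrightarrow> pole_dist z \<le> dist z a"
  using infdist_le[of a D z] by (auto simp: pole_dist_def)

lemma pole_dist_lipschitz: "pole_dist z \<le> pole_dist w + dist z w"
  using infdist_triangle[of z D w] zero_le_dist[of z w] unfolding pole_dist_def min_def
  by (auto simp del: zero_le_dist)

lemma pole_dist_attained:
  assumes "pole_dist z < 1"
  obtains a where "a \<in> D" "pole_dist z = dist z a"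
proof -
  have "D \<noteq> {}" "pole_dist z = infdist z D" using assms by (auto simp: pole_dist_def split: if_splits)
  then show ?thesis using infdist_attains_inf[OF D_closed] that by metis
qed

text \<open>The square of the distance cancels the double pole. Only boundedness is claimed: at a
  pole the weighted modulus takes the value 0 and is not continuous there.\<close>

lemma weight_locally_bounded: "\<exists>U M. open U \<and> z0 \<in> U \<and> (\<forall>z\<in>U. cmod (v z) * (pole_dist z)\<^sup>2 \<le> M)"
proof (cases "is_pole v z0")
  case True
  obtain r s W where L: "r > 0" "W holomorphic_on ball 0 r"
    "\<And>t. t \<in> ball 0 r - {0} \<Longrightarrow> v (z0 + t) = W t / t\<^sup>2"
    using pole_local[OF True] by metis
  have "W holomorphic_on cball 0 (r / 2)"
    by (rule holomorphic_on_subset[OF L(2)]) (use L(1) in auto)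
  then obtain M where M: "\<And>t. t \<in> cball 0 (r / 2) \<Longrightarrow> cmod (W t) \<le> M"
    using compact_imp_bounded[OF compact_continuous_image[OF holomorphic_on_imp_continuous_on compact_cball]]
    unfolding bounded_iff by blast
  have "cmod (v z) * (pole_dist z)\<^sup>2 \<le> max 0 M" if z: "z \<in> ball z0 (r / 2)" for z
  proof (cases "z = z0")
    case True
    then show ?thesis using \<open>is_pole v z0\<close> pole_dist_pos[of z0] pole_dist_nonneg[of z0] by (simp add: D_def less_le)
  next
    case False
    define t where "t = z - z0"
    have "cmod t < r / 2" using z by (simp add: t_def dist_norm norm_minus_commute)
    moreover from this have "cmod t < r" using L(1) by linarith
    ultimately have t: "t \<in> ball 0 r - {0}" "t \<in> cball 0 (r / 2)" "z = z0 + t"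
      using False by (auto simp: t_def)
    have "pole_dist z \<le> cmod t"
      using pole_dist_le_dist[of z0 z] True by (simp add: D_def t_def dist_norm)
    then have "cmod (v z) * (pole_dist z)\<^sup>2 \<le> cmod (v z) * (cmod t)\<^sup>2"
      using pole_dist_nonneg by (intro mult_left_mono power_mono) auto
    also have "\<dots> = cmod (W t)"
      using L(3)[OF t(1)] t by (simp add: norm_divide norm_power)
    finally show ?thesis using M[OF t(2)] by linarith
  qed
  then show ?thesis using L(1) by (intro exI[of _ "ball z0 (r / 2)"] exI[of _ "max 0 M"]) auto
next
  case False
  have "v analytic_on {z0}" using nicely_meromorphic_on_imp_analytic_at[OF v_nice] False by simp
  then have "v \<midarrow>z0\<rightarrow> v z0" using analytic_at_imp_isCont isContD by blast
  then have "eventually (\<lambda>z. cmod (v z) < cmod (v z0) + 1) (nhds z0)"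
    by (intro order_tendstoD(2)[OF tendsto_norm]) (auto simp: tendsto_at_iff_tendsto_nhds)
  then obtain U where U: "open U" "z0 \<in> U" "\<And>z. z \<in> U \<Longrightarrow> cmod (v z) < cmod (v z0) + 1"
    unfolding eventually_nhds by blast
  have "cmod (v z) * (pole_dist z)\<^sup>2 \<le> cmod (v z0) + 1" if "z \<in> U" for z
  proof -
    have "(pole_dist z)\<^sup>2 \<le> 1" using pole_dist_le_1[of z] pole_dist_nonneg[of z] by (simp add: power_le_one)
    then have "cmod (v z) * (pole_dist z)\<^sup>2 \<le> cmod (v z) * 1" by (intro mult_left_mono) auto
    then show ?thesis using U(3)[OF that] by simp
  qed
  then show ?thesis using U by blast
qed

text \<open>A rescaling argument: the extra weight (R + 1 - |z|)^2 vanishes on the boundary of a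
  larger disc and equals 1 on |z| = R, so a near-maximum lies away from both the boundary and the
  poles, where Cauchy's estimates apply.\<close>

lemma weight_bound:
  obtains C where "C > 0" "\<And>z. cmod (v z) * (pole_dist z)\<^sup>2 \<le> C * (cmod z + 1)\<^sup>2"
proof -
  define C0 where "C0 = 256 + 4096 * cmod (k + 1) + 64 * cmod p + cmod q"
  have C0: "C0 > 0" by (simp add: C0_def add_pos_nonneg)
  have main: "cmod (v z1) * (pole_dist z1)\<^sup>2 \<le> 8 * C0 * (R + 1)\<^sup>2" if z1: "cmod z1 = R" for z1 R
  proof -
    have R: "R \<ge> 0" using z1 by auto
    define w where "w = (\<lambda>z. R + 1 - cmod z)"
    define \<psi> where "\<psi> = (\<lambda>z. (w z)\<^sup>2 * (cmod (v z) * (pole_dist z)\<^sup>2))"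
    define K where "K = cball (0::complex) (R + 1)"
    obtain M where M: "\<And>z. z \<in> K \<Longrightarrow> cmod (v z) * (pole_dist z)\<^sup>2 \<le> M"
      using locally_bounded_imp_bounded_on_compact[of K "\<lambda>z. cmod (v z) * (pole_dist z)\<^sup>2"] weight_locally_bounded
      unfolding K_def by (metis compact_cball)
    have wK: "0 \<le> w z" "w z \<le> R + 1" if "z \<in> K" for z using that by (auto simp: w_def K_def)
    have "\<psi> z \<le> (R + 1)\<^sup>2 * \<bar>M\<bar>" if "z \<in> K" for z
      unfolding \<psi>_def using wK[OF that] M[OF that] by (intro mult_mono power_mono) auto
    then have bdd: "bdd_above (\<psi> ` K)" by (auto intro!: bdd_aboveI)
    define s where "s = Sup (\<psi> ` K)"
    have le_s: "\<psi> z \<le> s" if "z \<in> K" for z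
      unfolding s_def using that bdd by (intro cSUP_upper) auto
    have z1K: "z1 \<in> K" "w z1 = 1" using z1 by (auto simp: K_def w_def)
    have s_le: "s \<le> 8 * C0 * (R + 1)\<^sup>2"
    proof (cases "s > 0")
      case True
      then have "s / 2 < s" by simp
      \<comment> \<open>A point within a factor 2 of the supremum replaces a maximum, whose
        existence is unclear because of the discontinuity at poles. On the ball of radius \<rho>
        both \<open>w\<close> and \<open>pole_dist\<close> lose at most half, and 2 times 4 times 4
        is the constant 32.\<close>
      then obtain z0 where z0: "z0 \<in> K" "s / 2 < \<psi> z0"
        using less_cSUP_iff[OF _ bdd, of "s / 2"] z1K(1) unfolding s_def by blast
      have pos: "\<psi> z0 > 0" using z0(2) True by linarith
      have dd0: "pole_dist z0 > 0" and w0: "w z0 > 0" and v0: "cmod (v z0) > 0"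
        using pos pole_dist_nonneg[of z0] wK(1)[OF z0(1)] unfolding \<psi>_def
        by (auto simp: less_le)
      define \<rho> where "\<rho> = min (pole_dist z0) (w z0) / 2"
      have \<rho>: "\<rho> > 0" "\<rho> \<le> 1" using dd0 w0 pole_dist_le_1[of z0] by (auto simp: \<rho>_def)
      have near: "pole_dist z \<ge> pole_dist z0 / 2" "w z \<ge> w z0 / 2" "z \<in> K" if "z \<in> ball z0 \<rho>" for z
      proof -
        have d: "dist z0 z < pole_dist z0 / 2" "dist z0 z < w z0 / 2" using that by (auto simp: \<rho>_def)
        show "pole_dist z \<ge> pole_dist z0 / 2" using pole_dist_lipschitz[of z0 z] d by linarith
        have "cmod z \<le> cmod z0 + dist z0 z" by (metis dist_commute dist_norm norm_triangle_sub)
        then show "w z \<ge> w z0 / 2" using d by (simp add: w_def)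
        then show "z \<in> K" using w0 by (simp add: w_def K_def)
      qed
      have "cmod (v z0) * \<rho>\<^sup>2 \<le> C0"
        unfolding C0_def
      proof (rule v_le_of_nearly_maximal[OF \<rho>])
        fix z assume z: "z \<in> ball z0 \<rho>"
        have "pole_dist z > 0" using near(1)[OF z] dd0 by linarith
        then show "\<not> is_pole v z" by (simp add: pole_dist_pos D_def)
        have "(w z0 / 2)\<^sup>2 * (cmod (v z) * (pole_dist z0 / 2)\<^sup>2) \<le> \<psi> z"
          unfolding \<psi>_def using near[OF z] w0 dd0 by (intro mult_mono power_mono) auto
        also have "\<dots> \<le> 2 * \<psi> z0" using le_s[OF near(3)[OF z]] z0(2) by linarith
        finally have "((w z0)\<^sup>2 * (pole_dist z0)\<^sup>2) * cmod (v z) \<le> ((w z0)\<^sup>2 * (pole_dist z0)\<^sup>2) * (32 * cmod (v z0))"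
          by (simp add: \<psi>_def power_divide mult_ac)
        moreover have "(w z0)\<^sup>2 * (pole_dist z0)\<^sup>2 > 0" using w0 dd0 by simp
        ultimately show "cmod (v z) \<le> 32 * cmod (v z0)" by (rule mult_left_le_imp_le)
      qed
      \<comment> \<open>The product is minimum times maximum: the minimum is 2\<rho> by definition,
        and both factors are at most R + 1.\<close>
      moreover have "pole_dist z0 * w z0 \<le> 2 * (R + 1) * \<rho>"
      proof -
        have "pole_dist z0 * w z0 \<le> pole_dist z0 * (R + 1)" "pole_dist z0 * w z0 \<le> (R + 1) * w z0"
          using wK[OF z0(1)] dd0 pole_dist_le_1[of z0] R by (auto intro!: mult_left_mono mult_right_mono)
        then show ?thesis
          by (cases "pole_dist z0 \<le> w z0") (auto simp: \<rho>_def min_def algebra_simps)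
      qed
      then have "(pole_dist z0 * w z0)\<^sup>2 \<le> (2 * (R + 1) * \<rho>)\<^sup>2"
        using dd0 w0 by (intro power_mono) auto
      ultimately have "cmod (v z0) * (pole_dist z0 * w z0)\<^sup>2 \<le> 4 * (R + 1)\<^sup>2 * C0"
      proof -
        assume a: "cmod (v z0) * \<rho>\<^sup>2 \<le> C0" and b: "(pole_dist z0 * w z0)\<^sup>2 \<le> (2 * (R + 1) * \<rho>)\<^sup>2"
        have "cmod (v z0) * (pole_dist z0 * w z0)\<^sup>2 \<le> cmod (v z0) * (2 * (R + 1) * \<rho>)\<^sup>2"
          using b by (rule mult_left_mono) simp
        also have "\<dots> = 4 * (R + 1)\<^sup>2 * (cmod (v z0) * \<rho>\<^sup>2)" by (simp add: power2_eq_square algebra_simps)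
        also have "\<dots> \<le> 4 * (R + 1)\<^sup>2 * C0" using a by (intro mult_left_mono) auto
        finally show ?thesis .
      qed
      then have "\<psi> z0 \<le> 4 * (R + 1)\<^sup>2 * C0" by (simp add: \<psi>_def power_mult_distrib mult_ac)
      then show ?thesis using z0(2) by (simp add: mult_ac)
    next
      case False
      have "0 \<le> 8 * C0 * (R + 1)\<^sup>2" using C0 by simp
      then show ?thesis using False by linarith
    qed
    have "cmod (v z1) * (pole_dist z1)\<^sup>2 = \<psi> z1" by (simp add: \<psi>_def z1K)
    then show ?thesis using le_s[OF z1K(1)] s_le by linarith
  qed
  show ?thesis by (rule that[of "8 * C0"]) (use main C0 in auto)
qed

text \<open>Pigeonhole on a grid of squares of side \<sigma>/2, where \<sigma> is the separation:
  two poles in one square would be closer than \<sigma>. The number of squares is quadratic in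
  R/\<sigma>, and the additional 1 in K + 1 absorbs the factor R.\<close>

lemma card_poles_le:
  assumes c: "c > 0" and K: "K \<ge> 0" and R: "R \<ge> 0"
    and sep: "\<And>a b. a \<in> D \<Longrightarrow> b \<in> D \<Longrightarrow> a \<noteq> b \<Longrightarrow> cmod a \<le> R \<Longrightarrow> cmod b \<le> R \<Longrightarrow> c * exp (- K * R) \<le> dist a b"
  shows "real (card (D \<inter> cball 0 R)) \<le> (4 / c + 5)\<^sup>2 * exp (2 * (K + 1) * R)"
proof -
  define \<sigma> where "\<sigma> = c * exp (- K * R)"
  have \<sigma>: "\<sigma> > 0" using c by (simp add: \<sigma>_def)
  define f where "f = (\<lambda>z::complex. (\<lfloor>2 * Re z / \<sigma>\<rfloor>, \<lfloor>2 * Im z / \<sigma>\<rfloor>))"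
  define N where "N = \<lceil>2 * R / \<sigma>\<rceil> + 1"
  have N: "0 \<le> N" "real_of_int N \<le> 2 * R / \<sigma> + 2"
  proof -
    have "2 * R / \<sigma> \<ge> 0" using R \<sigma> by simp
    then have "\<lceil>2 * R / \<sigma>\<rceil> \<ge> 0" by linarith
    then show "0 \<le> N" by (simp add: N_def)
    show "real_of_int N \<le> 2 * R / \<sigma> + 2" unfolding N_def by linarith
  qed
  have close: "\<bar>x - y\<bar> < \<sigma> / 2" if "\<lfloor>2 * x / \<sigma>\<rfloor> = \<lfloor>2 * y / \<sigma>\<rfloor>" for x y
  proof -
    have "\<bar>2 * x / \<sigma> - 2 * y / \<sigma>\<bar> < 1" using that by linarith
    then have "\<bar>(x - y) * (2 / \<sigma>)\<bar> < 1" by (simp add: algebra_simps diff_divide_distrib)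
    then have "\<bar>2 * x - 2 * y\<bar> < \<sigma>" using \<sigma> by (simp add: abs_mult field_simps)
    then show ?thesis by linarith
  qed
  have inj: "inj_on f (D \<inter> cball 0 R)"
  proof (rule inj_onI, rule ccontr)
    fix a b assume ab: "a \<in> D \<inter> cball 0 R" "b \<in> D \<inter> cball 0 R" "f a = f b" "a \<noteq> b"
    have "\<bar>Re (a - b)\<bar> < \<sigma> / 2" "\<bar>Im (a - b)\<bar> < \<sigma> / 2"
      using ab(3) close[of "Re a" "Re b"] close[of "Im a" "Im b"] by (auto simp: f_def)
    then have "dist a b < \<sigma>"
      using cmod_le[of "a - b"] unfolding dist_norm by linarith
    moreover have "\<sigma> \<le> dist a b" unfolding \<sigma>_def using ab by (intro sep) auto
    ultimately show False by linarith
  qed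
  have rng: "\<lfloor>2 * x / \<sigma>\<rfloor> \<in> {- N..N}" if "\<bar>x\<bar> \<le> R" for x
  proof -
    have "\<bar>2 * x / \<sigma>\<bar> \<le> 2 * R / \<sigma>" using that \<sigma> by (simp add: abs_mult divide_right_mono)
    then show ?thesis unfolding N_def by (auto; linarith)
  qed
  have "f ` (D \<inter> cball 0 R) \<subseteq> {- N..N} \<times> {- N..N}"
  proof (rule image_subsetI)
    fix z assume "z \<in> D \<inter> cball 0 R"
    then have "\<bar>Re z\<bar> \<le> R" "\<bar>Im z\<bar> \<le> R"
      using abs_Re_le_cmod[of z] abs_Im_le_cmod[of z] by auto
    then show "f z \<in> {- N..N} \<times> {- N..N}" using rng unfolding f_def by blast
  qed
  then have "card (D \<inter> cball 0 R) \<le> card ({- N..N} \<times> {- N..N})"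
    using card_image[OF inj] card_mono[of "{- N..N} \<times> {- N..N}" "f ` (D \<inter> cball 0 R)"] by simp
  also have "\<dots> = (nat (2 * N + 1))\<^sup>2" by (simp add: card_cartesian_product power2_eq_square)
  finally have "real (card (D \<inter> cball 0 R)) \<le> real ((nat (2 * N + 1))\<^sup>2)"
    by (rule of_nat_mono)
  also have "\<dots> = (2 * real_of_int N + 1)\<^sup>2"
    using N(1) by simp
  also have "\<dots> \<le> ((4 / c + 5) * exp ((K + 1) * R))\<^sup>2"
  proof (rule power_mono)
    have E: "R \<le> exp R" "1 \<le> exp ((K + 1) * R)"
      using exp_ge_add_one_self[of R] K R by (linarith, simp)
    have "R / \<sigma> = R / c * exp (K * R)"
      by (simp add: \<sigma>_def exp_minus field_simps)
    also have "\<dots> \<le> exp R / c * exp (K * R)"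
      using E c by (intro mult_right_mono divide_right_mono) auto
    also have "\<dots> = exp ((K + 1) * R) / c"
      by (simp add: algebra_simps exp_add)
    finally have "4 * (R / \<sigma>) \<le> 4 / c * exp ((K + 1) * R)" by simp
    then show "2 * real_of_int N + 1 \<le> (4 / c + 5) * exp ((K + 1) * R)"
    proof -
      have "2 * R / \<sigma> = 2 * (R / \<sigma>)"
        "(4 / c + 5) * exp ((K + 1) * R) = 4 / c * exp ((K + 1) * R) + 5 * exp ((K + 1) * R)"
        by (simp_all add: distrib_right)
      then show ?thesis
        using N(2) E(2) \<open>4 * (R / \<sigma>) \<le> 4 / c * exp ((K + 1) * R)\<close> by linarith
    qed
    show "0 \<le> 2 * real_of_int N + 1" using N(1) by simp
  qed
  also have "\<dots> = (4 / c + 5)\<^sup>2 * exp (2 * (K + 1) * R)"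
    by (simp only: power_mult_distrib mult.assoc exp_double)
  finally show ?thesis .
qed

end

section \<open>Clearing the poles in a disc and the resulting growth bound\<close>

context log_deriv_ode
begin

text \<open>\<open>v\<close> and its derivative have poles of order 2 and 3, so after multiplication
  by the fourth power both limits at a pole are 0. This is also the value of the two expressions
  there, because the product vanishes, so they are analytic as they stand.\<close>

lemma pole_cleared_analytic:
  assumes "finite A" "z0 \<notin> D \<or> z0 \<in> A"
  shows "(\<lambda>z. v z * (\<Prod>a\<in>A. z - a) ^ 4) analytic_on {z0}"
    "(\<lambda>z. deriv v z * (\<Prod>a\<in>A. z - a) ^ 4) analytic_on {z0}"
proof -
  have both: "(\<lambda>z. v z * (\<Prod>a\<in>A. z - a) ^ 4) analytic_on {z0} \<and>
      (\<lambda>z. deriv v z * (\<Prod>a\<in>A. z - a) ^ 4) analytic_on {z0}"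
  proof (cases "z0 \<in> D")
    case False
    then have "v analytic_on {z0}"
      using nicely_meromorphic_on_imp_analytic_at[OF v_nice] by (simp add: D_def)
    then show ?thesis by (intro conjI analytic_intros analytic_deriv) auto
  next
    case True
    then have pole: "is_pole v z0" and z0A: "z0 \<in> A" using assms(2) by (auto simp: D_def)
    obtain r s W where L: "r > 0" "s holomorphic_on ball 0 r" "W holomorphic_on ball 0 r"
      "\<And>t. t \<in> ball 0 r - {0} \<Longrightarrow> \<not> is_pole l (z0 + t) \<and> v (z0 + t) = W t / t\<^sup>2 \<and> l (z0 + t) = (s t - 2) / t"
      using pole_local[OF pole] by metis
    define g where "g = (\<lambda>t. (\<Prod>a\<in>A - {z0}. z0 + t - a) ^ 4)"
    have ghol: "g holomorphic_on ball 0 r" unfolding g_def by (intro holomorphic_intros)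
    have prod: "(\<Prod>a\<in>A. z - a) = (z - z0) * (\<Prod>a\<in>A - {z0}. z - a)" for z
      using assms(1) z0A by (simp add: prod.remove)
    have eq: "v z * (\<Prod>a\<in>A. z - a) ^ 4 = W (z - z0) * (z - z0)\<^sup>2 * g (z - z0)"
        "deriv v z * (\<Prod>a\<in>A. z - a) ^ 4 = (s (z - z0) - 2) * W (z - z0) * (z - z0) * g (z - z0)"
      if z: "z \<in> ball z0 r" for z
    proof -
      show "v z * (\<Prod>a\<in>A. z - a) ^ 4 = W (z - z0) * (z - z0)\<^sup>2 * g (z - z0)"
      proof (cases "z = z0")
        case False
        define t where "t = z - z0"
        have t: "t \<in> ball 0 r - {0}" "z = z0 + t"
          using z False by (auto simp: t_def dist_norm norm_minus_commute)
        show ?thesis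
          using L(4)[OF t(1)] t unfolding prod by (simp add: g_def power_mult_distrib field_simps eval_nat_numeral)
      qed (simp add: prod)
      show "deriv v z * (\<Prod>a\<in>A. z - a) ^ 4 = (s (z - z0) - 2) * W (z - z0) * (z - z0) * g (z - z0)"
      proof (cases "z = z0")
        case False
        define t where "t = z - z0"
        have t: "t \<in> ball 0 r - {0}" "z = z0 + t"
          using z False by (auto simp: t_def dist_norm norm_minus_commute)
        have "deriv v z = l z * v z"
          using L(4)[OF t(1)] v_deriv[of z] t(2) by (simp add: DERIV_imp_deriv)
        then have e3: "deriv v z * t ^ 3 = (s t - 2) * W t"
          using L(4)[OF t(1)] t by (simp add: field_simps power2_eq_square power3_eq_cube)
        have "deriv v z * (t * x) ^ 4 = (deriv v z * t ^ 3) * t * x ^ 4" for x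
          by (simp add: eval_nat_numeral mult_ac)
        then have "deriv v z * (t * x) ^ 4 = (s t - 2) * W t * t * x ^ 4" for x
          unfolding e3 .
        then show ?thesis
          using t(2) unfolding prod g_def by simp
      qed (simp add: prod)
    qed
    have ev: "eventually (\<lambda>z. z \<in> ball z0 r) (nhds z0)"
      using L(1) by (intro eventually_nhds_in_open) auto
    have shift: "(\<lambda>z. f (z - z0)) holomorphic_on ball z0 r" if "f holomorphic_on ball 0 r" for f
      by (rule holomorphic_on_compose_gen[OF _ that, unfolded o_def])
         (auto intro!: holomorphic_intros simp: dist_norm norm_minus_commute)
    have hol: "(\<lambda>z. W (z - z0) * (z - z0)\<^sup>2 * g (z - z0)) holomorphic_on ball z0 r"
      "(\<lambda>z. (s (z - z0) - 2) * W (z - z0) * (z - z0) * g (z - z0)) holomorphic_on ball z0 r"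
      by (intro holomorphic_intros shift L ghol)+
    have an: "(\<lambda>z. W (z - z0) * (z - z0)\<^sup>2 * g (z - z0)) analytic_on {z0}"
      "(\<lambda>z. (s (z - z0) - 2) * W (z - z0) * (z - z0) * g (z - z0)) analytic_on {z0}"
      using hol L(1) by (meson analytic_at centre_in_ball open_ball)+
    have ev1: "eventually (\<lambda>z. v z * (\<Prod>a\<in>A. z - a) ^ 4 = W (z - z0) * (z - z0)\<^sup>2 * g (z - z0)) (nhds z0)"
      using ev by eventually_elim (rule eq(1))
    have ev2: "eventually (\<lambda>z. deriv v z * (\<Prod>a\<in>A. z - a) ^ 4 = (s (z - z0) - 2) * W (z - z0) * (z - z0) * g (z - z0)) (nhds z0)"
      using ev by eventually_elim (rule eq(2))
    show ?thesis
      using an unfolding analytic_at_cong[OF ev1 refl] analytic_at_cong[OF ev2 refl] by simp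
  qed
  show "(\<lambda>z. v z * (\<Prod>a\<in>A. z - a) ^ 4) analytic_on {z0}"
    "(\<lambda>z. deriv v z * (\<Prod>a\<in>A. z - a) ^ 4) analytic_on {z0}"
    using both by auto
qed

text \<open>The factor of the nearest pole supplies \<open>pole_dist z\<close>, and every other
  factor is at most \<open>L\<close>. The radius r + 2 ensures that a pole at distance less than 1
  from \<open>z\<close> belongs to \<open>A\<close>. The gain of \<open>pole_dist\<close> is what
  compensates the blow-up of \<open>v\<close>.\<close>

lemma pole_product_le:
  assumes z: "cmod z = r" and L: "L = 2 * r + 3" and A: "A = D \<inter> cball 0 (r + 2)"
  shows "cmod (\<Prod>a\<in>A. z - a) \<le> pole_dist z * L ^ card A"
proof -
  have fin: "finite A" unfolding A by (rule D_finite)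
  have r: "r \<ge> 0" using z by auto
  have le: "cmod (z - a) \<le> L" if "a \<in> A" for a
    using norm_triangle_ineq4[of z a] that z by (auto simp: L A)
  have L1: "L \<ge> 1" using r by (simp add: L)
  have gen: "(\<Prod>a\<in>B. cmod (z - a)) \<le> L ^ card B" if "B \<subseteq> A" for B
    using prod_mono[of B "\<lambda>a. cmod (z - a)" "\<lambda>_. L"] le that by auto
  show ?thesis
  proof (cases "pole_dist z < 1")
    case True
    then obtain a where a: "a \<in> D" "pole_dist z = dist z a" using pole_dist_attained by blast
    have "cmod a \<le> cmod z + dist z a" by (metis dist_commute dist_norm norm_triangle_sub)
    then have aA: "a \<in> A" using a True z by (simp add: A)
    have "cmod (\<Prod>a\<in>A. z - a) = cmod (z - a) * (\<Prod>b\<in>A - {a}. cmod (z - b))"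
      using fin aA by (simp add: prod.remove prod_norm[symmetric] norm_mult)
    also have "\<dots> \<le> pole_dist z * L ^ card (A - {a})"
      using gen[of "A - {a}"] a by (intro mult_mono) (auto simp: dist_norm intro!: prod_nonneg)
    also have "\<dots> \<le> pole_dist z * L ^ card A"
      using L1 fin pole_dist_nonneg by (intro mult_left_mono power_increasing card_mono) auto
    finally show ?thesis .
  next
    case False
    then have "pole_dist z = 1" using pole_dist_le_1[of z] by linarith
    then show ?thesis using gen[of A] by (simp add: prod_norm[symmetric])
  qed
qed

text \<open>Cauchy's estimate on a disc whose radius is a quarter of the distance costs one further
  power of \<open>pole_dist\<close>.\<close>

lemma v_deriv_bound:
  assumes z: "z \<notin> D" and C: "C > 0" "\<And>z. cmod (v z) * (pole_dist z)\<^sup>2 \<le> C * (cmod z + 1)\<^sup>2"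
  shows "cmod (deriv v z) * pole_dist z ^ 3 \<le> 16 * C * (cmod z + 2)\<^sup>2"
proof -
  define \<rho> where "\<rho> = pole_dist z / 4"
  have d: "pole_dist z > 0" using z pole_dist_pos by blast
  then have \<rho>: "\<rho> > 0" "\<rho> \<le> 1 / 4" using pole_dist_le_1[of z] by (auto simp: \<rho>_def)
  have near: "pole_dist w \<ge> pole_dist z / 2" if "dist z w \<le> \<rho>" for w
    using pole_dist_lipschitz[of z w] that d by (simp add: \<rho>_def)
  have hol: "v holomorphic_on cball z \<rho>"
  proof -
    have "v analytic_on {w}" if "w \<in> cball z \<rho>" for w
    proof -
      have "pole_dist w > 0" using near[of w] that d by simp
      then show ?thesis
        using nicely_meromorphic_on_imp_analytic_at[OF v_nice] pole_dist_pos by (simp add: D_def)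
    qed
    then show ?thesis using analytic_on_analytic_at analytic_imp_holomorphic by blast
  qed
  define B where "B = 4 * C * (cmod z + 2)\<^sup>2 / (pole_dist z)\<^sup>2"
  have "cmod ((deriv ^^ 1) v z) \<le> fact 1 * B / \<rho> ^ 1"
  proof (rule Cauchy_inequality)
    show "v holomorphic_on ball z \<rho>" "continuous_on (cball z \<rho>) v"
      using hol holomorphic_on_subset[OF hol] by (auto intro: holomorphic_on_imp_continuous_on)
    fix w assume w: "norm (z - w) = \<rho>"
    have "pole_dist z / 2 \<le> pole_dist w" using near[of w] w by (simp add: dist_norm)
    then have "cmod (v w) * (pole_dist z / 2)\<^sup>2 \<le> cmod (v w) * (pole_dist w)\<^sup>2"
      using d by (intro mult_left_mono power_mono) auto
    also have "\<dots> \<le> C * (cmod w + 1)\<^sup>2" by (rule C)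
    also have "\<dots> \<le> C * (cmod z + 2)\<^sup>2"
    proof -
      have "cmod w \<le> cmod z + cmod (z - w)" by (metis norm_minus_commute norm_triangle_sub)
      then show ?thesis using w \<rho> C(1) by (intro mult_left_mono power_mono) auto
    qed
    finally show "cmod (v w) \<le> B"
      using d by (simp add: B_def field_simps power2_eq_square)
  qed (rule \<rho>)
  then have "cmod (deriv v z) \<le> B / \<rho>" by simp
  then have "cmod (deriv v z) * pole_dist z ^ 3 \<le> B / \<rho> * pole_dist z ^ 3"
    using d by (intro mult_right_mono) auto
  also have "\<dots> = 16 * C * (cmod z + 2)\<^sup>2"
    using d by (simp add: B_def \<rho>_def field_simps eval_nat_numeral)
  finally show ?thesis .
qed

text \<open>From a u + b = l = v'/v one gets u (a v g^4) = (v' - b v) g^4, where g clears the poles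
  of \<open>v\<close> of modulus at most r + 2. The size of both sides on |z| = r is controlled by
  the degree of g, and the separation hypothesis bounds that degree.\<close>

theorem growth_from_separation:
  fixes u :: "complex \<Rightarrow> complex" and a b :: complex
  assumes u: "u nicely_meromorphic_on UNIV" and a: "a \<noteq> 0"
    and ul: "\<And>z. \<not> is_pole u z \<Longrightarrow> \<not> is_pole l z \<and> a * u z = l z - b"
    and c: "c > 0" and K: "K \<ge> 0"
    and sep: "\<And>R x y. R \<ge> 0 \<Longrightarrow> x \<in> D \<Longrightarrow> y \<in> D \<Longrightarrow> x \<noteq> y \<Longrightarrow> cmod x \<le> R \<Longrightarrow> cmod y \<le> R
        \<Longrightarrow> c * exp (- K * R) \<le> dist x y"
  shows "\<exists>a b c :: real. a > 0 \<and> b > 0 \<and> c > 0 \<and>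
           (\<forall>r\<ge>0. nevanlinna_T r u < a * exp (b * r powr c))"
proof -
  obtain C where C: "C > 0" "\<And>z. cmod (v z) * (pole_dist z)\<^sup>2 \<le> C * (cmod z + 1)\<^sup>2"
    using weight_bound by blast
  define A where "A = (\<lambda>r. D \<inter> cball 0 (r + 2))"
  define g where "g = (\<lambda>r z. (\<Prod>x\<in>A r. z - x))"
  have finA: "finite (A r)" for r unfolding A_def by (rule D_finite)
  have hol: "(\<lambda>z. v z * g r z ^ 4) holomorphic_on ball 0 (r + 2)"
    "(\<lambda>z. deriv v z * g r z ^ 4) holomorphic_on ball 0 (r + 2)" for r
  proof -
    have "(\<lambda>z. v z * g r z ^ 4) analytic_on {z0} \<and> (\<lambda>z. deriv v z * g r z ^ 4) analytic_on {z0}"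
      if "z0 \<in> ball 0 (r + 2)" for z0
      unfolding g_def using pole_cleared_analytic[OF finA, of z0 r] that by (auto simp: A_def)
    then show "(\<lambda>z. v z * g r z ^ 4) holomorphic_on ball 0 (r + 2)"
      "(\<lambda>z. deriv v z * g r z ^ 4) holomorphic_on ball 0 (r + 2)"
      using analytic_on_analytic_at analytic_imp_holomorphic by blast+
  qed
  have gnz: "g r z \<noteq> 0" if "z \<notin> D" for r z
    using that finA[of r] by (auto simp: g_def A_def)
  obtain z1 where z1: "z1 \<in> ball 0 2" "v z1 * g 0 z1 ^ 4 \<noteq> 0"
  proof -
    have "eventually (\<lambda>w. \<not> is_pole l w \<and> w \<in> ball 0 2 - {0}) (at (0::complex))"
      using ev_not_pole[of 0] eventually_at_in_open[of "ball 0 2" "0::complex"]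
      by (auto elim: eventually_elim2)
    then obtain w where w: "\<not> is_pole l w" "w \<in> ball 0 2"
      using eventually_happens' [OF at_neq_bot] by blast
    have "w \<notin> D" using w(1) pole_of_v_imp_pole_of_l by (auto simp: D_def)
    then show ?thesis using that w v_nz gnz by auto
  qed
  have hol0: "(\<lambda>z. v z * g 0 z ^ 4) holomorphic_on ball 0 2" using hol(1)[of 0] by simp
  \<comment> \<open>The zero at the origin is split off once, using only the poles of modulus at
    most 2, so that \<kappa> and H0(0) do not depend on the radius.\<close>
  obtain \<kappa> H0 where H0: "H0 holomorphic_on ball 0 2" "H0 0 \<noteq> 0"
      "\<And>z. z \<in> ball 0 2 \<Longrightarrow> v z * g 0 z ^ 4 = (z - 0) ^ \<kappa> * H0 z"
    using holomorphic_factor_at[OF hol0 open_ball convex_connected[OF convex_ball] _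
        bexI[of "\<lambda>z. v z * g 0 z ^ 4 \<noteq> 0", OF z1(2,1)], of 0]
    by (metis centre_in_ball zero_less_numeral)
  define N0 where "N0 = (4 / c + 5)\<^sup>2 * exp (4 * (K + 1))"
  have card: "real (card (A r)) \<le> N0 * exp (2 * (K + 1) * r)" if "r \<ge> 0" for r
  proof -
    have "real (card (A r)) \<le> (4 / c + 5)\<^sup>2 * exp (2 * (K + 1) * (r + 2))"
      unfolding A_def using that by (intro card_poles_le c K sep) auto
    also have "exp (2 * (K + 1) * (r + 2)) = exp (4 * (K + 1)) * exp (2 * (K + 1) * r)"
      by (simp add: algebra_simps flip: exp_add)
    finally show ?thesis by (simp add: N0_def mult.assoc)
  qed
  define C1 where "C1 = (1 + cmod a + cmod b) * 16 * C"
  have C1: "C1 > 0" unfolding C1_def using C(1) norm_ge_zero[of a] norm_ge_zero[of b]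
    by (intro mult_pos_pos) linarith+
  \<comment> \<open>The exponent to be bounded is C1 + 2(r + 2) + 4 n (2r + 3) with n the number of
    poles. The summands 4 and 12 N0 come from r + 2 <= 2 exp(B1 r) and 2r + 3 <= 3 exp r; the 1 in
    \<open>B1\<close> pays for this last exponential.\<close>
  define A1 B1 where "A1 = C1 + 4 + 12 * N0" and "B1 = 2 * (K + 1) + 1"
  have total: "C1 * (r + 2)\<^sup>2 * (2 * r + 3) ^ (4 * card (A r)) \<le> exp (A1 * exp (B1 * r))" if r: "r \<ge> 0" for r
  proof -
    have e: "x \<le> exp x" for x :: real using exp_ge_add_one_self[of x] by linarith
    have "C1 * (r + 2)\<^sup>2 * (2 * r + 3) ^ (4 * card (A r)) \<le> exp C1 * (exp (r + 2))\<^sup>2 * (exp (2 * r + 3)) ^ (4 * card (A r))"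
      using e C1 r by (intro mult_mono power_mono) auto
    also have "\<dots> = exp (C1 + 2 * (r + 2) + 4 * (real (card (A r)) * (2 * r + 3)))"
      by (simp add: exp_add exp_double[symmetric] exp_of_nat_mult[symmetric] algebra_simps)
    also have "\<dots> \<le> exp (A1 * exp (B1 * r))"
    proof -
      have E1: "1 \<le> exp (B1 * r)" using r K by (simp add: B1_def)
      have rB: "r \<le> B1 * r" using mult_right_mono[of 1 B1 r] r K by (simp add: B1_def)
      have E2: "r + 2 \<le> 2 * exp (B1 * r)"
      proof -
        have "r + 1 \<le> exp (B1 * r)" using exp_ge_add_one_self[of "B1 * r"] rB by linarith
        then show ?thesis using E1 by linarith
      qed
      have "real (card (A r)) * (2 * r + 3) \<le> (N0 * exp (2 * (K + 1) * r)) * (3 * exp r)"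
      proof (rule mult_mono)
        show "2 * r + 3 \<le> 3 * exp r" using exp_ge_add_one_self[of r] r by linarith
      qed (use card[OF r] r in \<open>auto intro: order_trans[OF _ card[OF r]]\<close>)
      also have "\<dots> = 3 * N0 * (exp (2 * (K + 1) * r) * exp r)" by simp
      also have "exp (2 * (K + 1) * r) * exp r = exp (B1 * r)"
        unfolding exp_add[symmetric] B1_def by (simp add: algebra_simps)
      finally have E3: "real (card (A r)) * (2 * r + 3) \<le> 3 * N0 * exp (B1 * r)" .
      have "C1 \<le> C1 * exp (B1 * r)" using E1 C1 by simp
      then have "C1 + 2 * (r + 2) + 4 * (real (card (A r)) * (2 * r + 3)) \<le> A1 * exp (B1 * r)"
        using E2 E3 by (simp add: A1_def algebra_simps)
      then show ?thesis by simp
    qed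
    finally show ?thesis .
  qed
  show ?thesis
  proof (rule nevanlinna_growth_quotient[OF u, of "cmod (a * H0 0)" \<kappa> A1 B1])
    show "cmod (a * H0 0) > 0" using a H0(2) by simp
    fix r :: real assume r: "r > 0"
    define h where "h = (\<lambda>z. (\<Prod>x\<in>A r - A 0. z - x))"
    have gh: "g r z = g 0 z * h z" for z
    proof -
      have "A 0 \<subseteq> A r" using r by (auto simp: A_def)
      then show ?thesis
        unfolding g_def h_def using finA[of r] by (metis mult.commute prod.subset_diff)
    qed
    define F where "F = (\<lambda>z. deriv v z * g r z ^ 4 - b * (v z * g r z ^ 4))"
    \<comment> \<open>Division by z^\<kappa> is meaningless at 0, so near 0 the factor
      \<open>H0\<close> is used instead; the two formulas agree on the overlap because g r = g 0
      h.\<close>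
    define H where "H = (\<lambda>z. a * (if z \<in> ball 0 2 then H0 z * h z ^ 4 else v z * g r z ^ 4 / z ^ \<kappa>))"
    have zH: "z ^ \<kappa> * H z = a * (v z * g r z ^ 4)" for z
      using H0(3)[of z] by (auto simp: H_def gh power_mult_distrib)
    have "H holomorphic_on ball 0 2 \<union> (ball 0 (r + 2) - {0})"
    proof (rule holomorphic_on_Un)
      have "(\<lambda>z. a * (H0 z * h z ^ 4)) holomorphic_on ball 0 2"
        unfolding h_def by (intro holomorphic_intros H0)
      then show "H holomorphic_on ball 0 2"
        by (rule holomorphic_transform) (auto simp: H_def)
      have "(\<lambda>z. a * (v z * g r z ^ 4) / z ^ \<kappa>) holomorphic_on ball 0 (r + 2) - {0}"
        by (intro holomorphic_intros holomorphic_on_subset[OF hol(1)]) auto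
      then show "H holomorphic_on ball 0 (r + 2) - {0}"
        by (rule holomorphic_transform) (use zH in \<open>auto simp: field_simps\<close>)
    qed auto
    then have Hhol: "H holomorphic_on ball 0 (r + 2)"
      by (rule holomorphic_on_subset) (use r in auto)
    have Fhol: "F holomorphic_on ball 0 (r + 2)"
      unfolding F_def by (intro holomorphic_intros hol)
    \<comment> \<open>The poles outside \<open>A 0\<close> have modulus greater than 2, hence |h(0)|
      >= 1: enlarging the disc cannot make the denominator small at the origin.\<close>
    have H_0: "cmod (a * H0 0) \<le> cmod (H 0)"
    proof -
      have "1 \<le> (\<Prod>x\<in>A r - A 0. cmod (0 - x))"
        by (rule prod_ge_1) (auto simp: A_def)
      then have "1 \<le> cmod (h 0)" by (simp add: h_def prod_norm[symmetric])
      then have "1 \<le> cmod (h 0) ^ 4" by simp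
      then have "cmod (a * H0 0) * 1 \<le> cmod (a * H0 0) * cmod (h 0) ^ 4"
        by (intro mult_left_mono) auto
      then show ?thesis by (simp add: H_def norm_mult norm_power mult.assoc)
    qed
    have eq: "u z * (z ^ \<kappa> * H z) = F z" if "\<not> is_pole u z" for z
    proof -
      have "deriv v z = l z * v z" using ul[OF that] v_deriv by (simp add: DERIV_imp_deriv)
      moreover have "l z = a * u z + b" using ul[OF that] by (simp add: algebra_simps)
      ultimately show ?thesis unfolding zH F_def by (simp add: algebra_simps)
    qed
    have bd: "cmod (F z) \<le> exp (A1 * exp (B1 * r)) \<and> cmod (z ^ \<kappa> * H z) \<le> exp (A1 * exp (B1 * r))"
      if z: "cmod z = r" for z
    proof -
      define L where "L = 2 * r + 3"
      define n where "n = card (A r)"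
      have L1: "L \<ge> 1" using r by (simp add: L_def)
      have gle: "cmod (g r z) \<le> pole_dist z * L ^ n"
        unfolding g_def n_def by (rule pole_product_le[OF z L_def]) (simp add: A_def)
      have g4: "cmod (g r z) ^ 4 \<le> pole_dist z ^ 4 * L ^ (4 * n)"
        using power_mono[OF gle, of 4] by (simp add: power_mult_distrib power_mult mult.commute)
      have d4: "pole_dist z ^ 4 \<le> (pole_dist z)\<^sup>2" "pole_dist z ^ 4 \<le> pole_dist z ^ 3"
        using pole_dist_nonneg[of z] pole_dist_le_1[of z] by (auto intro: power_decreasing)
      have V: "cmod (v z * g r z ^ 4) \<le> 16 * C * (r + 2)\<^sup>2 * L ^ (4 * n)"
      proof -
        have "cmod (v z * g r z ^ 4) \<le> cmod (v z) * ((pole_dist z)\<^sup>2 * L ^ (4 * n))"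
          unfolding norm_mult norm_power
          using g4 d4 L1 by (intro mult_left_mono order_trans[OF g4] mult_right_mono) auto
        also have "\<dots> \<le> C * (r + 1)\<^sup>2 * L ^ (4 * n)"
          unfolding mult.assoc[symmetric] using C(2)[of z] z L1 by (intro mult_right_mono) auto
        also have "\<dots> \<le> 16 * C * (r + 2)\<^sup>2 * L ^ (4 * n)"
          using C(1) r L1 by (intro mult_right_mono mult_mono power_mono) auto
        finally show ?thesis .
      qed
      have V': "cmod (deriv v z * g r z ^ 4) \<le> 16 * C * (r + 2)\<^sup>2 * L ^ (4 * n)"
      proof (cases "z \<in> D")
        case True
        then have "pole_dist z = 0" using pole_dist_pos[of z] pole_dist_nonneg[of z] by simp
        then have "g r z = 0" using gle by simp
        then show ?thesis using C(1) L1 by simp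
      next
        case False
        have "cmod (deriv v z * g r z ^ 4) \<le> cmod (deriv v z) * (pole_dist z ^ 3 * L ^ (4 * n))"
          unfolding norm_mult norm_power
          using g4 d4 L1 by (intro mult_left_mono order_trans[OF g4] mult_right_mono) auto
        also have "\<dots> \<le> 16 * C * (r + 2)\<^sup>2 * L ^ (4 * n)"
          unfolding mult.assoc[symmetric] using v_deriv_bound[OF False C] z L1
          by (intro mult_right_mono) (auto simp: mult.assoc)
        finally show ?thesis .
      qed
      define X where "X = 16 * C * (r + 2)\<^sup>2 * L ^ (4 * n)"
      have X: "X \<ge> 0" using C(1) L1 by (simp add: X_def)
      have tot: "(1 + cmod a + cmod b) * X \<le> exp (A1 * exp (B1 * r))"
      proof -
        have "(1 + cmod a + cmod b) * X = C1 * (r + 2)\<^sup>2 * (2 * r + 3) ^ (4 * card (A r))"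
          by (simp only: X_def C1_def L_def n_def mult.assoc)
        then show ?thesis using total[of r] r by simp
      qed
      have "cmod (F z) \<le> X + cmod b * X"
        unfolding F_def using V V' norm_triangle_ineq4[of "deriv v z * g r z ^ 4" "b * (v z * g r z ^ 4)"]
          mult_left_mono[OF V, of "cmod b"] by (simp add: X_def norm_mult)
      also have "\<dots> \<le> (1 + cmod a + cmod b) * X" using X by (simp add: algebra_simps)
      finally have 1: "cmod (F z) \<le> exp (A1 * exp (B1 * r))" using tot by linarith
      have "cmod (z ^ \<kappa> * H z) \<le> cmod a * X"
        unfolding zH norm_mult[of a] using V by (intro mult_left_mono) (auto simp: X_def)
      also have "\<dots> \<le> (1 + cmod a + cmod b) * X" using X by (intro mult_right_mono) auto
      finally show ?thesis using 1 tot by linarith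
    qed
    show "\<exists>R F H. r < R \<and> F holomorphic_on ball 0 R \<and> H holomorphic_on ball 0 R \<and>
        cmod (a * H0 0) \<le> cmod (H 0) \<and> (\<forall>z\<in>ball 0 R. \<not> is_pole u z \<longrightarrow> u z * (z ^ \<kappa> * H z) = F z) \<and>
        (\<forall>z. cmod z = r \<longrightarrow> cmod (F z) \<le> exp (A1 * exp (B1 * r)) \<and>
              cmod (z ^ \<kappa> * H z) \<le> exp (A1 * exp (B1 * r)))"
      using r Fhol Hhol H_0 eq bd by (intro exI[of _ "r + 2"] exI[of _ F] exI[of _ H]) auto
  qed
qed

end

subsection \<open>First integrals and separation of the poles\<close>

context log_deriv_ode
begin

lemma constant_of_deriv_zero:
  fixes X g :: "complex \<Rightarrow> complex"
  assumes "\<And>z. \<not> is_pole l z \<Longrightarrow> (X has_field_derivative 0) (at z)"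
  obtains c where "\<And>z. \<not> is_pole l z \<Longrightarrow> X z = c"
proof -
  have cont: "continuous_on {z. \<not> is_pole l z} X"
    by (rule DERIV_continuous_on, rule has_field_derivative_at_within, rule assms, simp)
  have der: "\<forall>x\<in>{z. \<not> is_pole l z} - {}. (X has_field_derivative 0) (at x)"
    using assms by auto
  obtain c where "\<And>x. x \<in> {z. \<not> is_pole l z} \<Longrightarrow> X x = c"
    by (rule DERIV_zero_connected_constant[OF not_pole_connected not_pole_open finite.emptyI cont der]) (rule that)
  then show ?thesis using that by blast
qed

text \<open>\<open>E = (l - \<lambda>)\<^sup>2 + q0 - 2 v / (1 - 2 k)\<close> satisfies \<open>E' = (2 k l + \<tau>) E\<close>, so \<open>E\<^sup>2\<close> is a multiple of
  \<open>v powi (4 k) exp (2 \<tau> z)\<close>.\<close>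

lemma first_integral:
  fixes lam q0 \<tau> :: complex and m :: int
  assumes m: "4 * k = of_int m" "m \<le> 1" and k2: "1 - 2 * k \<noteq> 0"
    and tau: "\<tau> = lam * (1 - 2 * k)" "\<tau> = 2 * p + 2 * k * lam"
    and q0: "2 * q - 2 * lam * p = 2 * k * lam\<^sup>2 + 2 * k * q0 - 2 * lam * \<tau>" "- 2 * lam * q = \<tau> * (lam\<^sup>2 + q0)"
  obtains B K where "B \<ge> 0" "K \<ge> 0"
    "\<And>z. \<not> is_pole l z \<Longrightarrow> cmod (v z) \<ge> 1 \<Longrightarrow>
      cmod ((l z - lam)\<^sup>2 - 2 / (1 - 2 * k) * v z) \<le> B * exp (K * cmod z) * sqrt (cmod (v z))"
proof -
  define \<mu> where "\<mu> = 2 / (1 - 2 * k)"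
  have mu: "2 - \<mu> = - 2 * k * \<mu>" "2 * lam = \<tau> * \<mu>"
    using k2 unfolding \<mu>_def tau(1) by (simp_all add: field_simps)
  define E where "E = (\<lambda>z. (l z - lam)\<^sup>2 + q0 - \<mu> * v z)"
  have Ed: "(E has_field_derivative (2 * k * l z + \<tau>) * E z) (at z)" if z: "\<not> is_pole l z" for z
  proof -
    have "((\<lambda>z. (l z - lam) * (l z - lam) + q0 - \<mu> * v z) has_field_derivative
        2 * (l z - lam) * (v z + k * (l z)\<^sup>2 + p * l z + q) - \<mu> * (l z * v z)) (at z)"
      by (auto intro!: derivative_eq_intros l_deriv[OF z] v_deriv[OF z] simp: algebra_simps)
    \<comment> \<open>Comparison of the coefficients of xy, y, x^2, x and 1: the two identities for
      \<mu>, the second formula for \<tau> and the two hypotheses on \<open>q0\<close> each dispose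
      of one of them.\<close>
    moreover have "2 * (x - lam) * (y + k * x\<^sup>2 + p * x + q) - \<mu> * (x * y)
        = (2 * k * x + \<tau>) * ((x - lam)\<^sup>2 + q0 - \<mu> * y)" for x y
    proof -
      have "2 * (x - lam) * (y + k * x\<^sup>2 + p * x + q) - \<mu> * (x * y) - (2 * k * x + \<tau>) * ((x - lam)\<^sup>2 + q0 - \<mu> * y)
        = x * y * ((2 - \<mu>) + 2 * k * \<mu>) - y * (2 * lam - \<tau> * \<mu>)
          + x\<^sup>2 * ((2 * p + 2 * k * lam) - \<tau>)
          + x * ((2 * q - 2 * lam * p) - (2 * k * lam\<^sup>2 + 2 * k * q0 - 2 * lam * \<tau>))
          + (- 2 * lam * q - \<tau> * (lam\<^sup>2 + q0))"
        by algebra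
      also have "\<dots> = 0" using mu tau q0 by simp
      finally show ?thesis by simp
    qed
    ultimately show ?thesis unfolding E_def by (simp add: power2_eq_square)
  qed
  \<comment> \<open>\<open>v\<close> and \<open>E\<close> are Darboux polynomials with cofactors l
    and 2 k l + \<tau>, so this product has logarithmic derivative 0. The square is taken because 2k
    may be half an odd integer, whereas 4k is the integer \<open>m\<close>.\<close>
  define X where "X = (\<lambda>z. (E z)\<^sup>2 * v z powi (- m) * exp (- (2 * \<tau>) * z))"
  have "(X has_field_derivative 0) (at z)" if z: "\<not> is_pole l z" for z
  proof -
    have vz: "v z \<noteq> 0" using v_nz[OF z] .
    have 1: "((\<lambda>z. v z powi (- m)) has_field_derivative (- of_int m) * l z * v z powi (- m)) (at z)"
    proof -
      have "((\<lambda>z. v z powi (- m)) has_field_derivative of_int (- m) * v z powi (- m - 1) * (l z * v z)) (at z)"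
        by (rule DERIV_power_int[OF v_deriv[OF z] disjI2[OF vz], THEN DERIV_cong]) (simp add: algebra_simps)
      moreover have "v z powi (- m) = v z powi (- m - 1) * v z"
        using vz by (simp add: power_int_minus_mult)
      ultimately show ?thesis by (simp add: mult_ac)
    qed
    have 2: "((\<lambda>z. E z * E z) has_field_derivative 2 * (2 * k * l z + \<tau>) * (E z * E z)) (at z)"
      by (rule DERIV_cong[OF DERIV_mult[OF Ed[OF z] Ed[OF z]]]) (simp add: algebra_simps)
    have 3: "((\<lambda>z. exp (- (2 * \<tau>) * z)) has_field_derivative - (2 * \<tau>) * exp (- (2 * \<tau>) * z)) (at z)"
      by (auto intro!: derivative_eq_intros)
    have 0: "2 * (2 * k * l z + \<tau>) - of_int m * l z - 2 * \<tau> = 0"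
    proof -
      have "2 * (2 * k * l z + \<tau>) - of_int m * l z - 2 * \<tau> = (4 * k - of_int m) * l z"
        by (simp add: algebra_simps)
      then show ?thesis using m(1) by simp
    qed
    have "((\<lambda>z. E z * E z * v z powi (- m) * exp (- (2 * \<tau>) * z)) has_field_derivative
        (2 * (2 * k * l z + \<tau>) - of_int m * l z - 2 * \<tau>) * (E z * E z * v z powi (- m) * exp (- (2 * \<tau>) * z))) (at z)"
      by (rule DERIV_cong[OF DERIV_mult[OF DERIV_mult[OF 2 1] 3]]) (simp only: ring_distribs mult_ac, simp)
    then show ?thesis unfolding 0 X_def power2_eq_square mult_zero_left .
  qed
  then obtain c where c: "\<And>z. \<not> is_pole l z \<Longrightarrow> X z = c"
    using constant_of_deriv_zero by blast
  show ?thesis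
  proof (rule that[of "sqrt (cmod c) + cmod q0" "cmod \<tau>"])
    fix z assume z: "\<not> is_pole l z" and v1: "cmod (v z) \<ge> 1"
    have vz: "v z \<noteq> 0" using v_nz[OF z] .
    have "(E z)\<^sup>2 = c * v z powi m * exp (2 * \<tau> * z)"
    proof -
      have "X z * (v z powi m * exp (2 * \<tau> * z)) = (E z)\<^sup>2 * (v z powi (- m) * v z powi m) * (exp (- (2 * \<tau>) * z) * exp (2 * \<tau> * z))"
        by (simp add: X_def mult_ac)
      also have "\<dots> = (E z)\<^sup>2"
        using vz by (simp add: power_int_minus exp_add[symmetric])
      finally show ?thesis using c[OF z] by (simp add: mult.assoc)
    qed
    then have "(cmod (E z))\<^sup>2 = cmod c * cmod (v z powi m) * cmod (exp (2 * \<tau> * z))"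
      by (metis norm_mult norm_power)
    \<comment> \<open>This is where m <= 1 and |v| >= 1 enter: they bound |v|^m by |v|, so that |E|
      is of size sqrt|v|.\<close>
    also have "\<dots> \<le> cmod c * cmod (v z) * (exp (cmod \<tau> * cmod z))\<^sup>2"
    proof (intro mult_mono mult_nonneg_nonneg)
      have "cmod (v z powi m) = cmod (v z) powi m" by (simp add: norm_power_int)
      also have "\<dots> \<le> cmod (v z) powi 1" using v1 m(2) by (rule power_int_increasing[rotated])
      finally show "cmod (v z powi m) \<le> cmod (v z)" by simp
      have "cmod (exp (2 * \<tau> * z)) = exp (Re (2 * \<tau> * z))" by (rule norm_exp_eq_Re)
      also have "\<dots> \<le> exp (2 * (cmod \<tau> * cmod z))"
        using complex_Re_le_cmod[of "2 * \<tau> * z"] by (simp add: norm_mult)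
      finally show "cmod (exp (2 * \<tau> * z)) \<le> (exp (cmod \<tau> * cmod z))\<^sup>2" by (simp add: exp_double)
    qed auto
    finally have "cmod (E z) \<le> sqrt (cmod c * cmod (v z) * (exp (cmod \<tau> * cmod z))\<^sup>2)"
      by (rule real_le_rsqrt)
    then have 1: "cmod (E z) \<le> sqrt (cmod c) * exp (cmod \<tau> * cmod z) * sqrt (cmod (v z))"
      by (simp add: real_sqrt_mult mult_ac)
    have "1 \<le> exp (cmod \<tau> * cmod z) * sqrt (cmod (v z))"
      using mult_mono[of 1 "exp (cmod \<tau> * cmod z)" 1 "sqrt (cmod (v z))"] v1 by simp
    then have "cmod q0 * 1 \<le> cmod q0 * (exp (cmod \<tau> * cmod z) * sqrt (cmod (v z)))"
      by (rule mult_left_mono) simp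
    moreover have "(l z - lam)\<^sup>2 - 2 / (1 - 2 * k) * v z = E z - q0" by (simp add: E_def \<mu>_def)
    then have "cmod ((l z - lam)\<^sup>2 - 2 / (1 - 2 * k) * v z) \<le> cmod (E z) + cmod q0"
      by (metis norm_triangle_ineq4)
    ultimately show "cmod ((l z - lam)\<^sup>2 - 2 / (1 - 2 * k) * v z)
        \<le> (sqrt (cmod c) + cmod q0) * exp (cmod \<tau> * cmod z) * sqrt (cmod (v z))"
      using 1 by (simp add: algebra_simps)
  qed auto
qed

text \<open>The exceptional integrable case \<open>k = - 1\<close>, \<open>q = 6 p\<^sup>2 / 25\<close>: here
  \<open>F = 3 (v' - \<lambda> (v + q))\<^sup>2 - 2 (v + q)\<^sup>3\<close> satisfies \<open>F' = 3 \<lambda> F\<close>.\<close>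

lemma first_integral_cubic:
  fixes lam :: complex
  assumes k: "k = - 1" and lam: "5 * lam = 2 * p" and q: "2 * q = 3 * lam\<^sup>2"
  obtains B K where "B \<ge> 0" "K \<ge> 0"
    "\<And>z. \<not> is_pole l z \<Longrightarrow> cmod (v z) \<ge> 1 \<Longrightarrow>
      cmod ((l z - lam)\<^sup>2 - 2 / (1 - 2 * k) * v z) \<le> B * exp (K * cmod z) * sqrt (cmod (v z))"
proof -
  \<comment> \<open>For k = -1 the equation reads v'' = v^2 + p v' + q v. When \<open>lam\<close> is
    nonzero, writing v + q = exp(lam z) P(s) with s = (2/lam) exp(lam z / 2) turns F = c exp(3 lam
    z) into the Weierstrass equation 3 P'^2 = 2 P^3 + c.\<close>
  define F where "F = (\<lambda>z. 3 * (l z * v z - lam * (v z + q))\<^sup>2 - 2 * (v z + q) ^ 3)"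
  \<comment> \<open>Half of \<open>lam\<close> makes the coefficients integral, p = 5h and q = 6h^2,
    which keeps the polynomial identity below free of fractions.\<close>
  define h where "h = lam / 2"
  have lam_h: "lam = 2 * h" by (simp add: h_def)
  have p: "p = 5 * h" and q': "q = 6 * h\<^sup>2"
    using lam q by (simp_all add: lam_h field_simps)
  have Fd: "(F has_field_derivative 3 * lam * F z) (at z)" if z: "\<not> is_pole l z" for z
  proof -
    define x y where "x = l z" and "y = v z"
    define Y V where "Y = (\<lambda>z. l z * v z - lam * (v z + q))" and "V = (\<lambda>z. v z + q)"
    have "(Y has_field_derivative
       ((v z + k * (l z)\<^sup>2 + p * l z + q) * v z + (l z * v z) * l z) - lam * (l z * v z + 0)) (at z)"
      unfolding Y_def
      by (rule DERIV_diff[OF DERIV_mult[OF l_deriv[OF z] v_deriv[OF z]]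
            DERIV_cmult[OF DERIV_add[OF v_deriv[OF z] DERIV_const]]])
    moreover have "((v z + k * (l z)\<^sup>2 + p * l z + q) * v z + (l z * v z) * l z) - lam * (l z * v z + 0)
        = y * (V z + 3 * h * x)"
      by (simp add: k p lam_h x_def y_def V_def algebra_simps power2_eq_square)
    ultimately have 1: "(Y has_field_derivative y * (V z + 3 * h * x)) (at z)" by simp
    have 2: "(V has_field_derivative x * y) (at z)"
      unfolding V_def x_def y_def by (rule DERIV_cong[OF DERIV_add[OF v_deriv[OF z] DERIV_const]]) simp
    have F: "F = (\<lambda>z. 3 * (Y z * Y z) - 2 * (V z * (V z * V z)))"
      by (simp add: F_def Y_def V_def power2_eq_square power3_eq_cube mult.assoc)
    have "3 * (y1 * a + y1 * a) - 2 * (v1 * (b * b) + (v1 * b + v1 * b) * b) = 6 * a * y1 - 6 * b * b * v1"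
      for a b y1 v1 :: complex by (simp add: algebra_simps)
    note D = DERIV_cong[OF DERIV_diff[OF DERIV_cmult[OF DERIV_mult[OF 1 1]]
        DERIV_cmult[OF DERIV_mult[OF 2 DERIV_mult[OF 2 2]]]] this]
    have yV: "y = V z - 6 * h\<^sup>2" by (simp add: y_def V_def q')
    have Y: "Y z = x * y - 2 * h * V z" by (simp add: Y_def V_def x_def y_def lam_h)
    have poly: "6 * (x * (b - 6 * h\<^sup>2) - 2 * h * b) * ((b - 6 * h\<^sup>2) * (b + 3 * h * x)) - 6 * b * b * (x * (b - 6 * h\<^sup>2))
        = 6 * h * (3 * (x * (b - 6 * h\<^sup>2) - 2 * h * b)\<^sup>2 - 2 * b ^ 3)" for b
      by algebra
    have "6 * Y z * (y * (V z + 3 * h * x)) - 6 * V z * V z * (x * y) = 3 * lam * F z"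
      using poly[of "V z"] unfolding F Y yV lam_h by (simp add: power2_eq_square power3_eq_cube mult.assoc)
    then show ?thesis using D unfolding F by simp
  qed
  have "((\<lambda>z. F z * exp (- (3 * lam) * z)) has_field_derivative 0) (at z)" if z: "\<not> is_pole l z" for z
    by (auto intro!: derivative_eq_intros Fd[OF z])
  then obtain c where c: "\<And>z. \<not> is_pole l z \<Longrightarrow> F z * exp (- (3 * lam) * z) = c"
    using constant_of_deriv_zero by blast
  define Q0 where "Q0 = (1 + cmod q) ^ 3 * (1 + cmod c)"
  have Q0: "Q0 \<ge> 0" by (simp add: Q0_def)
  show ?thesis
  proof (rule that[of "5 * Q0 + 8 * Q0 * (cmod lam * cmod q) + (cmod lam * cmod q)\<^sup>2" "3 * cmod lam"])
    fix z assume z: "\<not> is_pole l z" and v1: "cmod (v z) \<ge> 1"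
    define x y where "x = l z" and "y = v z"
    have y: "cmod y \<ge> 1" "y \<noteq> 0" using v1 by (auto simp: y_def)
    define E where "E = exp (3 * cmod lam * cmod z)"
    have E: "E \<ge> 1" by (simp add: E_def)
    have Fz: "cmod (F z) \<le> cmod c * E"
    proof -
      have e: "exp (- (3 * lam) * z) * exp (3 * lam * z) = 1"
        by (simp flip: exp_add)
      have "F z = F z * exp (- (3 * lam) * z) * exp (3 * lam * z)"
        unfolding mult.assoc[of "F z"] e by simp
      then have "F z = c * exp (3 * lam * z)" unfolding c[OF z] .
      moreover have "cmod (exp (3 * lam * z)) \<le> E"
        unfolding norm_exp_eq_Re E_def using complex_Re_le_cmod[of "3 * lam * z"] by (simp add: norm_mult)
      ultimately show ?thesis by (simp add: norm_mult mult_left_mono)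
    qed
    \<comment> \<open>\<open>X\<close> is \<open>l - \<lambda>\<close> up to the term \<open>\<lambda> q / v\<close>.\<close>
    define X where "X = x - lam - lam * q / y"
    have Xy: "X * y = x * y - lam * (y + q)" using y by (simp add: X_def field_simps)
    have X2: "3 * X\<^sup>2 - 2 * y = (6 * q * y\<^sup>2 + 6 * q\<^sup>2 * y + 2 * q ^ 3 + F z) / y\<^sup>2"
    proof -
      have "3 * (X * y)\<^sup>2 = F z + 2 * (y + q) ^ 3"
        unfolding Xy by (simp add: F_def x_def y_def)
      also have "2 * (y + q) ^ 3 = 2 * (y * y\<^sup>2) + (6 * q * y\<^sup>2 + 6 * q\<^sup>2 * y + 2 * q ^ 3)"
        by (simp add: power2_eq_square power3_eq_cube algebra_simps)
      finally have "(3 * X\<^sup>2 - 2 * y) * y\<^sup>2 = 6 * q * y\<^sup>2 + 6 * q\<^sup>2 * y + 2 * q ^ 3 + F z"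
        by (simp add: power_mult_distrib algebra_simps)
      then show ?thesis using y by (simp add: eq_divide_eq)
    qed
    have yy: "1 \<le> cmod y * cmod y" using y(1) mult_mono[of 1 "cmod y" 1 "cmod y"] by simp
    have e1: "cmod (3 * X\<^sup>2 - 2 * y) \<le> 14 * (1 + cmod q) ^ 3 + cmod c * E"
    proof -
      have "3 * X\<^sup>2 - 2 * y = 6 * q + 6 * q\<^sup>2 / y + 2 * q ^ 3 / y\<^sup>2 + F z / y\<^sup>2"
        unfolding X2 using y by (simp add: field_simps power2_eq_square)
      moreover have "cmod (a + b + c + d) \<le> cmod a + cmod b + cmod c + cmod d" for a b c d
        using norm_triangle_ineq[of "a + b + c" d] norm_triangle_ineq[of "a + b" c] norm_triangle_ineq[of a b] by linarith
      ultimately have "cmod (3 * X\<^sup>2 - 2 * y) \<le> cmod (6 * q) + cmod (6 * q\<^sup>2 / y) + cmod (2 * q ^ 3 / y\<^sup>2) + cmod (F z / y\<^sup>2)"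
        by metis
      also have "\<dots> \<le> 6 * cmod q + 6 * (cmod q)\<^sup>2 + 2 * cmod q ^ 3 + cmod c * E"
      proof (intro add_mono)
        have dv: "cmod (a / y) \<le> cmod a" "cmod (a / y\<^sup>2) \<le> cmod a" for a
          using y yy mult_left_mono[of 1 "cmod y" "cmod a"] mult_left_mono[of 1 "cmod y * cmod y" "cmod a"]
          by (simp_all add: norm_divide norm_power power2_eq_square field_simps norm_mult)
        show "cmod (6 * q\<^sup>2 / y) \<le> 6 * (cmod q)\<^sup>2" using dv(1)[of "6 * q\<^sup>2"] by (simp add: norm_mult norm_power)
        show "cmod (2 * q ^ 3 / y\<^sup>2) \<le> 2 * cmod q ^ 3" using dv(2)[of "2 * q ^ 3"] by (simp add: norm_mult norm_power)
        show "cmod (F z / y\<^sup>2) \<le> cmod c * E" using dv(2)[of "F z"] Fz by linarith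
      qed (simp add: norm_mult)
      also have "6 * cmod q + 6 * (cmod q)\<^sup>2 + 2 * cmod q ^ 3 \<le> 14 * (1 + cmod q) ^ 3"
        by (simp add: power2_eq_square power3_eq_cube algebra_simps)
      finally show ?thesis by simp
    qed
    define Q where "Q = Q0 * E"
    have Q1: "1 \<le> Q" "cmod q \<le> Q" "14 * (1 + cmod q) ^ 3 + cmod c * E \<le> 15 * Q"
    proof -
      have a: "1 \<le> (1 + cmod q) ^ 3" by simp
      have b: "1 + cmod q \<le> (1 + cmod q) ^ 3" using power_increasing[of 1 3 "1 + cmod q"] by simp
      have "(1 + cmod q) ^ 3 * 1 \<le> (1 + cmod q) ^ 3 * ((1 + cmod c) * E)"
        using mult_mono[of 1 "1 + cmod c" 1 E] E by (intro mult_left_mono) auto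
      then have c: "(1 + cmod q) ^ 3 \<le> Q" by (simp add: Q_def Q0_def mult.assoc)
      have "1 * (cmod c * E) \<le> (1 + cmod q) ^ 3 * ((1 + cmod c) * E)"
        using a E by (intro mult_mono) auto
      then have d: "cmod c * E \<le> Q" by (simp add: Q_def Q0_def mult.assoc)
      show "1 \<le> Q" "cmod q \<le> Q" "14 * (1 + cmod q) ^ 3 + cmod c * E \<le> 15 * Q"
        using a b c d by linarith+
    qed
    define S where "S = sqrt (cmod y)"
    have S: "S \<ge> 1" "S\<^sup>2 = cmod y" using y(1) by (auto simp: S_def)
    have Xle: "cmod X \<le> 4 * Q * S"
    proof -
      have "3 * (cmod X)\<^sup>2 \<le> cmod (3 * X\<^sup>2 - 2 * y) + 2 * cmod y"
        using norm_triangle_ineq[of "3 * X\<^sup>2 - 2 * y" "2 * y"] by (simp add: norm_mult norm_power)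
      also have "\<dots> \<le> 15 * Q + 2 * S\<^sup>2" using e1 Q1 S by linarith
      also have "\<dots> \<le> 48 * (Q\<^sup>2 * S\<^sup>2)"
      proof -
        have Q2: "Q \<le> Q\<^sup>2" "1 \<le> Q\<^sup>2" using Q1 by (auto simp: power2_eq_square intro: order_trans[OF _ mult_mono[of 1 Q Q Q]])
        have S2: "1 \<le> S\<^sup>2" using S(2) y(1) by simp
        have "Q\<^sup>2 * 1 \<le> Q\<^sup>2 * S\<^sup>2" "1 * S\<^sup>2 \<le> Q\<^sup>2 * S\<^sup>2"
          by (rule mult_left_mono[OF S2], simp) (rule mult_right_mono[OF Q2(2)], simp)
        then show ?thesis using Q2 by linarith
      qed
      finally have "(cmod X)\<^sup>2 \<le> (4 * Q * S)\<^sup>2" by (simp add: power_mult_distrib)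
      then show ?thesis using Q1 S by (intro power2_le_imp_le[of "cmod X"]) auto
    qed
    define w where "w = lam * q / y"
    have w: "cmod w \<le> cmod lam * cmod q"
    proof -
      have "cmod w = cmod lam * cmod q / cmod y" by (simp add: w_def norm_divide norm_mult)
      also have "\<dots> \<le> cmod lam * cmod q / 1" using y by (intro divide_left_mono) auto
      finally show ?thesis by simp
    qed
    \<comment> \<open>For k = -1 the coefficient of \<open>v\<close> is 2/3, so the main part is (3
      X^2 - 2y)/3, which is bounded independently of |y|. The cross term pairs the bounded
      \<open>w\<close> with \<open>X\<close> of size sqrt|y|, whence the order of the error.\<close>
    have "(l z - lam)\<^sup>2 - 2 / (1 - 2 * k) * v z = (3 * X\<^sup>2 - 2 * y) / 3 + 2 * X * w + w\<^sup>2"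
    proof -
      have "l z - lam = X + w" by (simp add: X_def w_def x_def)
      then show ?thesis by (simp add: k y_def power2_eq_square algebra_simps add_divide_distrib diff_divide_distrib)
    qed
    moreover have "cmod (a + b + c) \<le> cmod a + cmod b + cmod c" for a b c
      using norm_triangle_ineq[of "a + b" c] norm_triangle_ineq[of a b] by linarith
    ultimately have "cmod ((l z - lam)\<^sup>2 - 2 / (1 - 2 * k) * v z) \<le> cmod ((3 * X\<^sup>2 - 2 * y) / 3) + cmod (2 * X * w) + cmod (w\<^sup>2)"
      by metis
    also have "\<dots> \<le> 15 * Q / 3 + 2 * (4 * Q * S) * (cmod lam * cmod q) + (cmod lam * cmod q)\<^sup>2"
    proof (intro add_mono)
      show "cmod ((3 * X\<^sup>2 - 2 * y) / 3) \<le> 15 * Q / 3" using e1 Q1 by (simp add: norm_divide)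
      show "cmod (2 * X * w) \<le> 2 * (4 * Q * S) * (cmod lam * cmod q)"
      proof -
        have "0 \<le> Q * S" using Q1(1) S(1) by simp
        then show ?thesis unfolding norm_mult using Xle w by (intro mult_mono) auto
      qed
      show "cmod (w\<^sup>2) \<le> (cmod lam * cmod q)\<^sup>2" using w by (simp add: norm_power power_mono)
    qed
    also have "\<dots> \<le> (5 * Q0 + 8 * Q0 * (cmod lam * cmod q) + (cmod lam * cmod q)\<^sup>2) * (E * S)"
    proof -
      define b where "b = cmod lam * cmod q"
      have b: "b \<ge> 0" by (simp add: b_def)
      have ES: "1 \<le> E * S" "E \<le> E * S"
        using mult_mono[of 1 E 1 S] mult_left_mono[of 1 S E] E S by auto
      have "Q0 * E \<le> Q0 * (E * S)" "b\<^sup>2 * 1 \<le> b\<^sup>2 * (E * S)"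
        by (rule mult_left_mono[OF ES(2) Q0]) (rule mult_left_mono[OF ES(1)], simp)
      then show ?thesis
        unfolding b_def[symmetric] Q_def by (simp add: algebra_simps)
    qed
    finally show "cmod ((l z - lam)\<^sup>2 - 2 / (1 - 2 * k) * v z)
        \<le> (5 * Q0 + 8 * Q0 * (cmod lam * cmod q) + (cmod lam * cmod q)\<^sup>2) * exp (3 * cmod lam * cmod z) * sqrt (cmod (v z))"
      by (simp add: E_def S_def y_def mult.assoc)
  qed (use Q0 in auto)
qed

end

section \<open>Lower bounds for the distances between poles\<close>

context log_deriv_ode
begin

text \<open>All poles share one Laurent expansion, so by the identity theorem \<open>v\<close> is
  invariant under the translation from any pole x to a fixed pole p0. A pole y close to x would be
  carried to a second pole inside a punctured disc around p0 on which \<open>v\<close> is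
  analytic.\<close>

lemma separation_nonresonant:
  assumes nonres: "\<And>n. n \<ge> 1 \<Longrightarrow> 2 - 4 * k \<noteq> of_nat n"
  obtains c where "c > 0" "\<And>x y. x \<in> D \<Longrightarrow> y \<in> D \<Longrightarrow> x \<noteq> y \<Longrightarrow> c \<le> dist x y"
proof (cases "D = {}")
  case True
  then show ?thesis using that[of 1] by auto
next
  case False
  then obtain p0 where p0: "is_pole v p0" by (auto simp: D_def)
  obtain r0 where r0: "r0 > 0" "v analytic_on ball p0 r0 - {p0}"
    using v_isolated[of p0] unfolding isolated_singularity_at_def by blast
  show ?thesis
  proof (rule that[OF r0(1)], rule ccontr)
    fix x y assume x: "x \<in> D" and y: "y \<in> D" and xy: "x \<noteq> y" "\<not> r0 \<le> dist x y"
    define \<omega> where "\<omega> = p0 - x"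
    obtain r s W where L: "r > 0" "s holomorphic_on ball 0 r" "W holomorphic_on ball 0 r" "s 0 = 0"
      "\<And>t. t \<in> ball 0 r - {0} \<Longrightarrow> v (p0 + t) = W t / t\<^sup>2"
      "\<And>t. t \<in> ball 0 r \<Longrightarrow> W t = (2 - 4 * k) + (4 * k - 1) * s t + t * deriv s t - k * (s t)\<^sup>2
        + 2 * p * t - p * t * s t - q * t\<^sup>2"
      "\<And>t. t \<in> ball 0 r \<Longrightarrow> t * deriv W t = s t * W t"
      using pole_local[OF p0] by metis
    obtain r' s' W' where L': "r' > 0" "s' holomorphic_on ball 0 r'" "W' holomorphic_on ball 0 r'" "s' 0 = 0"
      "\<And>t. t \<in> ball 0 r' - {0} \<Longrightarrow> v (x + t) = W' t / t\<^sup>2"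
      "\<And>t. t \<in> ball 0 r' \<Longrightarrow> W' t = (2 - 4 * k) + (4 * k - 1) * s' t + t * deriv s' t - k * (s' t)\<^sup>2
        + 2 * p * t - p * t * s' t - q * t\<^sup>2"
      "\<And>t. t \<in> ball 0 r' \<Longrightarrow> t * deriv W' t = s' t * W' t"
      using pole_local[of x] x by (metis D_def mem_Collect_eq)
    interpret a: laurent_coefficients k p q "fps_nth (fps_expansion s 0)" "fps_nth (fps_expansion W 0)"
      by (rule pole_coefficients[OF L(1-4,6,7)])
    have "laurent_coefficients k p q (fps_nth (fps_expansion s' 0)) (fps_nth (fps_expansion W' 0))"
      by (rule pole_coefficients[OF L'(1-4,6,7)])
    from a.determined[OF this nonres] have W_eq: "fps_expansion W 0 = fps_expansion W' 0"
      by (intro fps_ext) blast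
    have "W has_fps_expansion fps_expansion W 0" "W' has_fps_expansion fps_expansion W' 0"
      using L(1,3) L'(1,3)
      by (auto intro: has_fps_expansion_fps_expansion[of "ball 0 r"] has_fps_expansion_fps_expansion[of "ball 0 r'"])
    then have "eventually (\<lambda>t. W t = W' t) (nhds 0)"
      unfolding W_eq has_fps_expansion_def by (auto elim: eventually_elim2)
    then have "eventually (\<lambda>t. W t = W' t) (at 0)"
      by (simp add: eventually_nhds_conv_at)
    moreover have "eventually (\<lambda>t. t \<in> ball 0 (min r r') - {0}) (at (0::complex))"
      using L(1) L'(1) by (intro eventually_at_in_open) auto
    ultimately have ev0: "eventually (\<lambda>t. v (x + t) - v (x + t + \<omega>) = 0) (at 0)"
    proof eventually_elim
      case (elim t)
      then have e: "v (p0 + t) = W t / t\<^sup>2" "v (x + t) = W' t / t\<^sup>2"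
        using L(5)[of t] L'(5)[of t] by auto
      have "x + t + \<omega> = p0 + t" by (simp add: \<omega>_def)
      then show ?case using elim(1) by (simp only: e diff_self)
    qed
    have ev: "eventually (\<lambda>z. v z - v (z + \<omega>) = 0) (at x)"
      unfolding at_to_0[of x] eventually_filtermap using ev0 by (simp only: add.commute[of _ x])
    have "(\<lambda>z. v (z + \<omega>)) meromorphic_on UNIV"
      by (rule meromorphic_on_compose[OF v_mero]) (auto intro!: analytic_intros)
    then have "(\<lambda>z. v z - v (z + \<omega>)) meromorphic_on UNIV"
      by (intro meromorphic_intros v_mero)
    from meromorphic_imp_constant_or_avoid[OF this open_UNIV connected_UNIV, of 0]
    have "eventually (\<lambda>z. v z - v (z + \<omega>) = 0) (cosparse UNIV)"
    proof
      assume "eventually (\<lambda>z. v z - v (z + \<omega>) \<noteq> 0) (cosparse UNIV)"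
      then have "eventually (\<lambda>z. v z - v (z + \<omega>) \<noteq> 0) (at x)"
        by (rule eventually_cosparse_imp_eventually_at) auto
      with ev have "eventually (\<lambda>z. False) (at x)" by eventually_elim auto
      then show ?thesis by simp
    qed
    then have "eventually (\<lambda>z. v z - v (z + \<omega>) = 0) (at y)"
      by (rule eventually_cosparse_imp_eventually_at) auto
    then have evy: "eventually (\<lambda>z. v z = v (z + \<omega>)) (at y)" by eventually_elim simp
    have "is_pole (\<lambda>z. v (z + \<omega>)) y"
      using is_pole_cong[OF evy refl] y by (simp add: D_def)
    then have "is_pole v (y + \<omega>)"
      using is_pole_shift_iff[of v \<omega> y] by (simp add: o_def add.commute)
    moreover have "y + \<omega> \<in> ball p0 r0 - {p0}"
      using xy by (auto simp: \<omega>_def dist_norm norm_minus_commute)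
    then have "v analytic_on {y + \<omega>}"
      using analytic_on_subset[OF r0(2), of "{y + \<omega>}"] by simp
    ultimately show False using analytic_at_imp_no_pole by blast
  qed
qed

text \<open>1/v has a double zero at each pole, and since \<open>inverse 0 = 0\<close> the
  expression already has the value of its holomorphic extension there.\<close>

lemma inverse_v_at_pole:
  assumes x: "x \<in> D"
  shows "(\<lambda>z. inverse (v z)) analytic_on {x}" "((\<lambda>z. inverse (v z)) has_field_derivative 0) (at x)"
proof -
  obtain r W where L: "r > 0" "W holomorphic_on ball 0 r" "W 0 \<noteq> 0"
      "\<And>t. t \<in> ball 0 r - {0} \<Longrightarrow> \<not> is_pole l (x + t) \<and> v (x + t) = W t / t\<^sup>2"
    using pole_local[of x] x by (metis D_def mem_Collect_eq)
  have Wnz: "W t \<noteq> 0" if "t \<in> ball 0 r" for t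
    using L(3) L(4)[of t] v_nz[of "x + t"] that by (cases "t = 0") auto
  have "(\<lambda>t. inverse (W t)) holomorphic_on ball 0 r"
    by (intro holomorphic_intros L Wnz)
  then have Yhol: "(\<lambda>z. inverse (W (z - x))) holomorphic_on ball x r"
    by (rule holomorphic_on_compose_gen[of "\<lambda>z. z - x" "ball x r" "\<lambda>t. inverse (W t)" "ball 0 r", unfolded o_def, rotated])
       (auto intro!: holomorphic_intros simp: dist_norm norm_minus_commute)
  have eq: "inverse (v z) = (z - x)\<^sup>2 * inverse (W (z - x))" if z: "z \<in> ball x r" for z
  proof (cases "z = x")
    case True
    have "is_pole l x" using x pole_of_v_imp_pole_of_l by (simp add: D_def)
    then show ?thesis using True v_pole by simp
  next
    case False
    then have "z - x \<in> ball 0 r - {0}" using z by (auto simp: dist_norm norm_minus_commute)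
    then have "v z = W (z - x) / (z - x)\<^sup>2" using L(4)[of "z - x"] by simp
    then show ?thesis by (simp add: divide_inverse mult.commute)
  qed
  have "(\<lambda>z. (z - x)\<^sup>2 * inverse (W (z - x))) holomorphic_on ball x r"
    by (intro holomorphic_intros Yhol)
  then have "(\<lambda>z. inverse (v z)) holomorphic_on ball x r"
    by (rule holomorphic_transform) (simp add: eq)
  then show "(\<lambda>z. inverse (v z)) analytic_on {x}"
    using L(1) by (meson analytic_at centre_in_ball open_ball)
  have "((\<lambda>z. inverse (W (z - x))) has_field_derivative deriv (\<lambda>z. inverse (W (z - x))) x) (at x)"
    using L(1) by (intro holomorphic_derivI[OF Yhol]) auto
  moreover have "((\<lambda>z. (z - x)\<^sup>2) has_field_derivative 0) (at x)"
    by (auto intro!: derivative_eq_intros)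
  ultimately have "((\<lambda>z. (z - x)\<^sup>2 * inverse (W (z - x))) has_field_derivative 0) (at x)"
    using DERIV_mult by fastforce
  then show "((\<lambda>z. inverse (v z)) has_field_derivative 0) (at x)"
    by (rule has_field_derivative_transform_within_open[of _ _ _ "ball x r"]) (use L(1) eq in auto)
qed

text \<open>If l^2 is close to 2 v/(1 - 2k), the second derivative is close to (1 - k) 2/(1 - 2k) -
  1 = 1/(1 - 2k), a nonzero constant.\<close>

lemma inverse_v_deriv:
  assumes z: "\<not> is_pole l z"
  shows "((\<lambda>z. inverse (v z)) has_field_derivative - l z / v z) (at z)"
    "deriv (deriv (\<lambda>z. inverse (v z))) z = ((1 - k) * (l z)\<^sup>2 - p * l z - q) / v z - 1"
proof -
  have d: "((\<lambda>z. inverse (v z)) has_field_derivative - l z / v z) (at z)" if "\<not> is_pole l z" for z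
    using v_nz[OF that]
    by (auto intro!: derivative_eq_intros v_deriv[OF that] simp: field_simps)
  show "((\<lambda>z. inverse (v z)) has_field_derivative - l z / v z) (at z)" by (rule d[OF z])
  have "((\<lambda>w. - l w / v w) has_field_derivative
      (- (v z + k * (l z)\<^sup>2 + p * l z + q) * v z - (- l z) * (l z * v z)) / (v z * v z)) (at z)"
    using v_nz[OF z] by (intro DERIV_divide DERIV_minus l_deriv[OF z] v_deriv[OF z])
  then have "(deriv (\<lambda>z. inverse (v z)) has_field_derivative
      (- (v z + k * (l z)\<^sup>2 + p * l z + q) * v z - (- l z) * (l z * v z)) / (v z * v z)) (at z)"
    by (rule has_field_derivative_transform_within_open[OF _ not_pole_open])
       (use z DERIV_imp_deriv[OF d] in auto)
  then have "deriv (deriv (\<lambda>z. inverse (v z))) z =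
      (- (v z + k * (l z)\<^sup>2 + p * l z + q) * v z - (- l z) * (l z * v z)) / (v z * v z)"
    by (rule DERIV_imp_deriv)
  also have "\<dots> = ((1 - k) * (l z)\<^sup>2 - p * l z - q) / v z - 1"
    using v_nz[OF z] by (simp add: field_simps power2_eq_square)
  finally show "deriv (deriv (\<lambda>z. inverse (v z))) z = ((1 - k) * (l z)\<^sup>2 - p * l z - q) / v z - 1" .
qed

text \<open>Where \<open>v\<close> is large, \<open>1 / v\<close> has nearly constant second derivative; starting from a double zero
  it therefore stays close to a parabola and cannot vanish again nearby.\<close>

lemma separation_from_first_integral:
  fixes lam :: complex
  assumes k2: "1 - 2 * k \<noteq> 0" and BK: "B \<ge> 0" "K \<ge> 0"
    and H: "\<And>z. \<not> is_pole l z \<Longrightarrow> cmod (v z) \<ge> 1 \<Longrightarrow>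
      cmod ((l z - lam)\<^sup>2 - 2 / (1 - 2 * k) * v z) \<le> B * exp (K * cmod z) * sqrt (cmod (v z))"
  obtains c where "c > 0"
    "\<And>R x y. R \<ge> 0 \<Longrightarrow> x \<in> D \<Longrightarrow> y \<in> D \<Longrightarrow> x \<noteq> y \<Longrightarrow> cmod x \<le> R \<Longrightarrow> cmod y \<le> R
        \<Longrightarrow> c * exp (- K * R) \<le> dist x y"
proof -
  define \<mu> where "\<mu> = 2 / (1 - 2 * k)"
  have mu: "cmod \<mu> > 0" using k2 by (simp add: \<mu>_def)
  have mu_half: "(1 - k) * \<mu> - 1 = \<mu> / 2" using k2 by (simp add: \<mu>_def field_simps)
  define a0 where "a0 = 1 + cmod \<mu> + B"
  \<comment> \<open>Collects the error terms of G'' after \<open>l\<close> is estimated by a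
    multiple of exp(K|z|) sqrt|v| through the hypothesis; \<open>a0\<close> is the multiple for l -
    lam.\<close>
  define A0 where "A0 = cmod (1 - k) * (B + 2 * cmod lam * (cmod lam + a0) + (cmod lam)\<^sup>2)
      + cmod p * (cmod lam + a0) + cmod q + 1"
  have a0: "a0 \<ge> 1" using BK by (simp add: a0_def)
  have A0: "A0 \<ge> 1" using BK a0 by (simp add: A0_def)
  \<comment> \<open>Makes the deviation of G'' at most |\<mu>|/8, half of the coefficient |\<mu>|/4
    of the parabola.\<close>
  define \<eta>0 where "\<eta>0 = min 1 (cmod \<mu> / (8 * A0))"
  have eta0: "\<eta>0 > 0" "\<eta>0 \<le> 1" "A0 * \<eta>0 \<le> cmod \<mu> / 8"
  proof -
    show "\<eta>0 > 0" "\<eta>0 \<le> 1" using mu A0 by (auto simp: \<eta>0_def)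
    have "A0 * \<eta>0 \<le> A0 * (cmod \<mu> / (8 * A0))" using A0 by (intro mult_left_mono) (auto simp: \<eta>0_def)
    then show "A0 * \<eta>0 \<le> cmod \<mu> / 8" using A0 by simp
  qed
  define G where "G = (\<lambda>z. inverse (v z))"
  have G2: "cmod (deriv (deriv G) z - \<mu> / 2) \<le> A0 * exp (K * cmod z) / sqrt (cmod (v z))"
    if z: "\<not> is_pole l z" and v1: "cmod (v z) \<ge> 1" for z
  proof -
    define S where "S = sqrt (cmod (v z))"
    have S: "S \<ge> 1" "S * S = cmod (v z)" using v1 by (auto simp: S_def)
    define E where "E = exp (K * cmod z)"
    have E: "E \<ge> 1" using BK by (simp add: E_def)
    have h: "cmod ((l z - lam)\<^sup>2 - \<mu> * v z) \<le> B * E * S"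
      using H[OF z v1] by (simp add: \<mu>_def E_def S_def)
    have ESS: "S \<le> S * S" "E * S \<le> E * (S * S)" "S * S \<le> E * (S * S)" "S \<le> E * S"
      using S E mult_left_mono[of 1 S S] mult_left_mono[of S "S * S" E] mult_right_mono[of 1 E "S * S"]
        mult_right_mono[of 1 E S] by auto
    have l1: "cmod (l z - lam) \<le> a0 * E * S"
    proof (rule power2_le_imp_le)
      have "(cmod (l z - lam))\<^sup>2 \<le> cmod ((l z - lam)\<^sup>2 - \<mu> * v z) + cmod (\<mu> * v z)"
        using norm_triangle_ineq[of "(l z - lam)\<^sup>2 - \<mu> * v z" "\<mu> * v z"] by (simp add: norm_power)
      also have "\<dots> \<le> B * (E * (S * S)) + cmod \<mu> * (E * (S * S))"
      proof (rule add_mono)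
        have "B * (E * S) \<le> B * (E * (S * S))" using ESS(2) BK(1) by (rule mult_left_mono)
        then show "cmod ((l z - lam)\<^sup>2 - \<mu> * v z) \<le> B * (E * (S * S))" using h by (simp add: mult.assoc)
        show "cmod (\<mu> * v z) \<le> cmod \<mu> * (E * (S * S))"
          unfolding norm_mult S(2)[symmetric] using ESS(3) by (rule mult_left_mono) simp
      qed
      also have "\<dots> \<le> a0 * (E * (S * S))"
      proof -
        have "0 \<le> E * (S * S)" using E S by auto
        then show ?thesis by (simp add: a0_def algebra_simps)
      qed
      also have "\<dots> \<le> (a0 * a0) * ((E * E) * (S * S))"
      proof (intro mult_mono)
        show "a0 \<le> a0 * a0" "E \<le> E * E"
          using a0 E mult_left_mono[of 1 a0 a0] mult_left_mono[of 1 E E] by auto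
      qed (use a0 E S in auto)
      finally show "(cmod (l z - lam))\<^sup>2 \<le> (a0 * E * S)\<^sup>2" by (simp add: power2_eq_square mult_ac)
    qed (use a0 E S in auto)
    have ES1: "1 \<le> E * S" using mult_mono[of 1 E 1 S] E S by simp
    have l2: "cmod (l z) \<le> (cmod lam + a0) * (E * S)"
    proof -
      have "cmod (l z) \<le> cmod lam * 1 + a0 * (E * S)"
        using l1 norm_triangle_ineq[of "l z - lam" lam] by (simp add: mult.assoc)
      also have "\<dots> \<le> cmod lam * (E * S) + a0 * (E * S)"
        using ES1 by (intro add_right_mono mult_left_mono) auto
      finally show ?thesis by (simp add: algebra_simps)
    qed
    have l3: "cmod ((l z)\<^sup>2 - \<mu> * v z) \<le> (B + 2 * cmod lam * (cmod lam + a0) + (cmod lam)\<^sup>2) * (E * S)"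
    proof -
      have "(l z)\<^sup>2 - \<mu> * v z = ((l z - lam)\<^sup>2 - \<mu> * v z) + 2 * lam * l z - lam\<^sup>2"
        by (simp add: power2_eq_square algebra_simps)
      then have eq: "cmod ((l z)\<^sup>2 - \<mu> * v z) = cmod (((l z - lam)\<^sup>2 - \<mu> * v z) + 2 * lam * l z - lam\<^sup>2)"
        by (rule arg_cong)
      have "cmod ((l z)\<^sup>2 - \<mu> * v z) \<le> cmod ((l z - lam)\<^sup>2 - \<mu> * v z) + cmod (2 * lam * l z) + cmod (lam\<^sup>2)"
        unfolding eq using norm_triangle_ineq4[of "((l z - lam)\<^sup>2 - \<mu> * v z) + 2 * lam * l z" "lam\<^sup>2"]
          norm_triangle_ineq[of "(l z - lam)\<^sup>2 - \<mu> * v z" "2 * lam * l z"] by linarith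
      also have "\<dots> \<le> B * (E * S) + 2 * cmod lam * ((cmod lam + a0) * (E * S)) + (cmod lam)\<^sup>2 * (E * S)"
      proof (intro add_mono)
        show "cmod ((l z - lam)\<^sup>2 - \<mu> * v z) \<le> B * (E * S)" using h by (simp add: mult.assoc)
        show "cmod (2 * lam * l z) \<le> 2 * cmod lam * ((cmod lam + a0) * (E * S))"
          using mult_left_mono[OF l2, of "2 * cmod lam"] by (simp add: norm_mult)
        show "cmod (lam\<^sup>2) \<le> (cmod lam)\<^sup>2 * (E * S)"
          using mult_left_mono[OF ES1, of "(cmod lam)\<^sup>2"] by (simp add: norm_power)
      qed
      finally show ?thesis by (simp add: algebra_simps)
    qed
    have "deriv (deriv G) z - \<mu> / 2 = ((1 - k) * ((l z)\<^sup>2 - \<mu> * v z) - p * l z - q) / v z"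
    proof -
      have "deriv (deriv G) z - ((1 - k) * \<mu> - 1) = ((1 - k) * ((l z)\<^sup>2 - \<mu> * v z) - p * l z - q) / v z"
        unfolding G_def inverse_v_deriv(2)[OF z] using v_nz[OF z] by (simp add: field_simps)
      then show ?thesis unfolding mu_half .
    qed
    then have "cmod (deriv (deriv G) z - \<mu> / 2) = cmod ((1 - k) * ((l z)\<^sup>2 - \<mu> * v z) - p * l z - q) / (S * S)"
      by (simp add: norm_divide S)
    also have "\<dots> \<le> (A0 * (E * S)) / (S * S)"
    proof (rule divide_right_mono)
      have "cmod ((1 - k) * ((l z)\<^sup>2 - \<mu> * v z) - p * l z - q)
          \<le> cmod (1 - k) * cmod ((l z)\<^sup>2 - \<mu> * v z) + cmod p * cmod (l z) + cmod q"
        using norm_triangle_ineq4[of "(1 - k) * ((l z)\<^sup>2 - \<mu> * v z) - p * l z" q]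
          norm_triangle_ineq4[of "(1 - k) * ((l z)\<^sup>2 - \<mu> * v z)" "p * l z"] by (simp add: norm_mult)
      also have "\<dots> \<le> cmod (1 - k) * ((B + 2 * cmod lam * (cmod lam + a0) + (cmod lam)\<^sup>2) * (E * S))
          + cmod p * ((cmod lam + a0) * (E * S)) + (cmod q + 1) * (E * S)"
      proof (intro add_mono mult_left_mono l2 l3)
        have "cmod q \<le> (cmod q + 1) * 1" by simp
        also have "\<dots> \<le> (cmod q + 1) * (E * S)" using ES1 by (intro mult_left_mono) auto
        finally show "cmod q \<le> (cmod q + 1) * (E * S)" .
      qed auto
      also have "\<dots> = A0 * (E * S)" by (simp add: A0_def algebra_simps)
      finally show "cmod ((1 - k) * ((l z)\<^sup>2 - \<mu> * v z) - p * l z - q) \<le> A0 * (E * S)" .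
    qed (use S in auto)
    also have "\<dots> = A0 * E / S" using S(1) by simp
    finally show ?thesis by (simp add: E_def S_def)
  qed
  \<comment> \<open>The factor exp(-K) appears because the estimates are used in |z| < R + 1. The
    denominator ensures that |\<mu>| d^2 is at most \<eta>^2 / 2 for every d below the assumed
    distance.\<close>
  define \<delta>0 where "\<delta>0 = \<eta>0 * exp (- K) / (2 * (1 + cmod \<mu>))"
  show ?thesis
  proof (rule that[of \<delta>0])
    have "0 < 2 * (1 + cmod \<mu>)" using mu by (intro mult_pos_pos add_pos_pos) auto
    then show "\<delta>0 > 0" using eta0(1) unfolding \<delta>0_def by (intro divide_pos_pos mult_pos_pos) auto
    fix R x y assume R: "R \<ge> 0" and x: "x \<in> D" and y: "y \<in> D" and xy: "x \<noteq> y" and xR: "cmod x \<le> R" "cmod y \<le> R"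
    show "\<delta>0 * exp (- K * R) \<le> dist x y"
    proof (rule ccontr)
      assume "\<not> \<delta>0 * exp (- K * R) \<le> dist x y"
      define \<eta> where "\<eta> = \<eta>0 * exp (- K * (R + 1))"
      have eta: "\<eta> > 0" using eta0(1) by (simp add: \<eta>_def)
      have close: "dist x y < \<eta> / (2 * (1 + cmod \<mu>))"
      proof -
        have "exp (- K) * exp (- K * R) = exp (- K * (R + 1))" by (simp add: algebra_simps flip: exp_add)
        then have "\<delta>0 * exp (- K * R) = \<eta> / (2 * (1 + cmod \<mu>))" by (simp add: \<delta>0_def \<eta>_def)
        then show ?thesis using \<open>\<not> \<delta>0 * exp (- K * R) \<le> dist x y\<close> by simp
      qed
      have eta1: "\<eta> \<le> 1"
        using eta0 BK R mult_mono[of \<eta>0 1 "exp (- K * (R + 1))" 1] by (simp add: \<eta>_def)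
      \<comment> \<open>The region |1/v| < \<eta>^2, on which G'' is nearly constant. The poles are
        added explicitly because \<open>v\<close> has the dummy value 0 there.\<close>
      define U where "U = {z. z \<in> D \<or> (\<not> is_pole l z \<and> 1 / \<eta>\<^sup>2 < cmod (v z))}"
      have U_near: "eventually (\<lambda>w. \<not> is_pole l w \<and> 1 / \<eta>\<^sup>2 < cmod (v w)) (at z)" if z: "z \<in> U" for z
      proof (cases "z \<in> D")
        case True
        then have "filterlim v at_infinity (at z)" by (simp add: D_def is_pole_def)
        then have "eventually (\<lambda>w. 1 / \<eta>\<^sup>2 + 1 \<le> cmod (v w)) (at z)"
          using filterlim_at_infinity[of 0 v "at z"] eta by (auto simp: add_pos_pos)
        with ev_not_pole[of z] show ?thesis by eventually_elim auto
      next
        case False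
        then have z': "\<not> is_pole l z" "1 / \<eta>\<^sup>2 < cmod (v z)" using z by (auto simp: U_def)
        have "v \<midarrow>z\<rightarrow> v z" using analytic_at_imp_isCont[OF v_analytic[OF z'(1)]] by (simp add: isCont_def)
        then have "eventually (\<lambda>w. 1 / \<eta>\<^sup>2 < cmod (v w)) (at z)"
          using order_tendstoD(1)[OF tendsto_norm z'(2)] by blast
        with ev_not_pole[of z] show ?thesis by eventually_elim auto
      qed
      have "open U"
      proof (subst open_subopen, rule ballI)
        fix z assume z: "z \<in> U"
        have "eventually (\<lambda>w. w \<in> U) (at z)"
          using U_near[OF z] by eventually_elim (simp add: U_def)
        then have "eventually (\<lambda>w. w \<in> U) (nhds z)"
          using z by (simp add: eventually_nhds_conv_at)
        then show "\<exists>T. open T \<and> z \<in> T \<and> T \<subseteq> U" unfolding eventually_nhds by blast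
      qed
      have Ghol: "G holomorphic_on U"
      proof -
        have "G analytic_on {z}" if "z \<in> U" for z
        proof (cases "z \<in> D")
          case False
          then have "\<not> is_pole l z" using that by (simp add: U_def)
          then show ?thesis unfolding G_def using v_nz by (intro analytic_intros v_analytic) auto
        qed (simp add: G_def inverse_v_at_pole)
        then show ?thesis using analytic_on_analytic_at analytic_imp_holomorphic by blast
      qed
      define \<epsilon> where "\<epsilon> = cmod \<mu> / 8"
      have G2': "cmod (deriv (deriv G) z - \<mu> / 2) \<le> \<epsilon>"
        if z: "\<not> is_pole l z" "1 / \<eta>\<^sup>2 < cmod (v z)" "cmod z < R + 1" for z
      proof -
        have "1 \<le> 1 / \<eta>\<^sup>2" using eta eta1 by (simp add: power_le_one)
        then have v1: "cmod (v z) \<ge> 1" using z by linarith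
        have "1 / \<eta> \<le> sqrt (cmod (v z))"
          using z(2) eta by (intro real_le_rsqrt) (simp add: power_divide)
        then have s: "1 / sqrt (cmod (v z)) \<le> \<eta>"
        proof -
          have "0 < cmod (v z)" using v1 by linarith
          then have "0 < sqrt (cmod (v z))" by simp
          then show ?thesis using \<open>1 / \<eta> \<le> sqrt (cmod (v z))\<close> eta by (simp add: field_simps)
        qed
        have "cmod (deriv (deriv G) z - \<mu> / 2) \<le> A0 * exp (K * cmod z) * (1 / sqrt (cmod (v z)))"
          using G2[OF z(1) v1] by simp
        also have "\<dots> \<le> A0 * exp (K * (R + 1)) * \<eta>"
          using A0 BK z s eta by (intro mult_mono) (auto intro: mult_left_mono)
        also have "\<dots> = A0 * \<eta>0 * (exp (K * (R + 1)) * exp (- K * (R + 1)))"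
          by (simp add: \<eta>_def)
        also have "\<dots> = A0 * \<eta>0" by (simp flip: exp_add)
        finally show ?thesis using eta0(3) by (simp add: \<epsilon>_def)
      qed
      \<comment> \<open>The previous estimate concerns points where \<open>l\<close> is finite; at
        the poles it follows by continuity of G''.\<close>
      have G2'': "cmod (deriv (deriv G) z - \<mu> / 2) \<le> \<epsilon>" if z: "z \<in> U" "cmod z < R + 1" for z
      proof -
        have "deriv (deriv G) holomorphic_on U" by (intro holomorphic_deriv Ghol \<open>open U\<close>)
        then have "isCont (deriv (deriv G)) z"
          using holomorphic_on_imp_continuous_on \<open>open U\<close> z(1) continuous_on_eq_continuous_at by blast
        then have lim: "((\<lambda>w. cmod (deriv (deriv G) w - \<mu> / 2)) \<longlongrightarrow> cmod (deriv (deriv G) z - \<mu> / 2)) (at z)"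
          by (intro tendsto_intros) (simp add: isCont_def)
        have "eventually (\<lambda>w. w \<in> ball 0 (R + 1)) (at z)"
          using z(2) by (intro eventually_at_in_open') auto
        with U_near[OF z(1)] have "eventually (\<lambda>w. cmod (deriv (deriv G) w - \<mu> / 2) \<le> \<epsilon>) (at z)"
          by eventually_elim (use G2' in auto)
        then show ?thesis by (rule tendsto_upperbound[OF lim]) simp
      qed
      \<comment> \<open>Two integrations along the segment from \<open>x\<close>, where both G and
        G' vanish.\<close>
      have parabola: "cmod (G z - \<mu> / 4 * (z - x)\<^sup>2) \<le> \<epsilon> * (cmod (z - x))\<^sup>2"
        if seg: "closed_segment x z \<subseteq> U" and zx: "dist x z \<le> dist x y" for z
      proof -
        define C where "C = closed_segment x z"
        have near: "cmod (w - x) \<le> cmod (z - x)" if "w \<in> C" for w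
          using segment_bound(1)[of w x z] that by (simp add: C_def norm_minus_commute)
        have d1: "dist x y < 1"
        proof -
          have "\<eta> / (2 * (1 + cmod \<mu>)) \<le> 1 / 1" using eta eta1 mu by (intro frac_le) auto
          then show ?thesis using close by simp
        qed
        have inR: "cmod w < R + 1" if "w \<in> C" for w
        proof -
          have "cmod w \<le> cmod x + cmod (w - x)" by (metis add.commute diff_add_cancel norm_triangle_ineq)
          then show ?thesis using near[OF that] zx d1 xR by (simp add: dist_norm norm_minus_commute)
        qed
        have CU: "C \<subseteq> U" using seg by (simp add: C_def)
        have conv: "convex C" "x \<in> C" "z \<in> C" by (auto simp: C_def)
        have Gd: "(G has_field_derivative deriv G w) (at w within T)"
          and Gdd: "(deriv G has_field_derivative deriv (deriv G) w) (at w within T)" if "w \<in> C" for w T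
          using holomorphic_derivI[OF Ghol \<open>open U\<close>, of w] holomorphic_derivI[OF holomorphic_deriv[OF Ghol \<open>open U\<close>] \<open>open U\<close>, of w]
            CU that by (auto intro: has_field_derivative_at_within)
        have G'x: "deriv G x = 0" "G x = 0"
          using DERIV_imp_deriv[OF inverse_v_at_pole(2)[OF x]] v_pole pole_of_v_imp_pole_of_l x
          by (auto simp: G_def D_def)
        have first: "cmod (deriv G w - \<mu> / 2 * (w - x)) \<le> \<epsilon> * cmod (w - x)" if w: "w \<in> C" for w
        proof -
          have "norm ((deriv G w - \<mu> / 2 * (w - x)) - (deriv G x - \<mu> / 2 * (x - x))) \<le> \<epsilon> * norm (w - x)"
          proof (rule field_differentiable_bound[of C "\<lambda>w. deriv G w - \<mu> / 2 * (w - x)" "\<lambda>w. deriv (deriv G) w - \<mu> / 2"])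
            show "((\<lambda>w. deriv G w - \<mu> / 2 * (w - x)) has_field_derivative deriv (deriv G) w - \<mu> / 2) (at w within C)"
              if "w \<in> C" for w
              by (auto intro!: derivative_eq_intros Gdd[OF that])
            show "norm (deriv (deriv G) w - \<mu> / 2) \<le> \<epsilon>" if "w \<in> C" for w
              using G2'' inR[OF that] CU that by auto
          qed (use conv w in auto)
          then show ?thesis by (simp add: G'x)
        qed
        have "norm ((G z - \<mu> / 4 * (z - x)\<^sup>2) - (G x - \<mu> / 4 * (x - x)\<^sup>2)) \<le> (\<epsilon> * cmod (z - x)) * norm (z - x)"
        proof (rule field_differentiable_bound[of C "\<lambda>w. G w - \<mu> / 4 * (w - x)\<^sup>2" "\<lambda>w. deriv G w - \<mu> / 2 * (w - x)"])
          show "((\<lambda>w. G w - \<mu> / 4 * (w - x)\<^sup>2) has_field_derivative deriv G w - \<mu> / 2 * (w - x)) (at w within C)"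
            if "w \<in> C" for w
            by (auto intro!: derivative_eq_intros Gd[OF that])
          show "norm (deriv G w - \<mu> / 2 * (w - x)) \<le> \<epsilon> * cmod (z - x)" if "w \<in> C" for w
          proof -
            have "\<epsilon> * cmod (w - x) \<le> \<epsilon> * cmod (z - x)"
              using near[OF that] by (intro mult_left_mono) (auto simp: \<epsilon>_def)
            then show ?thesis using first[OF that] by linarith
          qed
        qed (use conv in auto)
        then show ?thesis by (simp add: G'x power2_eq_square)
      qed
      have small: "cmod (G z) \<le> \<eta>\<^sup>2 / 2" if seg: "closed_segment x z \<subseteq> U" and zx: "dist x z \<le> dist x y" for z
      proof -
        define d where "d = cmod (z - x)"
        have d: "0 \<le> d" "d \<le> \<eta> / (2 * (1 + cmod \<mu>))"
          using zx close by (auto simp: d_def dist_norm norm_minus_commute)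
        have "cmod (G z) \<le> cmod (G z - \<mu> / 4 * (z - x)\<^sup>2) + cmod (\<mu> / 4 * (z - x)\<^sup>2)"
          by (metis add.commute norm_triangle_sub)
        also have "\<dots> \<le> \<epsilon> * d\<^sup>2 + cmod \<mu> / 4 * d\<^sup>2"
          using parabola[OF seg zx] by (simp add: d_def norm_mult norm_divide norm_power)
        also have "\<dots> \<le> cmod \<mu> * d\<^sup>2" by (simp add: \<epsilon>_def)
        also have "\<dots> \<le> (1 + cmod \<mu>) * (\<eta> / (2 * (1 + cmod \<mu>)))\<^sup>2"
          using d by (intro mult_mono power_mono) auto
        also have "\<dots> = \<eta>\<^sup>2 / (4 * (1 + cmod \<mu>))"
        proof -
          have "a * (\<eta> / (2 * a))\<^sup>2 = \<eta>\<^sup>2 / (4 * a)" if "a \<noteq> 0" for a :: real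
            using that by (simp add: field_simps power2_eq_square)
          then show ?thesis using mu by (metis add_pos_pos less_irrefl zero_less_one)
        qed
        also have "\<dots> \<le> \<eta>\<^sup>2 / 2" using mu by (intro divide_left_mono mult_pos_pos add_pos_pos) auto
        finally show ?thesis .
      qed
      \<comment> \<open>A continuity argument: let z be the point outside \<open>U\<close> nearest
        to \<open>x\<close>. Before z the parabola gives |G| <= \<eta>^2 / 2, that is |v| >= 2 /
        \<eta>^2; the limit passes this to z and puts z back into \<open>U\<close>.\<close>
      have segU: "closed_segment x y \<subseteq> U"
      proof (rule ccontr)
        assume "\<not> closed_segment x y \<subseteq> U"
        then have ne: "closed_segment x y - U \<noteq> {}" by blast
        have "closed (closed_segment x y - U)" using \<open>open U\<close> by (intro closed_Diff) auto
        from distance_attains_inf[OF this ne, of x] obtain z where z: "z \<in> closed_segment x y - U"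
          "\<And>w. w \<in> closed_segment x y - U \<Longrightarrow> dist x z \<le> dist x w" by blast
        have zU: "z \<notin> U" and zxy: "z \<in> closed_segment x y" using z by auto
        have zx: "z \<noteq> x" using zU x by (auto simp: U_def)
        have dzy: "dist x z \<le> dist x y"
          using segment_bound(1)[OF zxy] by (simp add: dist_norm norm_minus_commute)
        have big: "2 / \<eta>\<^sup>2 \<le> cmod (v (z + of_real t * (x - z)))" if t: "0 < t" "t < 1" for t
        proof -
          define w where "w = z + of_real t * (x - z)"
          have dw: "dist x w = (1 - t) * dist x z"
          proof -
            have "x - w = of_real (1 - t) * (x - z)" by (simp add: w_def algebra_simps)
            then have "dist x w = \<bar>1 - t\<bar> * dist x z"
              by (simp only: dist_norm norm_mult norm_of_real)
            then show ?thesis using t by simp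
          qed
          have wz: "w \<in> closed_segment x z"
            unfolding in_segment using t
            by (intro exI[of _ "1 - t"]) (auto simp: w_def scaleR_conv_of_real algebra_simps)
          have "dist x z > 0" using zx by simp
          then have lt: "dist x w < dist x z" using dw t mult_strict_right_mono[of "1 - t" 1 "dist x z"] by simp
          have seg: "closed_segment x w \<subseteq> U"
          proof
            fix a assume a: "a \<in> closed_segment x w"
            have "a \<in> closed_segment x y"
              using a wz zxy by (meson convex_closed_segment convex_contains_segment ends_in_segment(1) subsetD)
            moreover have "dist x a < dist x z"
              using segment_bound(1)[OF a] lt by (simp add: dist_norm norm_minus_commute)
            ultimately show "a \<in> U" using z(2)[of a] by force
          qed
          have "w \<noteq> x" using dw t zx by auto
          have le: "dist x w \<le> dist x y" using lt dzy by linarith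
          have Gw: "G w \<noteq> 0"
          proof
            assume "G w = 0"
            then have "cmod \<mu> / 4 * (cmod (w - x))\<^sup>2 \<le> \<epsilon> * (cmod (w - x))\<^sup>2"
              using parabola[OF seg le] by (simp add: norm_mult norm_divide norm_power)
            then show False using \<open>w \<noteq> x\<close> mu by (simp add: \<epsilon>_def mult_le_0_iff)
          qed
          then have "cmod (v w) = 1 / cmod (G w)" by (simp only: G_def norm_inverse inverse_inverse_eq divide_inverse mult_1_left)
          moreover have "1 / (\<eta>\<^sup>2 / 2) \<le> 1 / cmod (G w)"
            using small[OF seg le] Gw eta by (intro divide_left_mono) auto
          ultimately show ?thesis by (simp add: w_def)
        qed
        have "\<not> is_pole v z" using zU by (auto simp: U_def D_def)
        then have "isCont v z"
          using nicely_meromorphic_on_imp_analytic_at[OF v_nice] analytic_at_imp_isCont by blast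
        have lim: "((\<lambda>t::real. cmod (v (z + of_real t * (x - z)))) \<longlongrightarrow> cmod (v z)) (at_right 0)"
        proof (intro tendsto_norm isCont_tendsto_compose[OF \<open>isCont v z\<close>])
          have "((\<lambda>t::real. z + of_real t * (x - z)) \<longlongrightarrow> z + of_real 0 * (x - z)) (at_right 0)"
            by (intro tendsto_intros)
          then show "((\<lambda>t::real. z + of_real t * (x - z)) \<longlongrightarrow> z) (at_right 0)" by simp
        qed
        have "eventually (\<lambda>t::real. t \<in> {0<..<1}) (at_right 0)"
          by (rule eventually_at_right_real) simp
        then have "eventually (\<lambda>t::real. 2 / \<eta>\<^sup>2 \<le> cmod (v (z + of_real t * (x - z)))) (at_right 0)"
          by eventually_elim (use big in auto)
        then have vz: "2 / \<eta>\<^sup>2 \<le> cmod (v z)"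
          by (rule tendsto_lowerbound[OF lim]) simp
        moreover have "0 < 1 / \<eta>\<^sup>2" using eta by simp
        ultimately have "1 / \<eta>\<^sup>2 < cmod (v z)" by (simp add: field_simps)
        moreover from this have "\<not> is_pole l z" using v_pole[of z] eta by auto
        ultimately show False using zU by (simp add: U_def)
      qed
      have "G y = 0" using y pole_of_v_imp_pole_of_l v_pole by (simp add: G_def D_def)
      \<comment> \<open>A second zero of G on the segment would require |\<mu>|/4 <=
        |\<mu>|/8.\<close>
      then have "cmod \<mu> / 4 * (cmod (y - x))\<^sup>2 \<le> \<epsilon> * (cmod (y - x))\<^sup>2"
        using parabola[OF segU] by (simp add: norm_mult norm_divide norm_power)
      then show False using xy mu by (simp add: \<epsilon>_def mult_le_0_iff)
    qed
  qed
qed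

end

section \<open>From the resonance relations to a first integral\<close>

context log_deriv_ode
begin

lemma first_integral_of_resonant_pole:
  assumes D: "D \<noteq> {}" and n: "2 - 4 * k = of_nat n" "n \<in> {1, 2, 3, 4, 6}"
  shows "\<exists>lam B K. B \<ge> 0 \<and> K \<ge> 0 \<and> (\<forall>z. \<not> is_pole l z \<longrightarrow> cmod (v z) \<ge> 1 \<longrightarrow>
      cmod ((l z - lam)\<^sup>2 - 2 / (1 - 2 * k) * v z) \<le> B * exp (K * cmod z) * sqrt (cmod (v z)))"
proof -
  obtain p0 where p0: "is_pole v p0" using D by (auto simp: D_def)
  obtain r s W where L: "r > 0" "s holomorphic_on ball 0 r" "W holomorphic_on ball 0 r" "s 0 = 0"
      "\<And>t. t \<in> ball 0 r \<Longrightarrow> W t = (2 - 4 * k) + (4 * k - 1) * s t + t * deriv s t - k * (s t)\<^sup>2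
        + 2 * p * t - p * t * s t - q * t\<^sup>2"
      "\<And>t. t \<in> ball 0 r \<Longrightarrow> t * deriv W t = s t * W t"
    using pole_local[OF p0] by metis
  interpret a: laurent_coefficients k p q "fps_nth (fps_expansion s 0)" "fps_nth (fps_expansion W 0)"
    by (rule pole_coefficients[OF L])
  have k2: "1 - 2 * k \<noteq> 0"
  proof
    assume "1 - 2 * k = 0"
    then have "2 - 4 * k = 0" by (simp add: algebra_simps)
    then show False using n by auto
  qed
  \<comment> \<open>Origin of the witnesses below: equating the two formulas for \<tau> gives lam =
    2p/(1 - 4k), and then q0 = 0 if p is nonzero or k = 0. For p = 0 and k nonzero one takes lam =
    \<tau> = 0 and q0 = q/k.\<close>
  have use: ?thesis if h: "4 * k = of_int m" "m \<le> 1" "\<tau> = lam * (1 - 2 * k)" "\<tau> = 2 * p + 2 * k * lam"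
    "2 * q - 2 * lam * p = 2 * k * lam\<^sup>2 + 2 * k * q0 - 2 * lam * \<tau>" "- 2 * lam * q = \<tau> * (lam\<^sup>2 + q0)"
    for m :: int and lam q0 \<tau>
  proof -
    obtain B K where "B \<ge> 0" "K \<ge> 0"
      "\<And>z. \<not> is_pole l z \<Longrightarrow> cmod (v z) \<ge> 1 \<Longrightarrow>
        cmod ((l z - lam)\<^sup>2 - 2 / (1 - 2 * k) * v z) \<le> B * exp (K * cmod z) * sqrt (cmod (v z))"
      using first_integral[OF h(1,2) k2 h(3-6)] by blast
    then show ?thesis by blast
  qed
  consider "k = 1 / 4" | "k = 0" | "k = - 1 / 4" | "k = - 1 / 2" | "k = - 1"
  proof -
    have k: "k = (2 - of_nat n) / 4" using n(1) by (simp add: field_simps)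
    have "n = 1 \<Longrightarrow> k = 1 / 4" "n = 2 \<Longrightarrow> k = 0" "n = 3 \<Longrightarrow> k = - 1 / 4" "n = 4 \<Longrightarrow> k = - 1 / 2"
      "n = 6 \<Longrightarrow> k = - 1"
      unfolding k by simp_all
    then show ?thesis using n(2) that by blast
  qed
  then show ?thesis
  proof cases
    case 1
    then have "p = 0" by (rule a.integrability(1))
    then show ?thesis by (intro use[of 1 0 0 "4 * q"]) (simp_all add: 1)
  next
    case 2
    then have "q = - 2 * p ^ 2" by (rule a.integrability(2))
    then show ?thesis
      by (intro use[of 0 "2 * p" "2 * p" 0]) (simp_all add: 2 power2_eq_square)
  next
    case 3
    then have o: "p * (3 * p ^ 2 + 4 * q) = 0" by (rule a.integrability(3))
    show ?thesis
    proof (cases "p = 0")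
      case True
      then show ?thesis by (intro use[of "- 1" 0 0 "- 4 * q"]) (simp_all add: 3)
    next
      case False
      then have "3 * p\<^sup>2 + 4 * q = 0" using o by simp
      then have "4 * q = - 3 * p\<^sup>2" by algebra
      then have "q = - 3 / 4 * p\<^sup>2" by (simp add: field_simps)
      then show ?thesis
        by (intro use[of "- 1" "3 / 2 * p" p 0]) (simp_all add: 3 power2_eq_square)
    qed
  next
    case 4
    then have o: "p * (4 * p ^ 2 + 9 * q) = 0" by (rule a.integrability(4))
    show ?thesis
    proof (cases "p = 0")
      case True
      then show ?thesis by (intro use[of "- 2" 0 0 "- 2 * q"]) (simp_all add: 4)
    next
      case False
      then have "4 * p\<^sup>2 + 9 * q = 0" using o by simp
      then have "9 * q = - 4 * p\<^sup>2" by algebra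
      then have "q = - 4 / 9 * p\<^sup>2" by (simp add: field_simps)
      then show ?thesis
        by (intro use[of "- 2" "4 / 3 * p" "2 / 3 * p" 0]) (simp_all add: 4 power2_eq_square)
    qed
  next
    case 5
    then have o: "p * (36 * p ^ 4 - 625 * q ^ 2) = 0" by (rule a.integrability(5))
    show ?thesis
    proof (cases "p = 0")
      case True
      then show ?thesis by (intro use[of "- 4" 0 0 "- q"]) (simp_all add: 5)
    next
      case False
      then have "36 * p ^ 4 - 625 * q\<^sup>2 = 0" using o by simp
      \<comment> \<open>The relation splits into two branches: 25 q = -6 p^2 admits the quadratic
        first integral, whereas 25 q = 6 p^2 requires the cubic one.\<close>
      then have "(6 * p\<^sup>2 - 25 * q) * (6 * p\<^sup>2 + 25 * q) = 0" by algebra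
      then have "6 * p\<^sup>2 - 25 * q = 0 \<or> 6 * p\<^sup>2 + 25 * q = 0" by simp
      then have "25 * q = 6 * p\<^sup>2 \<or> 25 * q = - 6 * p\<^sup>2" by algebra
      then consider "q = 6 / 25 * p\<^sup>2" | "q = - 6 / 25 * p\<^sup>2"
        by (auto simp: field_simps)
      then show ?thesis
      proof cases
        case 1
        have "5 * (2 / 5 * p) = 2 * p" "2 * q = 3 * (2 / 5 * p)\<^sup>2"
          using 1 by (simp_all add: power2_eq_square field_simps)
        then obtain B K where "B \<ge> 0" "K \<ge> 0"
          "\<And>z. \<not> is_pole l z \<Longrightarrow> cmod (v z) \<ge> 1 \<Longrightarrow>
            cmod ((l z - 2 / 5 * p)\<^sup>2 - 2 / (1 - 2 * k) * v z) \<le> B * exp (K * cmod z) * sqrt (cmod (v z))"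
          by (rule first_integral_cubic[OF 5]) (rule that)
        then show ?thesis by (intro exI[of _ "2 / 5 * p"] exI[of _ B] exI[of _ K]) simp
      next
        case 2
        then show ?thesis
          by (intro use[of "- 4" "6 / 5 * p" "2 / 5 * p" 0]) (simp_all add: 5 power2_eq_square)
      qed
    qed
  qed
qed

end

section \<open>Separation of poles in all admissible cases\<close>

context log_deriv_ode
begin

lemma separation_admissible:
  assumes adm: "\<And>n. n \<ge> 1 \<Longrightarrow> 2 - 4 * k = of_nat n \<Longrightarrow> n \<in> {1, 2, 3, 4, 6}"
  obtains c K where "c > 0" "K \<ge> 0"
    "\<And>R x y. R \<ge> 0 \<Longrightarrow> x \<in> D \<Longrightarrow> y \<in> D \<Longrightarrow> x \<noteq> y \<Longrightarrow> cmod x \<le> R \<Longrightarrow> cmod y \<le> R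
        \<Longrightarrow> c * exp (- K * R) \<le> dist x y"
proof (cases "D = {}")
  case True
  then show ?thesis using that[of 1 0] by auto
next
  case D: False
  show ?thesis
  proof (cases "\<exists>n\<ge>1. 2 - 4 * k = of_nat n")
    case True
    then obtain n where n: "n \<ge> 1" "2 - 4 * k = of_nat n" by blast
    obtain lam B K where H: "B \<ge> 0" "K \<ge> 0" "\<And>z. \<not> is_pole l z \<Longrightarrow> cmod (v z) \<ge> 1 \<Longrightarrow>
      cmod ((l z - lam)\<^sup>2 - 2 / (1 - 2 * k) * v z) \<le> B * exp (K * cmod z) * sqrt (cmod (v z))"
      using first_integral_of_resonant_pole[OF D n(2) adm[OF n]] by blast
    have k2: "1 - 2 * k \<noteq> 0"
    proof
      assume "1 - 2 * k = 0"
      then have "2 - 4 * k = 0" by (simp add: algebra_simps)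
      then show False using n by auto
    qed
    show ?thesis
    proof (rule separation_from_first_integral[OF k2 H(1,2)])
      fix c assume "c > 0" "\<And>R x y. R \<ge> 0 \<Longrightarrow> x \<in> D \<Longrightarrow> y \<in> D \<Longrightarrow> x \<noteq> y \<Longrightarrow> cmod x \<le> R \<Longrightarrow> cmod y \<le> R
        \<Longrightarrow> c * exp (- K * R) \<le> dist x y"
      then show ?thesis by (rule that[OF _ H(2)])
    qed (rule H(3))
  next
    case False
    then obtain c where c: "c > 0" "\<And>x y. x \<in> D \<Longrightarrow> y \<in> D \<Longrightarrow> x \<noteq> y \<Longrightarrow> c \<le> dist x y"
      using separation_nonresonant by blast
    show ?thesis by (rule that[OF c(1), of 0]) (use c(2) in auto)
  qed
qed

end

section \<open>Reduction of the original equation to the system for l and v\<close>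

context double_product_solution
begin

lemma growth_generic:
  assumes a2: "a2 \<noteq> 0" "a1 \<noteq> a2" and v0: "\<forall>z\<in>S. v0 z \<noteq> 0"
    and adm: "\<And>n. n \<ge> 1 \<Longrightarrow> 2 - 4 * (a1 / a2) = of_nat n \<Longrightarrow> n \<in> {1, 2, 3, 4, 6}"
  shows growth_bound
proof -
  \<comment> \<open>From a1 u + b1 = k l + (b1 - k b2) and a2 (u - \<alpha>) = l - (b2 + a2
    \<alpha>): the product of the two right-hand sides is k l^2 + p l + q.\<close>
  define k p q where "k = a1 / a2" and "p = b1 - k * b2 - k * (b2 + a2 * \<alpha>)" and "q = - (b1 - k * b2) * (b2 + a2 * \<alpha>)"
  define l v where "l = (\<lambda>z. if is_pole u z then 0 else a2 * u z + b2)"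
    and "v = (\<lambda>z. if is_pole u z then 0 else a2 * v0 z)"
  have a1: "a1 = k * a2" using a2 by (simp add: k_def)
  have ev: "eventually (\<lambda>w. l w = a2 * u w + b2) (at z)" for z
  proof -
    have "eventually (\<lambda>w. \<not> is_pole u w) (cosparse UNIV)"
      by (rule meromorphic_on_imp_not_pole_cosparse[OF mero])
    then have "eventually (\<lambda>w. \<not> is_pole u w) (at z)"
      by (rule eventually_cosparse_imp_eventually_at) auto
    then show ?thesis by eventually_elim (simp add: l_def)
  qed
  have pole_iff: "is_pole l z \<longleftrightarrow> is_pole u z" for z
    using is_pole_cong[OF ev refl, of z] a2
    by (simp add: is_pole_plus_const_iff[symmetric])
  have l_der: "(l has_field_derivative a2 * ((a1 * u z + b1) * (u z - \<alpha>) + v0 z)) (at z)" if "z \<in> S" for z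
  proof -
    have "((\<lambda>z. a2 * u z + b2) has_field_derivative a2 * ((a1 * u z + b1) * (u z - \<alpha>) + v0 z)) (at z)"
      by (rule DERIV_cong[OF DERIV_add[OF DERIV_cmult[OF u_deriv[OF that]] DERIV_const]]) simp
    then show ?thesis
      by (rule has_field_derivative_transform_within_open[OF _ S_open that]) (simp add: l_def S_def)
  qed
  have v_der: "(v has_field_derivative l z * v z) (at z)" if "z \<in> S" for z
  proof -
    have "((\<lambda>z. a2 * v0 z) has_field_derivative a2 * ((a2 * u z + b2) * v0 z)) (at z)"
      by (rule DERIV_cmult[OF v0_deriv[OF that]])
    then have "(v has_field_derivative a2 * ((a2 * u z + b2) * v0 z)) (at z)"
      by (rule has_field_derivative_transform_within_open[OF _ S_open that]) (simp add: v_def S_def)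
    then show ?thesis using that by (simp add: l_def v_def S_def mult_ac)
  qed
  have l_mero: "l meromorphic_on UNIV"
  proof -
    have "(\<lambda>z. a2 * u z + b2) meromorphic_on UNIV" by (intro meromorphic_intros mero)
    moreover have "l meromorphic_on UNIV \<longleftrightarrow> (\<lambda>z. a2 * u z + b2) meromorphic_on UNIV"
      by (intro meromorphic_on_cong ev refl)
    ultimately show ?thesis by simp
  qed
  interpret c: log_deriv_ode k p q l v
  proof
    show "l nicely_meromorphic_on UNIV"
      unfolding nicely_meromorphic_on_def
    proof (intro conjI ballI l_mero)
      fix z
      show "is_pole l z \<and> l z = 0 \<or> l \<midarrow>z\<rightarrow> l z"
      proof (cases "is_pole u z")
        case False
        then have "isCont l z" using l_der[of z] DERIV_isCont by (auto simp: S_def)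
        then show ?thesis by (simp add: isCont_def)
      next
        case True
        then have "is_pole l z" "l z = 0" by (simp add: pole_iff) (simp add: l_def True)
        then show ?thesis by simp
      qed
    qed
    show "v z = deriv l z - k * (l z)\<^sup>2 - p * l z - q" if "\<not> is_pole l z" for z
    proof -
      have z: "z \<in> S" using that by (simp add: pole_iff S_def)
      have "deriv l z = a2 * ((a1 * u z + b1) * (u z - \<alpha>) + v0 z)"
        by (rule DERIV_imp_deriv[OF l_der[OF z]])
      moreover have "l z = a2 * u z + b2" "v z = a2 * v0 z" using z by (simp_all add: l_def v_def S_def)
      ultimately show ?thesis
        unfolding a1 p_def q_def by (simp add: algebra_simps power2_eq_square)
    qed
    show "v z = 0" if "is_pole l z" for z using that by (simp add: pole_iff v_def)
    show "(v has_field_derivative l z * v z) (at z)" if "\<not> is_pole l z" for z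
      using that v_der by (simp add: pole_iff S_def)
    show "v z \<noteq> 0" if "\<not> is_pole l z" for z
      using that v0 a2 by (simp add: pole_iff S_def v_def)
    show "k \<noteq> 1" using a2 by (simp add: k_def)
  qed
  obtain c K where sep: "c > 0" "K \<ge> 0"
    "\<And>R x y. R \<ge> 0 \<Longrightarrow> x \<in> c.D \<Longrightarrow> y \<in> c.D \<Longrightarrow> x \<noteq> y \<Longrightarrow> cmod x \<le> R \<Longrightarrow> cmod y \<le> R
        \<Longrightarrow> c * exp (- K * R) \<le> dist x y"
    using c.separation_admissible adm unfolding k_def by metis
  show ?thesis
  proof (rule c.growth_from_separation[OF nice a2(1) _ sep])
    show "\<not> is_pole l z \<and> a2 * u z = l z - b2" if "\<not> is_pole u z" for z
    proof
      show "\<not> is_pole l z" using that by (simp add: pole_iff)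
      show "a2 * u z = l z - b2" using that by (simp add: l_def)
    qed
  qed
qed

theorem growth_admissible:
  assumes "admissible a1 a2"
  shows growth_bound
proof -
  obtain z0 where z0: "z0 \<in> S" using S_nonempty by blast
  consider "\<forall>z\<in>S. v0 z = 0" | "a2 = 0" | "a2 \<noteq> 0" "a1 = a2" | "a2 \<noteq> 0" "a1 \<noteq> a2" "\<forall>z\<in>S. v0 z \<noteq> 0"
    using v0_zero_or_nonzero by blast
  then show ?thesis
  proof cases
    case 1
    show ?thesis by (rule growth_v0_exponential[of 0 0]) (use 1 in auto)
  next
    case 2
    define c where "c = v0 z0 * exp (- b2 * z0)"
    have "\<forall>z\<in>S. v0 z - c * exp (b2 * z) = 0"
    proof (rule linear_ode_zero[OF S_open S_connected z0 holomorphic_on_const[of b2]])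
      have e: "((\<lambda>z. c * exp (b2 * z)) has_field_derivative b2 * (c * exp (b2 * z))) (at z)" for z
        by (auto intro!: derivative_eq_intros)
      show "((\<lambda>z. v0 z - c * exp (b2 * z)) has_field_derivative b2 * (v0 z - c * exp (b2 * z))) (at z)"
        if "z \<in> S" for z
        by (rule DERIV_cong[OF DERIV_diff[OF v0_deriv[OF that] e]]) (simp add: 2 algebra_simps)
      have "exp (- b2 * z0) * exp (b2 * z0) = 1" by (simp flip: exp_add)
      then show "v0 z0 - c * exp (b2 * z0) = 0" by (simp only: c_def mult.assoc mult_1_right diff_self)
    qed
    then show ?thesis by (intro growth_v0_exponential[of c b2]) auto
  next
    case 3
    then show ?thesis by (intro growth_equal_coeffs) auto
  next
    case 4
    have "n \<in> {1, 2, 3, 4, 6}" if n: "n \<ge> 1" "2 - 4 * (a1 / a2) = of_nat n" for n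
    proof (rule ccontr)
      assume "n \<notin> {1, 2, 3, 4, 6}"
      then have "2 - 4 * a1 / a2 \<in> of_nat ` ({1..} - {1, 2, 3, 4, 6})"
        using n by auto
      \<comment> \<open>Here a2 is nonzero, so a1 a2 = 0 would mean a1 = 0 and 2 - 4k = 2, which
        belongs to the list.\<close>
      moreover have "a1 * a2 \<noteq> 0"
      proof
        assume "a1 * a2 = 0"
        then have "of_nat n = (of_nat 2 :: complex)" using n(2) 4(1) by simp
        then have "n = 2" by (simp only: of_nat_eq_iff)
        then show False using \<open>n \<notin> {1, 2, 3, 4, 6}\<close> by simp
      qed
      ultimately show False using assms by (simp add: admissible_def)
    qed
    then show ?thesis using 4 by (intro growth_generic) auto
  qed
qed

end

theorem theorem1p10:
  shows "(\<forall>a1 a2 b1 b2 \<alpha> :: complex. admissible a1 a2 \<longrightarrow>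
            (\<forall>u. meromorphic_solution a1 a2 b1 b2 \<alpha> u \<longrightarrow>
               (\<exists>a b c :: real. a > 0 \<and> b > 0 \<and> c > 0 \<and>
                  (\<forall>r\<ge>0. nevanlinna_T r u < a * exp (b * r powr c))))) \<and>
         (\<exists>a1 a2 b1 b2 \<alpha> :: complex. admissible a1 a2 \<and>
            (\<exists>u. meromorphic_solution a1 a2 b1 b2 \<alpha> u \<and>
               (\<exists>A B C :: real. A > 0 \<and> B > 0 \<and> C > 0 \<and>
                  (\<forall>\<^sub>F r in at_top. nevanlinna_T r u \<ge> A * exp (B * r powr C)))))"
proof (rule conjI)
  show "\<forall>a1 a2 b1 b2 \<alpha> :: complex. admissible a1 a2 \<longrightarrow>
            (\<forall>u. meromorphic_solution a1 a2 b1 b2 \<alpha> u \<longrightarrow>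
               (\<exists>a b c :: real. a > 0 \<and> b > 0 \<and> c > 0 \<and>
                  (\<forall>r\<ge>0. nevanlinna_T r u < a * exp (b * r powr c))))"
    using double_product_solution.growth_admissible[OF double_product_solution.intro] by blast
  have "admissible 1 0" by (simp add: admissible_def)
  moreover have "0 < ln 2 / (8::real)" "0 < 1 / (2::real)" "0 < (1::real)" by auto
  ultimately show "\<exists>a1 a2 b1 b2 \<alpha> :: complex. admissible a1 a2 \<and>
            (\<exists>u. meromorphic_solution a1 a2 b1 b2 \<alpha> u \<and>
               (\<exists>A B C :: real. A > 0 \<and> B > 0 \<and> C > 0 \<and>
                  (\<forall>\<^sub>F r in at_top. nevanlinna_T r u \<ge> A * exp (B * r powr C))))"
    using meromorphic_solution_exp_tan_exp nevanlinna_T_exp_tan_exp_ge by blast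
qed

end
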